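(* Let $\Gamma$ be a thick locally finitely generated generalized $n$-gon with $n\in\{4,6\}$, and let $\gamma:\Gamma\to\Delta$ be an epimorphism, with $\Delta$ a thin $n$-gon of order $(s,1)$. Then $s=1$, and, after a suitable naming of the points of $\Delta$, $\gamma$ is of type (a) or of type (b) (the types for $n=4$, respectively $n=6$, being those defined in the context).
   Context: Polygons. A point-line geometry is a weak generalized $n$-gon ($n\ge 3$) if any two elements (points or lines) lie in a common ordinary sub $n$-gon and there are no ordinary sub $k$-gons for $2\le k<n$; it is thick (a generalized $n$-gon) if every point is on at least three lines and every line has at least three points, and thin if it is not thick. Order $(u,v)$: each line has $u+1$ points and each point is on $v+1$ lines (possibly infinite). A morphism maps points to points, lines to lines, and preserves incidence; an epimorphism is a morphism surjective on points and on lines. $x\sim y$ means collinear; $\overline{x}\overline{y}$ is the line joining distinct collinear points. The point-line dual is obtained by interchanging points and lines. Locally finitely generated. A sub $n$-gon is a (thin or thick) weak generalized $n$-gon whose points and lines are points and lines of $\Gamma$, with induced incidence. For a point set $S$ of $\Gamma$, $\langle S\rangle$ is the intersection of all (thin and thick) sub $n$-gons containing $S$. A thick generalized $n$-gon $\Gamma$ is locally finitely generated if for every finite point subset $S$ for which $\langle S\rangle$ is a (possibly thin) sub $n$-gon, $\langle S\rangle$ is finite. Type (a), $n=4$. $\Delta$ has points $\overline{a}\sim\overline{b}\sim\overline{c}\sim\overline{d}\sim\overline{a}$; write $\widetilde{X}=\gamma^{-1}(\overline{x})$. There is a line $L$ of $\Gamma$ such that $(\widetilde{A},\widetilde{B})$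 is a partition of the points incident with $L$ into two nonempty sets; $\widetilde{C}$ (resp. $\widetilde{D}$) consists of the points not on $L$ collinear with a point of $\widetilde{B}$ (resp. $\widetilde{A}$); $\gamma^{-1}(\overline{a}\overline{b})=\{L\}$; $\gamma^{-1}(\overline{b}\overline{c})$ (resp. $\gamma^{-1}(\overline{a}\overline{d})$) is the set of lines distinct from $L$ incident with a point of $\widetilde{B}$ (resp. $\widetilde{A}$); $\gamma^{-1}(\overline{c}\overline{d})$ consists of the lines incident with at least one point of $\widetilde{C}$ and at least one point of $\widetilde{D}$. Type (a), $n=6$. $\Delta$ has points $\overline{a}\sim\overline{b}\sim\overline{c}\sim\overline{d}\sim\overline{e}\sim\overline{f}\sim\overline{a}$; write $\widetilde{X}=\gamma^{-1}(\overline{x})$. There is a line $L$ of $\Gamma$ such that $(\widetilde{C},\widetilde{B})$ is a partition of the points incident with $L$ into two nonempty sets; $\widetilde{D}$ (resp. $\widetilde{A}$) consists of the points not on $L$ collinear with a point of $\widetilde{C}$ (resp. $\widetilde{B}$); $\widetilde{E}$ consists of the points not in $\widetilde{C}\cup\widetilde{D}$ collinear with a point of $\widetilde{D}$; $\widetilde{F}$ consists of the points not in $\widetilde{A}\cup\widetilde{B}$ collinear with a point of $\widetilde{A}$; $\gamma^{-1}(\overline{b}\overline{c})=\{L\}$; $\gamma^{-1}(\overline{c}\overline{d})$ (resp. $\gamma^{-1}(\overline{a}\overline{b})$) is the set of lines distinct from $L$ incident with a point of $\widetilde{C}$ (resp. $\widetilde{B}$); $\gamma^{-1}(\overline{d}\overline{e})$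 is the set of lines not in $\gamma^{-1}(\overline{c}\overline{d})$ incident with a point of $\widetilde{D}$; $\gamma^{-1}(\overline{f}\overline{a})$ is the set of lines not in $\gamma^{-1}(\overline{a}\overline{b})$ incident with a point of $\widetilde{A}$; $\gamma^{-1}(\overline{f}\overline{e})$ is the set of lines not in $\gamma^{-1}(\overline{f}\overline{a})$ incident with a point of $\widetilde{F}$ (equivalently, the lines not in $\gamma^{-1}(\overline{d}\overline{e})$ incident with a point of $\widetilde{E}$). Type (b). $\gamma$, regarded as an epimorphism from the point-line dual of $\Gamma$ onto the point-line dual of $\Delta$, is of type (a). *)

theory Defs
  imports "HOL-Library.Extended_Nat"
begin

record ('p, 'l) geometry =
  Pts :: "'p set"
  Lns :: "'l set"
  Inc :: "'p \<Rightarrow> 'l \<Rightarrow> bool"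

definition point_line_geometry :: "('p, 'l) geometry \<Rightarrow> bool" where
  "point_line_geometry G \<longleftrightarrow>
     Pts G \<noteq> {} \<and> Lns G \<noteq> {} \<and> (\<forall>p l. Inc G p l \<longrightarrow> p \<in> Pts G \<and> l \<in> Lns G)"

definition dual :: "('p, 'l) geometry \<Rightarrow> ('l, 'p) geometry" where
  "dual G = \<lparr>Pts = Lns G, Lns = Pts G, Inc = (\<lambda>l p. Inc G p l)\<rparr>"

definition elements :: "('p, 'l) geometry \<Rightarrow> ('p + 'l) set" where
  "elements G = Pts G <+> Lns G"

text \<open>Subgeometries always carry the induced incidence.\<close>

definition subgeometry :: "('p, 'l) geometry \<Rightarrow> ('p, 'l) geometry \<Rightarrow> bool" where
  "subgeometry H G \<longleftrightarrow>
     Pts H \<subseteq> Pts G \<and> Lns H \<subseteq> Lns G \<and>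
     (\<forall>p l. Inc H p l \<longleftrightarrow> p \<in> Pts H \<and> l \<in> Lns H \<and> Inc G p l)"

text \<open>An ordinary \<open>k\<close>-gon has points \<open>p 0, \<dots>, p (k - 1)\<close> and sides \<open>m 0, \<dots>, m (k - 1)\<close>,
  where \<open>m j\<close> joins \<open>p j\<close> and \<open>p (j + 1)\<close>, indices modulo \<open>k\<close>. For \<open>k = 2\<close>
  this is two points both incident with two lines.\<close>

definition ordinary_polygon :: "nat \<Rightarrow> ('p, 'l) geometry \<Rightarrow> bool" where
  "ordinary_polygon k H \<longleftrightarrow>
     (\<exists>p m. bij_betw p {..<k} (Pts H) \<and> bij_betw m {..<k} (Lns H) \<and>
        (\<forall>i<k. \<forall>j<k. Inc H (p i) (m j) \<longleftrightarrow> i = j \<or> i = (j + 1) mod k))"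

definition weak_polygon :: "nat \<Rightarrow> ('p, 'l) geometry \<Rightarrow> bool" where
  "weak_polygon n G \<longleftrightarrow>
     3 \<le> n \<and> point_line_geometry G \<and>
     (\<forall>x\<in>elements G. \<forall>y\<in>elements G.
        \<exists>H. subgeometry H G \<and> ordinary_polygon n H \<and> x \<in> elements H \<and> y \<in> elements H) \<and>
     (\<forall>k. 2 \<le> k \<and> k < n \<longrightarrow> \<not> (\<exists>H. subgeometry H G \<and> ordinary_polygon k H))"

definition ecard :: "'a set \<Rightarrow> enat" where
  "ecard A = (if finite A then enat (card A) else \<infinity>)"

definition points_on :: "('p, 'l) geometry \<Rightarrow> 'l \<Rightarrow> 'p set" where
  "points_on G l = {p \<in> Pts G. Inc G p l}"

definition lines_through :: "('p, 'l) geometry \<Rightarrow> 'p \<Rightarrow> 'l set" where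
  "lines_through G p = {l \<in> Lns G. Inc G p l}"

definition thick :: "('p, 'l) geometry \<Rightarrow> bool" where
  "thick G \<longleftrightarrow>
     (\<forall>p\<in>Pts G. 3 \<le> ecard (lines_through G p)) \<and> (\<forall>l\<in>Lns G. 3 \<le> ecard (points_on G l))"

definition thick_polygon :: "nat \<Rightarrow> ('p, 'l) geometry \<Rightarrow> bool" where
  "thick_polygon n G \<longleftrightarrow> weak_polygon n G \<and> thick G"

definition thin_polygon :: "nat \<Rightarrow> ('p, 'l) geometry \<Rightarrow> bool" where
  "thin_polygon n G \<longleftrightarrow> weak_polygon n G \<and> \<not> thick G"

definition has_order :: "('p, 'l) geometry \<Rightarrow> enat \<Rightarrow> enat \<Rightarrow> bool" where
  "has_order G u v \<longleftrightarrow>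
     (\<forall>l\<in>Lns G. ecard (points_on G l) = u + 1) \<and>
     (\<forall>p\<in>Pts G. ecard (lines_through G p) = v + 1)"

definition sub_polygon :: "nat \<Rightarrow> ('p, 'l) geometry \<Rightarrow> ('p, 'l) geometry \<Rightarrow> bool" where
  "sub_polygon n H G \<longleftrightarrow> subgeometry H G \<and> weak_polygon n H"

text \<open>The intersection of all sub \<open>n\<close>-gons of \<open>G\<close> containing \<open>S\<close>, with the induced incidence.
  It need not itself be a sub \<open>n\<close>-gon.\<close>

definition generated :: "nat \<Rightarrow> ('p, 'l) geometry \<Rightarrow> 'p set \<Rightarrow> ('p, 'l) geometry" where
  "generated n G S =
     (let P = \<Inter> {Pts H | H. sub_polygon n H G \<and> S \<subseteq> Pts H};
          L = \<Inter> {Lns H | H. sub_polygon n H G \<and> S \<subseteq> Pts H}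
      in \<lparr>Pts = P, Lns = L, Inc = (\<lambda>p l. p \<in> P \<and> l \<in> L \<and> Inc G p l)\<rparr>)"

definition locally_finitely_generated :: "nat \<Rightarrow> ('p, 'l) geometry \<Rightarrow> bool" where
  "locally_finitely_generated n G \<longleftrightarrow>
     (\<forall>S. finite S \<and> S \<subseteq> Pts G \<and> sub_polygon n (generated n G S) G \<longrightarrow>
        finite (Pts (generated n G S)) \<and> finite (Lns (generated n G S)))"

text \<open>A morphism is given by its action \<open>f\<close> on points and its action \<open>g\<close> on lines.\<close>

definition morphism ::
  "('p, 'l) geometry \<Rightarrow> ('q, 'm) geometry \<Rightarrow> ('p \<Rightarrow> 'q) \<Rightarrow> ('l \<Rightarrow> 'm) \<Rightarrow> bool" where
  "morphism G D f g \<longleftrightarrow>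
     f ` Pts G \<subseteq> Pts D \<and> g ` Lns G \<subseteq> Lns D \<and>
     (\<forall>p\<in>Pts G. \<forall>l\<in>Lns G. Inc G p l \<longrightarrow> Inc D (f p) (g l))"

definition epimorphism ::
  "('p, 'l) geometry \<Rightarrow> ('q, 'm) geometry \<Rightarrow> ('p \<Rightarrow> 'q) \<Rightarrow> ('l \<Rightarrow> 'm) \<Rightarrow> bool" where
  "epimorphism G D f g \<longleftrightarrow> morphism G D f g \<and> f ` Pts G = Pts D \<and> g ` Lns G = Lns D"

definition collinear_in :: "('p, 'l) geometry \<Rightarrow> 'p \<Rightarrow> 'p \<Rightarrow> bool" where
  "collinear_in G x y \<longleftrightarrow>
     x \<in> Pts G \<and> y \<in> Pts G \<and> (\<exists>l\<in>Lns G. Inc G x l \<and> Inc G y l)"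

text \<open>Meaningful only for distinct collinear points of a weak polygon, where the line is unique.\<close>

definition join :: "('p, 'l) geometry \<Rightarrow> 'p \<Rightarrow> 'p \<Rightarrow> 'l" where
  "join G x y = (THE l. l \<in> Lns G \<and> Inc G x l \<and> Inc G y l)"

definition fibre :: "('a \<Rightarrow> 'b) \<Rightarrow> 'a set \<Rightarrow> 'b \<Rightarrow> 'a set" where
  "fibre f X y = {x \<in> X. f x = y}"

definition type_a_quadrangle ::
  "('p, 'l) geometry \<Rightarrow> ('q, 'm) geometry \<Rightarrow> ('p \<Rightarrow> 'q) \<Rightarrow> ('l \<Rightarrow> 'm) \<Rightarrow>
   'q \<Rightarrow> 'q \<Rightarrow> 'q \<Rightarrow> 'q \<Rightarrow> bool" where
  "type_a_quadrangle G D \<phi> \<psi> a b c d \<longleftrightarrow>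
     Pts D = {a, b, c, d} \<and> distinct [a, b, c, d] \<and>
     collinear_in D a b \<and> collinear_in D b c \<and> collinear_in D c d \<and> collinear_in D d a \<and>
     (let Ta = fibre \<phi> (Pts G) a; Tb = fibre \<phi> (Pts G) b;
          Tc = fibre \<phi> (Pts G) c; Td = fibre \<phi> (Pts G) d;
          lfib = (\<lambda>x y. fibre \<psi> (Lns G) (join D x y))
      in \<exists>L\<in>Lns G.
           Ta \<union> Tb = points_on G L \<and> Ta \<inter> Tb = {} \<and> Ta \<noteq> {} \<and> Tb \<noteq> {} \<and>
           Tc = {p \<in> Pts G. \<not> Inc G p L \<and> (\<exists>q\<in>Tb. collinear_in G p q)} \<and>
           Td = {p \<in> Pts G. \<not> Inc G p L \<and> (\<exists>q\<in>Ta. collinear_in G p q)} \<and>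
           lfib a b = {L} \<and>
           lfib b c = {l \<in> Lns G. l \<noteq> L \<and> (\<exists>p\<in>Tb. Inc G p l)} \<and>
           lfib a d = {l \<in> Lns G. l \<noteq> L \<and> (\<exists>p\<in>Ta. Inc G p l)} \<and>
           lfib c d = {l \<in> Lns G. (\<exists>p\<in>Tc. Inc G p l) \<and> (\<exists>p\<in>Td. Inc G p l)})"

definition type_a_hexagon ::
  "('p, 'l) geometry \<Rightarrow> ('q, 'm) geometry \<Rightarrow> ('p \<Rightarrow> 'q) \<Rightarrow> ('l \<Rightarrow> 'm) \<Rightarrow>
   'q \<Rightarrow> 'q \<Rightarrow> 'q \<Rightarrow> 'q \<Rightarrow> 'q \<Rightarrow> 'q \<Rightarrow> bool" where
  "type_a_hexagon G D \<phi> \<psi> a b c d e f \<longleftrightarrow>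
     Pts D = {a, b, c, d, e, f} \<and> distinct [a, b, c, d, e, f] \<and>
     collinear_in D a b \<and> collinear_in D b c \<and> collinear_in D c d \<and>
     collinear_in D d e \<and> collinear_in D e f \<and> collinear_in D f a \<and>
     (let Ta = fibre \<phi> (Pts G) a; Tb = fibre \<phi> (Pts G) b; Tc = fibre \<phi> (Pts G) c;
          Td = fibre \<phi> (Pts G) d; Te = fibre \<phi> (Pts G) e; Tf = fibre \<phi> (Pts G) f;
          lfib = (\<lambda>x y. fibre \<psi> (Lns G) (join D x y))
      in \<exists>L\<in>Lns G.
           Tc \<union> Tb = points_on G L \<and> Tc \<inter> Tb = {} \<and> Tc \<noteq> {} \<and> Tb \<noteq> {} \<and>
           Td = {p \<in> Pts G. \<not> Inc G p L \<and> (\<exists>q\<in>Tc. collinear_in G p q)} \<and>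
           Ta = {p \<in> Pts G. \<not> Inc G p L \<and> (\<exists>q\<in>Tb. collinear_in G p q)} \<and>
           Te = {p \<in> Pts G. p \<notin> Tc \<union> Td \<and> (\<exists>q\<in>Td. collinear_in G p q)} \<and>
           Tf = {p \<in> Pts G. p \<notin> Ta \<union> Tb \<and> (\<exists>q\<in>Ta. collinear_in G p q)} \<and>
           lfib b c = {L} \<and>
           lfib c d = {l \<in> Lns G. l \<noteq> L \<and> (\<exists>p\<in>Tc. Inc G p l)} \<and>
           lfib a b = {l \<in> Lns G. l \<noteq> L \<and> (\<exists>p\<in>Tb. Inc G p l)} \<and>
           lfib d e = {l \<in> Lns G. l \<notin> lfib c d \<and> (\<exists>p\<in>Td. Inc G p l)} \<and>
           lfib f a = {l \<in> Lns G. l \<notin> lfib a b \<and> (\<exists>p\<in>Ta. Inc G p l)} \<and>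
           lfib f e = {l \<in> Lns G. l \<notin> lfib f a \<and> (\<exists>p\<in>Tf. Inc G p l)} \<and>
           lfib f e = {l \<in> Lns G. l \<notin> lfib d e \<and> (\<exists>p\<in>Te. Inc G p l)})"

text \<open>The existential quantifiers express the suitable naming of the points of \<open>D\<close>.\<close>

definition type_a ::
  "nat \<Rightarrow> ('p, 'l) geometry \<Rightarrow> ('q, 'm) geometry \<Rightarrow> ('p \<Rightarrow> 'q) \<Rightarrow> ('l \<Rightarrow> 'm) \<Rightarrow> bool" where
  "type_a n G D f g \<longleftrightarrow>
     n = 4 \<and> (\<exists>a b c d. type_a_quadrangle G D f g a b c d) \<or>
     n = 6 \<and> (\<exists>a b c d e h. type_a_hexagon G D f g a b c d e h)"

definition type_b ::
  "nat \<Rightarrow> ('p, 'l) geometry \<Rightarrow> ('q, 'm) geometry \<Rightarrow> ('p \<Rightarrow> 'q) \<Rightarrow> ('l \<Rightarrow> 'm) \<Rightarrow> bool" where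
  "type_b n G D f g \<longleftrightarrow> type_a n (dual G) (dual D) g f"

end

theory Submission
  imports Defs
begin

text \<open>
  Everything happens in incidence graphs, where weak \<open>n\<close>-gons are the bipartite graphs of diameter
  \<open>n\<close> and girth \<open>2 n\<close> with all degrees at least \<open>2\<close>.

  Let first \<open>\<Gamma>\<close> be finite and mapped onto a cycle of length \<open>2 n\<close>. An element over position \<open>i\<close>
  has \<open>\<alpha> i + 1\<close> neighbours over \<open>i + 1\<close> and \<open>\<beta> i + 1\<close> over \<open>i - 1\<close>; perspectivities
  between elements over opposite positions show that these numbers depend on \<open>i\<close> only and that
  \<open>\<alpha> (i + n) = \<beta> i\<close>. Counting a fibre from an element over a position at distance \<open>n - 1\<close>, and
  from one over a position at distance \<open>n - 3\<close> (non-backtracking walks with no or one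
  downward step), gives \<open>\<alpha> u * \<alpha> (u + 1) = \<Sum>j = u + 1..u + n - 1. \<alpha> j * \<beta> (j + 1)\<close>
  for all \<open>u\<close>. Hence \<open>\<alpha> + \<beta>\<close> has period \<open>2\<close>, not all \<open>\<alpha> i\<close> are positive, and then \<open>\<alpha>\<close>
  vanishes at \<open>n - 1\<close> consecutive positions, so that some fibre is a singleton. Local finite
  generation extends this to infinite \<open>\<Gamma>\<close>: otherwise two elements of every fibre, together with a
  thick configuration, generate a finite thick counterexample.

  If \<open>s \<ge> 2\<close>, folding \<open>\<Delta>\<close> about a point onto a cycle shows that the point or one of its two
  lines has a singleton fibre. Doing this at two opposite points yields two singleton fibres, and an
  element over a point strictly between them has only two neighbours. If \<open>s = 1\<close>, then \<open>\<Delta>\<close> is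
  itself a cycle, and lifting walks towards the singleton fibre gives type (a) or type (b), according
  as it lies over a line or over a point.
\<close>

section \<open>Non-backtracking walks and cycles\<close>

text \<open>All counting rests on one fact: in girth \<open>2 * n\<close>, two non-backtracking
  walks with common ends and fewer than \<open>2 * n\<close> edges in total coincide. Elements of a
  fibre may therefore be replaced by short walks, and length together with label bounds the number
  of downward steps: none if the fibre lies \<open>n - 1\<close> positions up, at most one if it
  lies \<open>n - 3\<close> up. Positions \<open>v - 2\<close> and \<open>v\<close> see the same
  fibre in these two ways; equating the counts is the source of the identity for \<alpha> and
  \<beta>. An epimorphism is onto only globally. Local surjectivity, on which all lifting depends,
  comes from targets at distance \<open>n - 1\<close>: parity forces a geodesic upstairs to have
  exactly \<open>n - 1\<close> edges, so that its image is the geodesic downstairs. The existence of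
  a singleton fibre says nothing about its place. Folding locates it: for \<open>s \<ge> 2\<close>
  each element at distance at least 2 from the centre shares its folded label with another element,
  so the singleton lies within distance 1. Evenness of \<open>n\<close> enters here, since an
  element at odd distance is then never opposite the centre and its geodesic is unique.\<close>

definition walk :: "'e set \<Rightarrow> ('e \<Rightarrow> 'e \<Rightarrow> bool) \<Rightarrow> 'e list \<Rightarrow> bool" where
  "walk V adj w \<longleftrightarrow> w \<noteq> [] \<and> set w \<subseteq> V \<and> (\<forall>i. Suc i < length w \<longrightarrow> adj (w ! i) (w ! Suc i))"

definition nb_walk :: "'e set \<Rightarrow> ('e \<Rightarrow> 'e \<Rightarrow> bool) \<Rightarrow> 'e list \<Rightarrow> bool" where
  "nb_walk V adj w \<longleftrightarrow> walk V adj w \<and> (\<forall>i. Suc (Suc i) < length w \<longrightarrow> w ! i \<noteq> w ! Suc (Suc i))"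

lemma walk_Nil [simp]: "\<not> walk V adj []" by (simp add: walk_def)
lemma nb_walk_Nil [simp]: "\<not> nb_walk V adj []" by (simp add: nb_walk_def)
lemma nb_walk_imp_walk: "nb_walk V adj w \<Longrightarrow> walk V adj w" by (simp add: nb_walk_def)

lemma walk_Cons:
  "walk V adj (x # w) \<longleftrightarrow> x \<in> V \<and> (w = [] \<or> adj x (hd w) \<and> walk V adj w)"
  by (cases w) (auto simp: walk_def nth_Cons split: nat.splits)

lemma nb_walk_Cons:
  "nb_walk V adj (x # w) \<longleftrightarrow>
     x \<in> V \<and> (w = [] \<or> adj x (hd w) \<and> nb_walk V adj w \<and> (tl w = [] \<or> x \<noteq> hd (tl w)))"
proof (cases w)
  case (Cons y v)
  show ?thesis
    unfolding nb_walk_def walk_Cons Cons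
    by (cases v) (auto simp: nth_Cons split: nat.splits)
qed (simp add: nb_walk_def walk_Cons)

lemma walk_singleton [simp]: "walk V adj [x] \<longleftrightarrow> x \<in> V" by (simp add: walk_Cons)
lemma nb_walk_singleton [simp]: "nb_walk V adj [x] \<longleftrightarrow> x \<in> V" by (simp add: nb_walk_Cons)

lemma nb_walk_in: "nb_walk V adj w \<Longrightarrow> set w \<subseteq> V"
  by (simp add: nb_walk_def walk_def)

lemma nb_walk_append1: "nb_walk V adj (u @ v) \<Longrightarrow> u \<noteq> [] \<Longrightarrow> nb_walk V adj u"
proof (induction u)
  case (Cons x u)
  show ?case
  proof (cases u)
    case Nil then show ?thesis using Cons.prems by (simp add: nb_walk_Cons)
  next
    case (Cons y t)
    then show ?thesis using Cons.IH Cons.prems by (cases t) (auto simp: nb_walk_Cons)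
  qed
qed simp

lemma nb_walk_append2: "nb_walk V adj (u @ v) \<Longrightarrow> v \<noteq> [] \<Longrightarrow> nb_walk V adj v"
  by (induction u) (auto simp: nb_walk_Cons)

lemma nb_walk_glue:
  assumes "nb_walk V adj (u @ [y])" "nb_walk V adj (y # v)"
    and "u = [] \<or> v = [] \<or> last u \<noteq> hd v"
  shows "nb_walk V adj (u @ y # v)"
  using assms
proof (induction u)
  case (Cons x u)
  show ?case
  proof (cases u)
    case Nil then show ?thesis using Cons.prems by (auto simp: nb_walk_Cons)
  next
    case (Cons z t)
    then show ?thesis using Cons.IH Cons.prems by (cases t) (auto simp: nb_walk_Cons)
  qed
qed simp

lemma nb_walk_mono:
  assumes "nb_walk U adj w" "U \<subseteq> V" "\<And>x y. adj x y \<Longrightarrow> adj' x y"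
  shows "nb_walk V adj' w"
  using assms by (auto simp: nb_walk_def walk_def)

text \<open>Indices are integers so that they may be shifted and reflected freely.\<close>

definition cycle_in :: "('e \<Rightarrow> 'e \<Rightarrow> bool) \<Rightarrow> int \<Rightarrow> (int \<Rightarrow> 'e) \<Rightarrow> bool" where
  "cycle_in adj N c \<longleftrightarrow>
     (\<forall>i j. c i = c j \<longleftrightarrow> i mod N = j mod N) \<and>
     (\<forall>i j. adj (c i) (c j) \<longleftrightarrow> j mod N = (i + 1) mod N \<or> i mod N = (j + 1) mod N)"

lemma cycle_in_shift: "cycle_in adj N c \<Longrightarrow> cycle_in adj N (\<lambda>i. c (i + k))"
proof -
  have "(i + k) mod N = (j + k) mod N \<longleftrightarrow> i mod N = j mod N" for i j :: int
    by (simp add: mod_eq_dvd_iff)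
  moreover have "(j + k) mod N = (i + k + 1) mod N \<longleftrightarrow> j mod N = (i + 1) mod N" for i j :: int
    by (simp add: mod_eq_dvd_iff algebra_simps)
  ultimately show "cycle_in adj N c \<Longrightarrow> cycle_in adj N (\<lambda>i. c (i + k))"
    by (simp add: cycle_in_def)
qed

lemma cycle_in_reflect: "cycle_in adj N c \<Longrightarrow> cycle_in adj N (\<lambda>i. c (k - i))"
proof -
  have "(k - i) mod N = (k - j) mod N \<longleftrightarrow> i mod N = j mod N" for i j :: int
    unfolding mod_eq_dvd_iff using dvd_minus_iff[of N "i - j"] by (simp add: algebra_simps)
  moreover have "(k - j) mod N = (k - i + 1) mod N \<longleftrightarrow> i mod N = (j + 1) mod N" for i j :: int
    unfolding mod_eq_dvd_iff using dvd_minus_iff[of N "i - (j + 1)"] by (simp add: algebra_simps)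
  ultimately show "cycle_in adj N c \<Longrightarrow> cycle_in adj N (\<lambda>i. c (k - i))"
    by (auto simp: cycle_in_def)
qed

lemma cycle_in_adj: "cycle_in adj N c \<Longrightarrow> adj (c i) (c (i + 1))"
  by (simp add: cycle_in_def)

lemma cycle_in_eq: "cycle_in adj N c \<Longrightarrow> c i = c j \<longleftrightarrow> N dvd i - j"
  by (simp add: cycle_in_def mod_eq_dvd_iff)

locale bipartite_graph =
  fixes V :: "'e set" and adj :: "'e \<Rightarrow> 'e \<Rightarrow> bool" and col :: "'e \<Rightarrow> bool"
  assumes adj_sym: "adj x y \<Longrightarrow> adj y x"
    and adj_in: "adj x y \<Longrightarrow> x \<in> V"
    and adj_col: "adj x y \<Longrightarrow> col x \<noteq> col y"
begin

abbreviation "nb \<equiv> nb_walk V adj"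

lemma adj_in2: "adj x y \<Longrightarrow> y \<in> V"
  using adj_sym adj_in by blast

lemma nb_rev: "nb w \<Longrightarrow> nb (rev w)"
proof (induction w)
  case (Cons x w)
  show ?case
  proof (cases w)
    case Nil then show ?thesis using Cons.prems by simp
  next
    case (Cons y v)
    have "nb (rev v @ y # [x])"
    proof (rule nb_walk_glue)
      show "nb (rev v @ [y])" using Cons.IH Cons.prems Cons by (simp add: nb_walk_Cons)
      show "nb (y # [x])" using Cons.prems Cons adj_sym adj_in2
        by (auto simp: nb_walk_Cons)
      show "rev v = [] \<or> [x] = [] \<or> last (rev v) \<noteq> hd [x]"
        using Cons.prems Cons by (auto simp: nb_walk_Cons last_rev)
    qed
    then show ?thesis using Cons by simp
  qed
qed simp

lemma walk_rev: "walk V adj w \<Longrightarrow> walk V adj (rev w)"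
  unfolding walk_def
proof (intro conjI allI impI; elim conjE)
  fix i assume a: "\<forall>i. Suc i < length w \<longrightarrow> adj (w ! i) (w ! Suc i)" "Suc i < length (rev w)"
  have "Suc (length w - Suc (Suc i)) = length w - Suc i" using a(2) by simp
  then show "adj (rev w ! i) (rev w ! Suc i)"
    using a(1)[rule_format, of "length w - Suc (Suc i)"] a(2) adj_sym
    by (simp add: rev_nth)
qed auto

lemma walk_col: "walk V adj w \<Longrightarrow> (col (hd w) = col (last w)) \<longleftrightarrow> odd (length w)"
proof (induction w)
  case (Cons x w)
  then show ?case
    by (cases "w = []") (auto simp: walk_Cons dest: adj_col)
qed simp

text \<open>Prepending \<open>x\<close> to a reduced walk backtracks only if the second vertex of
  that walk is \<open>x\<close>; dropping its head then already gives a reduced walk from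
  \<open>x\<close>.\<close>

lemma walk_reduce:
  assumes "walk V adj w"
  shows "\<exists>u. nb u \<and> hd u = hd w \<and> last u = last w \<and> length u \<le> length w"
  using assms
proof (induction w)
  case (Cons x w)
  show ?case
  proof (cases "w = []")
    case True then show ?thesis using Cons.prems by (intro exI[of _ "[x]"]) (simp add: walk_Cons)
  next
    case False
    then obtain u where u: "nb u" "hd u = hd w" "last u = last w" "length u \<le> length w"
      using Cons by (auto simp: walk_Cons)
    have une: "u \<noteq> []" using u(1) by auto
    show ?thesis
    proof (cases "tl u = [] \<or> x \<noteq> hd (tl u)")
      case True
      then have "nb (x # u)" using u Cons.prems False by (auto simp: nb_walk_Cons walk_Cons)
      then show ?thesis using u False une by (intro exI[of _ "x # u"]) auto
    next
      case f: False
      then have "nb (tl u)" using u(1) une by (cases u) (auto simp: nb_walk_Cons)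
      then show ?thesis using u False f une
        by (intro exI[of _ "tl u"]) (auto simp: last_tl)
    qed
  qed
qed simp

text \<open>A repeated vertex would cut off a shorter closed non-backtracking walk, and so would a
  chord, since it closes up the segment of \<open>w\<close> that it spans.\<close>

lemma min_closed_walk_cycle:
  assumes w: "nb w" "length w = Suc N" "hd w = last w" "3 \<le> N"
    and ends: "w ! 1 \<noteq> w ! (N - 1)"
    and min: "\<And>u. nb u \<Longrightarrow> 2 \<le> length u \<Longrightarrow> hd u = last u \<Longrightarrow> N \<le> length u - 1"
  shows "cycle_in adj (int N) (\<lambda>i. w ! nat (i mod int N))"
proof -
  have wne: "w \<noteq> []" using w by auto
  have w0N: "w ! N = w ! 0" using w wne by (simp add: hd_conv_nth last_conv_nth)
  have sub: "nb (take (j - i + 1) (drop i w))" if "i \<le> j" "j \<le> N" for i j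
  proof -
    have "nb (take i w @ drop i w)" using w(1) by (simp only: append_take_drop_id)
    then have d: "nb (drop i w)" by (rule nb_walk_append2) (use w that in auto)
    then have "nb (take (j - i + 1) (drop i w) @ drop (j - i + 1) (drop i w))"
      by (simp only: append_take_drop_id)
    then show ?thesis by (rule nb_walk_append1) (use w that in auto)
  qed
  have hl: "hd (take (j - i + 1) (drop i w)) = w ! i" "last (take (j - i + 1) (drop i w)) = w ! j"
    "length (take (j - i + 1) (drop i w)) = j - i + 1" if "i \<le> j" "j \<le> N" for i j
  proof -
    show l: "length (take (j - i + 1) (drop i w)) = j - i + 1" using that w by simp
    show "hd (take (j - i + 1) (drop i w)) = w ! i" using that w by (simp add: hd_drop_conv_nth)
    show "last (take (j - i + 1) (drop i w)) = w ! j"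
      using that w l by (subst last_conv_nth) auto
  qed
  define seg where "seg i j = take (j - i + 1) (drop i w)" for i j
  note sub = sub[folded seg_def] and hl = hl[folded seg_def]
  have dist: "w ! i \<noteq> w ! j" if "i < j" "j < N" for i j
  proof
    assume "w ! i = w ! j"
    then have "N \<le> j - i"
      using min[OF sub[of i j]] hl[of i j] that by simp
    then show False using that by simp
  qed
  have adjw: "adj (w ! i) (w ! Suc i)" if "i < N" for i
    using w that by (auto simp: nb_walk_def walk_def)
  have chord: "j = Suc i \<or> (i = 0 \<and> j = N - 1)" if "i < j" "j < N" "adj (w ! i) (w ! j)" for i j
  proof (rule ccontr)
    assume n: "\<not> ?thesis"
    \<comment> \<open>The chord followed by the segment it spans is closed and has
      \<open>j - i + 1\<close> edges. This is less than \<open>N\<close> unless \<open>i = 0\<close>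
      and \<open>j = N - 1\<close>, where the chord is the closing side of \<open>w\<close>.\<close>
    let ?u = "w ! j # seg i j"
    have "tl (seg i j) = take (j - i) (drop (Suc i) w)"
      by (simp add: seg_def tl_take drop_Suc tl_drop)
    moreover have "hd (take (j - i) (drop (Suc i) w)) = w ! Suc i"
      using that w by (simp add: hd_drop_conv_nth)
    moreover have "w ! j \<noteq> w ! Suc i" using dist[of "Suc i" j] n that by auto
    ultimately have "nb ?u"
      using sub[of i j] that hl(1)[of i j] adj_sym adj_in by (auto simp: nb_walk_Cons)
    moreover have "last ?u = hd ?u" using hl(2,3)[of i j] that w by (auto simp: last.simps)
    ultimately have "N \<le> j - i + 1" using min[of ?u] hl(3)[of i j] that by simp
    then show False using n that by auto
  qed
  have m: "int (nat (i mod int N)) = i mod int N" "nat (i mod int N) < N" for i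
    using w by (auto simp: nat_less_iff)
  have e: "w ! nat (i mod int N) = w ! nat (j mod int N) \<longleftrightarrow> i mod int N = j mod int N" for i j
    using dist[of "nat (i mod int N)" "nat (j mod int N)"] dist[of "nat (j mod int N)" "nat (i mod int N)"]
      m by (metis linorder_neqE_nat)
  have nx: "adj (w ! nat (i mod int N)) (w ! nat ((i + 1) mod int N))" for i
  proof (cases "nat (i mod int N) = N - 1")
    case True
    then have "i mod int N = int N - 1" using m[of i] w by linarith
    then have "(i + 1) mod int N = 0" by (simp add: mod_add_left_eq[symmetric, of i])
    then show ?thesis using adjw[of "N - 1"] True w w0N by simp
  next
    case False
    then have "i mod int N + 1 < int N" using m[of i] by linarith
    then have "(i + 1) mod int N = i mod int N + 1"
      using m[of i] by (subst mod_add_left_eq[symmetric]) simp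
    then have "nat ((i + 1) mod int N) = Suc (nat (i mod int N))" using m[of i] by linarith
    then show ?thesis using adjw[of "nat (i mod int N)"] m[of i] by simp
  qed
  have ch: "j mod int N = (i + 1) mod int N \<or> i mod int N = (j + 1) mod int N"
    if a: "adj (w ! nat (i mod int N)) (w ! nat (j mod int N))" and l: "nat (i mod int N) < nat (j mod int N)" for i j
  proof -
    consider "nat (j mod int N) = Suc (nat (i mod int N))" |
       "nat (i mod int N) = 0" "nat (j mod int N) = N - 1" using chord[OF l m(2) a] by (elim disjE conjE)
    then show ?thesis
    proof cases
      case 1
      then have "j mod int N = i mod int N + 1" using m(1)[of i] m(1)[of j] by linarith
      then have "j mod int N = (i + 1) mod int N" by (metis mod_add_left_eq mod_mod_trivial)
      then show ?thesis by simp
    next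
      case 2
      then have "i mod int N = 0" "j mod int N = int N - 1" using m[of i] m[of j] w by linarith+
      then have "(j + 1) mod int N = 0" by (simp add: mod_add_left_eq[symmetric, of j])
      then show ?thesis using \<open>i mod int N = 0\<close> by simp
    qed
  qed
  show ?thesis
    unfolding cycle_in_def
  proof (intro conjI allI)
    fix i j
    show "(w ! nat (i mod int N) = w ! nat (j mod int N)) = (i mod int N = j mod int N)" by (rule e)
    have irr: "\<not> adj x x" for x using adj_col by blast
    have "j mod int N = (i + 1) mod int N \<or> i mod int N = (j + 1) mod int N"
      if a: "adj (w ! nat (i mod int N)) (w ! nat (j mod int N))"
    proof (cases "nat (i mod int N)" "nat (j mod int N)" rule: linorder_cases)
      case less then show ?thesis using ch a by blast
    next
      case equal then show ?thesis using irr a by simp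
    next
      case greater then show ?thesis using ch[OF adj_sym[OF a]] by blast
    qed
    then show "adj (w ! nat (i mod int N)) (w ! nat (j mod int N)) =
          (j mod int N = (i + 1) mod int N \<or> i mod int N = (j + 1) mod int N)"
      using nx[of i] nx[of j] adj_sym by metis
  qed
qed

end

section \<open>Generalized polygons as graphs\<close>

lemma (in bipartite_graph) cycle_nb_walk:
  assumes c: "cycle_in adj N c" and N: "3 \<le> N"
  shows "nb (map (\<lambda>j. c (i + int j)) [0..<Suc k])"
proof -
  have "c (i + int j) \<noteq> c (i + int (Suc (Suc j)))" for j
  proof
    assume "c (i + int j) = c (i + int (Suc (Suc j)))"
    then have "N dvd (i + int j) - (i + int (Suc (Suc j)))" using cycle_in_eq[OF c] by blast
    then have "N dvd 2" using dvd_minus_iff[of N 2] by simp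
    then show False using N zdvd_imp_le by fastforce
  qed
  moreover have a: "adj (c (i + int j)) (c (i + int (Suc j)))" for j
    using cycle_in_adj[OF c, of "i + int j"] by (simp add: add_ac)
  ultimately show ?thesis
    using adj_in unfolding nb_walk_def walk_def by (auto simp: nth_append simp del: upt_Suc)
qed

text \<open>A list has one vertex more than the walk has edges, so the bounds say diameter at most
  \<open>n\<close> and girth at least \<open>2 * n\<close>. Minimum degree two is put in the form
  that lets a walk continue without turning back.\<close>

locale ngon_graph = bipartite_graph +
  fixes n :: nat
  assumes n_ge_3: "3 \<le> n"
    and girth: "nb w \<Longrightarrow> 2 \<le> length w \<Longrightarrow> hd w = last w \<Longrightarrow> 2 * n \<le> length w - 1"
    and diam: "x \<in> V \<Longrightarrow> y \<in> V \<Longrightarrow> \<exists>w. nb w \<and> hd w = x \<and> last w = y \<and> length w \<le> Suc n"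
    and another_neighbour: "x \<in> V \<Longrightarrow> \<exists>z. adj x z \<and> z \<noteq> y"
begin

text \<open>Where the walks first part, one of them reversed and followed by the other is a closed
  non-backtracking walk, too short for the girth. The length bound means fewer than
  \<open>2 * n\<close> edges in total.\<close>

lemma nb_walk_unique:
  assumes "nb u" "nb w" "hd u = hd w" "last u = last w" "length u + length w < 2 * n + 2"
  shows "u = w"
  using assms
proof (induction u arbitrary: w)
  case (Cons x u)
  obtain w' where w: "w = x # w'" using Cons.prems(2,3) by (cases w) auto
  show ?case
  proof (cases "u = []")
    case True
    then have "w' = []" using girth[of w] Cons.prems w n_ge_3 by (cases w') auto
    then show ?thesis using w True by simp
  next
    case une: False
    have wne: "w' \<noteq> []" using girth[of "x # u"] Cons.prems w n_ge_3 une by (cases u) auto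
    have nbs: "nb u" "nb w'" using Cons.prems une wne w by (auto simp: nb_walk_Cons)
    show ?thesis
    proof (cases "hd u = hd w'")
      case True
      then have "u = w'"
        using Cons.IH[of w'] Cons.prems une wne w nbs by simp
      then show ?thesis using w by simp
    next
      case False
      have "nb (rev u @ x # w')"
      proof (rule nb_walk_glue)
        show "nb (rev u @ [x])" using nb_rev[OF Cons.prems(1)] by simp
        show "nb (x # w')" using Cons.prems w by simp
        show "rev u = [] \<or> w' = [] \<or> last (rev u) \<noteq> hd w'" using False une by (simp add: last_rev)
      qed
      then have "2 * n \<le> length u + length w'"
        using girth[of "rev u @ x # w'"] une wne Cons.prems w
        by (cases u rule: rev_cases) (auto simp: hd_append hd_rev)
      then show ?thesis using Cons.prems w by simp
    qed
  qed
qed simp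

section \<open>Distances, opposite elements and projections\<close>

definition dist :: "'a \<Rightarrow> 'a \<Rightarrow> nat" where
  "dist x y = (LEAST k. \<exists>w. nb w \<and> hd w = x \<and> last w = y \<and> length w = Suc k)"

lemma dist_walk:
  assumes "x \<in> V" "y \<in> V"
  shows "\<exists>w. nb w \<and> hd w = x \<and> last w = y \<and> length w = Suc (dist x y)" "dist x y \<le> n"
proof -
  obtain w where w: "nb w" "hd w = x" "last w = y" "length w \<le> Suc n" using diam assms by blast
  have e: "length w = Suc (length w - 1)" using w(1) by (cases w) auto
  show "\<exists>w. nb w \<and> hd w = x \<and> last w = y \<and> length w = Suc (dist x y)"
    unfolding dist_def by (rule LeastI_ex) (use w e in blast)
  have "dist x y \<le> length w - 1"
    unfolding dist_def by (rule Least_le) (use w e in blast)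
  then show "dist x y \<le> n" using w by linarith
qed

text \<open>By \<open>nb_walk_unique\<close> a non-backtracking walk with at most \<open>n\<close>
  edges has no shorter rival.\<close>

lemma dist_eqI:
  assumes "nb w" "hd w = x" "last w = y" "length w = Suc k" "k \<le> n"
  shows "dist x y = k"
proof -
  have "w \<noteq> []" using assms by auto
  then have xy: "x \<in> V" "y \<in> V" using nb_walk_in[OF assms(1)] assms by force+
  obtain u where u: "nb u" "hd u = x" "last u = y" "length u = Suc (dist x y)"
    using dist_walk[OF xy] by blast
  have "dist x y \<le> k"
    unfolding dist_def by (rule Least_le) (use assms in blast)
  moreover have False if "dist x y < k"
    using nb_walk_unique[of u w] u assms that by auto
  ultimately show ?thesis using le_neq_implies_less by blast
qed

lemma dist_le_walk:
  assumes "walk V adj w" "length w \<le> Suc k"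
  shows "dist (hd w) (last w) \<le> k"
proof -
  obtain u where u: "nb u" "hd u = hd w" "last u = last w" "length u \<le> length w"
    using walk_reduce[OF assms(1)] by blast
  have "length u = Suc (length u - 1)" using u(1) by (cases u) auto
  then have "dist (hd w) (last w) \<le> length u - 1"
    unfolding dist_def by (intro Least_le) (use u in blast)
  then show ?thesis using u assms by linarith
qed

lemma dist_col: "x \<in> V \<Longrightarrow> y \<in> V \<Longrightarrow> col x = col y \<longleftrightarrow> even (dist x y)"
proof -
  assume xy: "x \<in> V" "y \<in> V"
  obtain w where w: "nb w" "hd w = x" "last w = y" "length w = Suc (dist x y)"
    using dist_walk[OF xy] by blast
  then show ?thesis using walk_col[OF nb_walk_imp_walk[OF w(1)]] by simp
qed

text \<open>The bipartition excludes equal distances. Below distance \<open>n\<close>, the geodesic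
  from \<open>p\<close> to \<open>x\<close> either starts through \<open>q\<close> or is prolonged
  by \<open>q\<close> to a geodesic from \<open>q\<close>.\<close>

lemma dist_adj:
  assumes a: "adj y z" and x: "x \<in> V"
  shows "dist z x = Suc (dist y x) \<or> dist y x = Suc (dist z x)"
proof -
  have yz: "y \<in> V" "z \<in> V" using a adj_in adj_in2 by auto
  have step: "dist q x = Suc (dist p x) \<or> dist p x = Suc (dist q x)"
    if pq: "adj p q" and l: "dist p x < n" for p q
  proof -
    have pV: "p \<in> V" "q \<in> V" using pq adj_in adj_in2 by auto
    obtain w where w: "nb w" "hd w = p" "last w = x" "length w = Suc (dist p x)"
      using dist_walk[OF pV(1) x] by blast
    show ?thesis
    proof (cases "tl w \<noteq> [] \<and> hd (tl w) = q")
      case True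
      then have "nb (tl w)" using w(1) by (cases w) (auto simp: nb_walk_Cons)
      moreover have "last (tl w) = x" using True w by (simp add: last_tl)
      moreover have "length (tl w) = Suc (dist p x - 1)" using True w by (cases w; cases "tl w") auto
      ultimately have "dist q x = dist p x - 1" using dist_eqI[of "tl w" q x] True l by simp
      moreover have "dist p x \<noteq> 0" using w True by (cases w; cases "tl w") auto
      ultimately show ?thesis by simp
    next
      case False
      then have "nb (q # w)" using w pq pV adj_sym by (auto simp: nb_walk_Cons)
      then have "dist q x = Suc (dist p x)" using w l dist_eqI[of "q # w" q x] by (cases w) auto
      then show ?thesis by simp
    qed
  qed
  have "dist y x \<noteq> dist z x" using dist_col[OF yz(1) x] dist_col[OF yz(2) x] adj_col[OF a] by metis
  moreover have "dist y x \<le> n" "dist z x \<le> n" using dist_walk(2) yz x by auto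
  ultimately show ?thesis
    using step[OF a] step[OF adj_sym[OF a]] by linarith
qed

lemma extend_walk:
  assumes "nb w" "length w \<le> k"
  shows "\<exists>u. nb (u @ w) \<and> length (u @ w) = k"
  using assms(2)
proof (induction rule: dec_induct)
  case base show ?case using assms by (intro exI[of _ "[]"]) simp
next
  case (step m)
  then obtain u where u: "nb (u @ w)" "length (u @ w) = m" by blast
  let ?v = "u @ w"
  have ne: "?v \<noteq> []" using u by auto
  then have "hd ?v \<in> V" using nb_walk_in[OF u(1)] hd_in_set by blast
  then obtain z where z: "adj (hd ?v) z" "z \<noteq> hd (tl ?v)" using another_neighbour by blast
  then have "nb (z # ?v)" using u(1) adj_sym adj_in2 by (auto simp: nb_walk_Cons)
  then show ?case using u(2) by (intro exI[of _ "z # u"]) auto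
qed

text \<open>Prolong a geodesic from \<open>y\<close> to \<open>x\<close> beyond \<open>y\<close> to
  \<open>n\<close> edges, up to \<open>z\<close>, and step past \<open>x\<close> to a new neighbour
  \<open>x'\<close>. By parity a geodesic from \<open>z\<close> to \<open>x'\<close> has at most
  \<open>n - 1\<close> edges, so it closes the path to a walk with at most, hence exactly,
  \<open>2 * n\<close> edges.\<close>

lemma cycle_through:
  assumes x: "x \<in> V" and y: "y \<in> V"
  obtains c where "cycle_in adj (2 * int n) c" "range c \<subseteq> V" "x \<in> range c" "y \<in> range c"
proof -
  obtain w0 where w0: "nb w0" "hd w0 = y" "last w0 = x" "length w0 \<le> Suc n"
    using diam x y by blast
  then obtain v where v: "nb (v @ w0)" "length (v @ w0) = Suc n" using extend_walk by blast
  define w where "w = v @ w0"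
  have w0ne: "w0 \<noteq> []" using w0 by auto
  have w: "nb w" "length w = Suc n" "last w = x" "y \<in> set w" "x \<in> set w"
    using v w0 w0ne unfolding w_def by force+
  define z where "z = hd w"
  obtain w' where wz: "w = z # w'" "w' \<noteq> []"
    using w(2) n_ge_3 that unfolding z_def by (cases w; cases "tl w") auto
  have zV: "z \<in> V" using nb_walk_in[OF w(1)] wz(1) by (metis list.set_intros(1) subsetD)
  obtain x' where x': "adj x x'" "x' \<noteq> hd (tl (rev w))" using another_neighbour x by blast
  have x'V: "x' \<in> V" using x' adj_in2 by blast
  have rw: "rev w \<noteq> []" "hd (rev w) = x" using w by (auto simp: hd_rev)
  have nbx: "nb (x' # rev w)" using x' x'V rw nb_rev[OF w(1)] adj_sym by (auto simp: nb_walk_Cons)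
  have nbwx: "nb (w @ [x'])" using nb_rev[OF nbx] by simp
  obtain u where u: "nb u" "hd u = z" "last u = x'" "length u \<le> Suc n" using diam zV x'V by blast
  have une: "u \<noteq> []" using u by auto
  have "odd (length u) = odd (length (w @ [x']))"
    using walk_col[OF nb_walk_imp_walk[OF u(1)]] walk_col[OF nb_walk_imp_walk[OF nbwx]] u(2,3) w(2)
      z_def by (cases w) auto
  then have ul: "length u \<le> n" using u(4) w(2) by (cases "length u = Suc n") auto
  obtain u' where uz: "u = z # u'" using une u by (cases u) auto
  define C where "C = (x' # rev w') @ z # u'"
  have C_eq: "C = x' # rev w @ u'" unfolding C_def wz(1) by simp
  have nbC: "nb C"
    unfolding C_def
  proof (rule nb_walk_glue)
    show "nb ((x' # rev w') @ [z])" using nbx wz(1) by (metis append_Cons rev.simps(2))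
    show "nb (z # u')" using u(1) uz by simp
    have False if h: "u' \<noteq> []" "hd w' = hd u'"
    proof -
      have a: "nb u'" using u(1) uz h by (simp add: nb_walk_Cons)
      have "w @ [x'] = z # (w' @ [x'])" using wz(1) by simp
      then have b: "nb (w' @ [x'])" using nbwx by (simp add: nb_walk_Cons)
      have "u' = w' @ [x']"
        by (rule nb_walk_unique[OF a b]) (use h wz uz u ul w(2) in auto)
      then have "length u' = length (w' @ [x'])" by simp
      then show False using ul w(2) wz(1) uz by simp
    qed
    then show "x' # rev w' = [] \<or> u' = [] \<or> last (x' # rev w') \<noteq> hd u'"
      using wz by (auto simp: last_rev)
  qed
  have lC: "length C = Suc n + length u" unfolding C_eq using w(2) uz by simp
  have closed: "hd C = last C"
    unfolding C_def using u(3) uz by simp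
  have "2 * n \<le> length C - 1" using girth[OF nbC _ closed] lC n_ge_3 by simp
  then have len: "length C = Suc (2 * n)" "length u = n" using lC ul by auto
  \<comment> \<open>If the closed walk turned back at \<open>x'\<close>, then
    \<open>butlast u\<close> and \<open>w\<close> would both join \<open>z\<close> to
    \<open>x\<close>, with \<open>n - 2\<close> and \<open>n\<close> edges, and uniqueness would
    identify them.\<close>
  have ends: "C ! 1 \<noteq> C ! (2 * n - 1)"
  proof
    assume e: "C ! 1 = C ! (2 * n - 1)"
    have c1: "C ! 1 = x" using rw unfolding C_eq by (simp add: nth_append hd_conv_nth)
    have "C = (x' # rev w') @ u" unfolding C_def using uz by simp
    moreover have "2 * n - 1 = length (x' # rev w') + (n - 2)" using w(2) wz(1) n_ge_3 by simp
    ultimately have "C ! (2 * n - 1) = u ! (n - 2)" by (metis nth_append_length_plus)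
    then have un: "u ! (n - 2) = x" using e c1 by simp
    have uu: "nb (butlast u)"
    proof (rule nb_walk_append1)
      show "nb (butlast u @ [last u])" using u(1) une by simp
      show "butlast u \<noteq> []" using len(2) n_ge_3 by (cases u; cases "tl u") auto
    qed
    have bl: "butlast u \<noteq> []" "length (butlast u) = n - 1" using uu len(2) by auto
    have lb: "last (butlast u) = x"
      using un bl n_ge_3 by (simp add: last_conv_nth nth_butlast numeral_2_eq_2)
    have hb: "hd (butlast u) = z" using bl uz by (cases u') auto
    have "butlast u = w"
      by (rule nb_walk_unique[OF uu w(1)]) (use hb lb w(2,3) bl(2) z_def n_ge_3 in simp_all)
    then have "length (butlast u) = length w" by simp
    then show False using bl(2) w(2) n_ge_3 by simp
  qed
  let ?c = "\<lambda>i. C ! nat (i mod int (2 * n))"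
  have "cycle_in adj (int (2 * n)) ?c"
    by (rule min_closed_walk_cycle[OF nbC len(1) closed _ ends]) (use girth n_ge_3 in auto)
  moreover have "nat (i mod int (2 * n)) < length C" for i
  proof -
    have "0 \<le> i mod int (2 * n)" "i mod int (2 * n) < int (2 * n)" using n_ge_3 by simp_all
    then show ?thesis using len(1) by linarith
  qed
  then have "range ?c \<subseteq> V" using nb_walk_in[OF nbC] by (auto intro!: subsetD[OF _ nth_mem])
  moreover have mem: "q \<in> range ?c" if "q \<in> set w" for q
  proof -
    have "q \<in> set C" using that unfolding C_eq by simp
    then obtain i where i: "i < length C" "C ! i = q" by (auto simp: in_set_conv_nth)
    show ?thesis
    proof (cases "i = 2 * n")
      case True
      have "C \<noteq> []" using nbC by auto
      then have "C ! (2 * n) = C ! 0" using closed len(1) by (simp add: hd_conv_nth last_conv_nth)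
      then have "q = ?c 0" using True i by simp
      then show ?thesis by blast
    next
      case False
      then have "q = ?c (int i)" using i len by simp
      then show ?thesis by blast
    qed
  qed
  ultimately show thesis using that[of ?c] mem[OF w(4)] mem[OF w(5)] by simp
qed

text \<open>Were the largest distance below \<open>n\<close>, one of the two cycle neighbours of the
  vertex attaining it would avoid the geodesic to \<open>z\<close> and lie farther away.\<close>

lemma opposite_on_cycle:
  assumes c: "cycle_in adj (2 * int n) c" and z: "z \<in> V"
  shows "\<exists>i. dist (c i) z = n"
proof -
  have cV: "c i \<in> V" for i using cycle_in_adj[OF c] adj_in by blast
  have fin: "finite (range (\<lambda>i. dist (c i) z))"
    by (rule finite_subset[of _ "{..n}"]) (use dist_walk(2) cV z in auto)
  obtain i where i: "dist (c i) z = Max (range (\<lambda>i. dist (c i) z))"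
    using Max_in[OF fin] by auto
  have le: "dist (c j) z \<le> dist (c i) z" for j
    unfolding i using fin by (intro Max_ge) auto
  have "\<not> dist (c i) z < n"
  proof
    assume l: "dist (c i) z < n"
    obtain w where w: "nb w" "hd w = c i" "last w = z" "length w = Suc (dist (c i) z)"
      using dist_walk[OF cV z] by blast
    have wne: "w \<noteq> []" using w by auto
    have "c (i + 1) \<noteq> c (i - 1)"
      using n_ge_3 zdvd_not_zless[of 2 "2 * int n"] by (auto simp: cycle_in_eq[OF c])
    then obtain j where j: "j = i + 1 \<or> j = i - 1" "c j \<noteq> hd (tl w)" by metis
    have "adj (c j) (c i)" using j(1) cycle_in_adj[OF c, of i] cycle_in_adj[OF c, of "i - 1"] adj_sym by auto
    then have "nb (c j # w)" using w wne j(2) cV by (auto simp: nb_walk_Cons)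
    then have "dist (c j) z = Suc (dist (c i) z)" using w wne l dist_eqI[of "c j # w"] by auto
    then show False using le[of j] by simp
  qed
  then show ?thesis using dist_walk(2)[OF cV z] by (intro exI[of _ i]) (simp add: le_antisym)
qed

text \<open>This is the projection of \<open>z\<close> to \<open>x\<close>: the geodesic between
  them prolongs to a path from \<open>x\<close> to \<open>y\<close>, and \<open>hd (tl w)\<close> is
  the neighbour of \<open>x\<close> nearest to \<open>z\<close>.\<close>

lemma opposite_step:
  assumes d: "dist y x = n" and x: "x \<in> V" and a: "adj y z"
  shows "\<exists>w. nb w \<and> hd w = x \<and> last w = z \<and> length w = n \<and> adj x (hd (tl w)) \<and> nb (w @ [y])"
proof -
  have yz: "y \<in> V" "z \<in> V" using a adj_in adj_in2 by auto
  have dz: "dist z x = n - 1" using dist_adj[OF a x] d dist_walk(2)[OF yz(2) x] by auto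
  obtain w where w: "nb w" "hd w = z" "last w = x" "length w = Suc (dist z x)"
    using dist_walk[OF yz(2) x] by blast
  have l: "length w = n" using w dz n_ge_3 by simp
  have wne: "w \<noteq> []" "tl w \<noteq> []" using l n_ge_3 by (cases w; cases "tl w"; auto)+
  have "y \<noteq> hd (tl w)"
  proof
    assume e: "y = hd (tl w)"
    have "nb (tl w)" using w(1) wne by (cases w) (auto simp: nb_walk_Cons)
    then have "dist y x = n - 2"
      using dist_eqI[of "tl w" y x "n - 2"] e wne w l n_ge_3 by (auto simp: last_tl)
    then show False using d n_ge_3 by simp
  qed
  then have nby: "nb (y # w)" using w wne yz a by (auto simp: nb_walk_Cons)
  have "walk V adj (rev w)" using nb_walk_imp_walk[OF nb_rev[OF w(1)]] .
  moreover obtain p q t where r: "rev w = p # q # t"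
  proof -
    have "length (rev w) = n" using l by simp
    then show ?thesis using that n_ge_3 by (cases "rev w"; cases "tl (rev w)") auto
  qed
  ultimately have "adj (hd (rev w)) (hd (tl (rev w)))" by (simp add: walk_Cons)
  then show ?thesis using nb_rev[OF w(1)] nb_rev[OF nby] w l wne
    by (intro exI[of _ "rev w"]) (auto simp: hd_rev last_rev)
qed

text \<open>Without their first vertex both paths have \<open>n - 1\<close> edges, so a common
  second vertex makes them equal. Distinct neighbours of \<open>y\<close> thus project to distinct
  neighbours of \<open>x\<close>.\<close>

lemma opposite_step_inj:
  assumes "nb (w1 @ [y])" "nb (w2 @ [y])" "hd w1 = hd w2" "length w1 = n" "length w2 = n"
    and "hd (tl w1) = hd (tl w2)"
  shows "w1 = w2"
proof -
  obtain p q t where 1: "w1 = p # q # t" using assms(4) n_ge_3 by (cases w1; cases "tl w1") auto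
  obtain p' q' t' where 2: "w2 = p' # q' # t'" using assms(5) n_ge_3 by (cases w2; cases "tl w2") auto
  have "q # t @ [y] = q' # t' @ [y]"
    by (rule nb_walk_unique) (use assms 1 2 in \<open>auto simp: nb_walk_Cons\<close>)
  then show ?thesis using 1 2 assms by simp
qed

text \<open>The degrees are the difficulty: an element of \<open>K\<close> is opposite some cycle
  vertex, and the two cycle neighbours of that vertex project to two neighbours, which stay in
  \<open>K\<close> by \<open>closed\<close>. Paths between opposite elements are not unique and
  escape \<open>closed\<close>; one is routed through a neighbour in \<open>K\<close>.\<close>

lemma closed_subgraph:
  assumes KV: "K \<subseteq> V" and c: "cycle_in adj (2 * int n) c" "range c \<subseteq> K"
    and closed: "\<And>w. nb w \<Longrightarrow> hd w \<in> K \<Longrightarrow> last w \<in> K \<Longrightarrow> length w \<le> n \<Longrightarrow> set w \<subseteq> K"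
  shows "ngon_graph K (\<lambda>x y. adj x y \<and> x \<in> K \<and> y \<in> K) col n"
proof -
  let ?A = "\<lambda>x y. adj x y \<and> x \<in> K \<and> y \<in> K"
  have nbK: "nb_walk K ?A w \<longleftrightarrow> nb w \<and> set w \<subseteq> K" for w
  proof
    assume "nb_walk K ?A w"
    then show "nb w \<and> set w \<subseteq> K" using KV nb_walk_mono[of K ?A w V adj] nb_walk_in by blast
  next
    assume w: "nb w \<and> set w \<subseteq> K"
    then have "w ! i \<in> K" if "i < length w" for i using that nth_mem by blast
    then show "nb_walk K ?A w" using w unfolding nb_walk_def walk_def by simp
  qed
  have an: "\<exists>v. ?A z v \<and> v \<noteq> y" if z: "z \<in> K" for z y
  proof -
    have zV: "z \<in> V" using z KV by auto
    obtain i where i: "dist (c i) z = n" using opposite_on_cycle[OF c(1) zV] by blast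
    have a: "adj (c i) (c (i + 1))" "adj (c i) (c (i - 1))"
      using cycle_in_adj[OF c(1), of i] cycle_in_adj[OF c(1), of "i - 1"] adj_sym by auto
    obtain w1 where w1: "nb w1" "hd w1 = z" "last w1 = c (i + 1)" "length w1 = n" "adj z (hd (tl w1))"
      "nb (w1 @ [c i])" using opposite_step[OF i zV a(1)] by blast
    obtain w2 where w2: "nb w2" "hd w2 = z" "last w2 = c (i - 1)" "length w2 = n" "adj z (hd (tl w2))"
      "nb (w2 @ [c i])" using opposite_step[OF i zV a(2)] by blast
    have "c (i + 1) \<noteq> c (i - 1)"
      using n_ge_3 zdvd_not_zless[of 2 "2 * int n"] by (auto simp: cycle_in_eq[OF c(1)])
    then have ne: "hd (tl w1) \<noteq> hd (tl w2)"
      using opposite_step_inj[OF w1(6) w2(6)] w1(2,3,4) w2(2,3,4) by auto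
    have "c (i + 1) \<in> K" "c (i - 1) \<in> K" using c(2) by auto
    then have "set w1 \<subseteq> K" "set w2 \<subseteq> K"
      using closed[OF w1(1)] closed[OF w2(1)] w1(2-4) w2(2-4) z by simp_all
    moreover have "hd (tl w) \<in> set w" if "length w = n" for w :: "'a list"
      using that n_ge_3 by (cases w; cases "tl w") auto
    ultimately have "hd (tl w1) \<in> K" "hd (tl w2) \<in> K" using w1(4) w2(4) by blast+
    then show ?thesis using ne w1(5) w2(5) z by (cases "hd (tl w1) = y") auto
  qed
  show ?thesis
  proof
    fix x y assume 7: "x \<in> K" "y \<in> K"
    then have xy: "x \<in> V" "y \<in> V" using KV by auto
    show "\<exists>w. nb_walk K ?A w \<and> hd w = x \<and> last w = y \<and> length w \<le> Suc n"
    proof (cases "dist x y < n")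
      case True
      obtain w where w: "nb w" "hd w = x" "last w = y" "length w = Suc (dist x y)"
        using dist_walk[OF xy] by blast
      then have "set w \<subseteq> K" using closed 7 True by simp
      then show ?thesis using w True unfolding nbK by (intro exI[of _ w]) simp
    next
      case False
      then have d: "dist x y = n" using dist_walk(2)[OF xy] by simp
      obtain v where v: "adj x v" "v \<in> K" using an 7(1) by meson
      obtain w where w: "nb w" "hd w = y" "last w = v" "length w = n" "nb (w @ [x])"
        using opposite_step[OF d xy(2) v(1)] by blast
      then have "set w \<subseteq> K" using closed 7 v by simp
      moreover have "w \<noteq> []" using w by auto
      ultimately show ?thesis using w nb_rev[OF w(5)] 7 unfolding nbK
        by (intro exI[of _ "x # rev w"]) (auto simp: last_rev)
    qed
  next
    fix w assume "nb_walk K ?A w" "2 \<le> length w" "hd w = last w"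
    then show "2 * n \<le> length w - 1" using girth nbK by blast
  next
    fix x y assume "x \<in> K"
    then show "\<exists>z. ?A x z \<and> z \<noteq> y" by (rule an)
  qed (use adj_sym adj_col n_ge_3 in blast)+
qed

definition thick_graph :: bool where
  "thick_graph \<longleftrightarrow> (\<forall>x\<in>V. \<forall>a b. \<exists>u. adj x u \<and> u \<noteq> a \<and> u \<noteq> b)"

text \<open>Every element is opposite some vertex of the cycle, and projection carries three
  neighbours of that vertex to three neighbours of the element. Thus finitely many elements can
  enforce thickness.\<close>

lemma thick_graphI:
  assumes c: "cycle_in adj (2 * int n) c"
    and th: "\<And>i. \<exists>u1 u2 u3. adj (c i) u1 \<and> adj (c i) u2 \<and> adj (c i) u3 \<and> u1 \<noteq> u2 \<and> u1 \<noteq> u3 \<and> u2 \<noteq> u3"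
  shows thick_graph
  unfolding thick_graph_def
proof (intro ballI allI)
  fix x a b assume x: "x \<in> V"
  obtain i where i: "dist (c i) x = n" using opposite_on_cycle[OF c x] by blast
  obtain u1 u2 u3 where u: "adj (c i) u1" "adj (c i) u2" "adj (c i) u3" "u1 \<noteq> u2" "u1 \<noteq> u3" "u2 \<noteq> u3"
    using th by blast
  have "\<exists>w. hd w = x \<and> last w = u \<and> length w = n \<and> adj x (hd (tl w)) \<and> nb (w @ [c i])" if "adj (c i) u" for u
    using opposite_step[OF i x that] by blast
  then obtain W where W: "\<And>u. adj (c i) u \<Longrightarrow> hd (W u) = x \<and> last (W u) = u \<and> length (W u) = n
      \<and> adj x (hd (tl (W u))) \<and> nb (W u @ [c i])" by metis
  have "hd (tl (W p)) \<noteq> hd (tl (W q))" if "adj (c i) p" "adj (c i) q" "p \<noteq> q" for p q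
    using opposite_step_inj[of "W p" "c i" "W q"] W[OF that(1)] W[OF that(2)] that(3) by metis
  then show "\<exists>u. adj x u \<and> u \<noteq> a \<and> u \<noteq> b" using W u by metis
qed

end

section \<open>Weak polygons and their incidence graphs\<close>

text \<open>A shortest closed walk does not turn back at its common end either, since deleting both
  end vertices would shorten it. Bipartiteness makes its length even.\<close>

lemma (in bipartite_graph) closed_walk_cycle:
  assumes w: "nb w" "2 \<le> length w" "hd w = last w"
  shows "\<exists>k c. 2 \<le> k \<and> 2 * k \<le> length w - 1 \<and> cycle_in adj (2 * int k) c"
proof -
  let ?P = "\<lambda>N. \<exists>w. nb w \<and> 2 \<le> length w \<and> hd w = last w \<and> length w = Suc N"
  define N where "N = Least ?P"
  have P: "?P (length w - 1)" using w by (intro exI[of _ w]) auto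
  obtain v where v: "nb v" "2 \<le> length v" "hd v = last v" "length v = Suc N"
    using LeastI[of ?P, OF P] unfolding N_def by blast
  have min: "N \<le> length u - 1" if "nb u" "2 \<le> length u" "hd u = last u" for u
    unfolding N_def by (rule Least_le) (use that in \<open>auto intro!: exI[of _ u]\<close>)
  have "odd (length v)" using walk_col[OF nb_walk_imp_walk[OF v(1)]] v(3) by simp
  then have ev: "even N" using v by simp
  have "v \<noteq> []" using v by auto
  then have v0: "v ! 0 = v ! N" using v by (simp add: hd_conv_nth last_conv_nth)
  have N2: "N \<noteq> 2"
  proof
    assume "N = 2"
    then have "v ! 0 \<noteq> v ! Suc (Suc 0)" using v(1,4) unfolding nb_walk_def by auto
    then show False using v0 \<open>N = 2\<close> by (simp add: numeral_2_eq_2)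
  qed
  then have N4: "4 \<le> N" using ev v by presburger
  have ends: "v ! 1 \<noteq> v ! (N - 1)"
  proof
    assume e: "v ! 1 = v ! (N - 1)"
    define u where "u = tl (butlast v)"
    have l: "length u = N - 1" using v unfolding u_def by simp
    have "nb (butlast v @ [last v])" using v \<open>v \<noteq> []\<close> by simp
    then have "nb (butlast v)" by (rule nb_walk_append1) (use v N4 in \<open>cases v; cases "tl v"; auto\<close>)
    then have nbu: "nb u" unfolding u_def using l N4 u_def by (cases "butlast v") (auto simp: nb_walk_Cons)
    have "u ! i = v ! Suc i" if "i < N - 1" for i
      using that l unfolding u_def by (simp add: nth_tl nth_butlast)
    moreover have "u \<noteq> []" using l N4 by auto
    moreover have "Suc (N - 1 - 1) = N - 1" using N4 by simp
    ultimately have "hd u = last u" using e l N4 by (metis One_nat_def diff_less hd_conv_nth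
      last_conv_nth length_greater_0_conv zero_less_one)
    moreover have "2 \<le> length u" using l N4 by simp
    ultimately have "N \<le> length u - 1" using min[OF nbu] by blast
    then show False using l N4 by simp
  qed
  have "cycle_in adj (int N) (\<lambda>i. v ! nat (i mod int N))"
    by (rule min_closed_walk_cycle) (use v N4 ends min in auto)
  moreover obtain k where "N = 2 * k" using ev by (elim evenE)
  ultimately show ?thesis using min[OF w] N4 by (intro exI[of _ k]) auto
qed

definition incident :: "('p, 'l) geometry \<Rightarrow> 'p + 'l \<Rightarrow> 'p + 'l \<Rightarrow> bool" where
  "incident G x y \<longleftrightarrow>
     (\<exists>p l. Inc G p l \<and> (x = Inl p \<and> y = Inr l \<or> x = Inr l \<and> y = Inl p))"

lemma incident_simps [simp]:
  "incident G (Inl p) (Inr l) \<longleftrightarrow> Inc G p l" "incident G (Inr l) (Inl p) \<longleftrightarrow> Inc G p l"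
  "\<not> incident G (Inl p) (Inl q)" "\<not> incident G (Inr l) (Inr m)"
  by (auto simp: incident_def)

lemma elements_simps [simp]:
  "Inl p \<in> elements G \<longleftrightarrow> p \<in> Pts G" "Inr l \<in> elements G \<longleftrightarrow> l \<in> Lns G"
  by (auto simp: elements_def)

lemma bipartite_graph_incident:
  "point_line_geometry G \<Longrightarrow> bipartite_graph (elements G) (incident G) isl"
  by unfold_locales (auto simp: incident_def point_line_geometry_def)

text \<open>Splits a position on a cycle into its kind, point or line, given by parity, and its
  index among the elements of that kind.\<close>

lemma mod_double_eq_iff:
  fixes i j K :: int
  shows "i mod (2 * K) = j mod (2 * K) \<longleftrightarrow> (even i \<longleftrightarrow> even j) \<and> (i div 2) mod K = (j div 2) mod K"
proof (cases "even i \<longleftrightarrow> even j")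
  case True
  then have "i - j = 2 * (i div 2 - j div 2)" by presburger
  then have "2 * K dvd i - j \<longleftrightarrow> K dvd i div 2 - j div 2"
    by (simp only: dvd_mult_cancel_left) simp
  then show ?thesis using True by (simp add: mod_eq_dvd_iff)
next
  case False
  then have "\<not> 2 dvd i - j" by presburger
  then have "\<not> 2 * K dvd i - j" using dvd_mult_left by blast
  then show ?thesis using False by (simp add: mod_eq_dvd_iff)
qed

lemma ordinary_polygon_cycle:
  assumes H: "subgeometry H G" "ordinary_polygon k H" and k: "2 \<le> k"
  shows "\<exists>c. cycle_in (incident G) (2 * int k) c \<and> range c = elements H"
proof -
  obtain p m where p: "bij_betw p {..<k} (Pts H)" and m: "bij_betw m {..<k} (Lns H)"
    and inc: "\<And>i j. i < k \<Longrightarrow> j < k \<Longrightarrow> Inc H (p i) (m j) \<longleftrightarrow> i = j \<or> i = (j + 1) mod k"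
    using H(2) unfolding ordinary_polygon_def by blast
  define r where "r i = nat ((i div 2) mod int k)" for i :: int
  \<comment> \<open>Points take the even positions and lines the odd ones, so that side
    \<open>m j\<close> stands between \<open>p j\<close> and \<open>p (j + 1)\<close>.\<close>
  define c where "c i = (if even i then Inl (p (r i)) else Inr (m (r i)))" for i :: int
  have r: "r i < k" "int (r i) = (i div 2) mod int k" for i using k unfolding r_def by (auto simp: nat_less_iff)
  have r_eq: "r i = r j \<longleftrightarrow> (i div 2) mod int k = (j div 2) mod int k" for i j
    using r(2)[of i] r(2)[of j] by linarith
  have inj: "p i = p j \<longleftrightarrow> i = j" "m i = m j \<longleftrightarrow> i = j" if "i < k" "j < k" for i j
    using p m that by (auto simp: bij_betw_def inj_on_def)
  have incG: "Inc G (p i) (m j) \<longleftrightarrow> Inc H (p i) (m j)" if "i < k" "j < k" for i j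
    using H(1) p m that unfolding subgeometry_def bij_betw_def by auto
  have rS: "r i = (r j + 1) mod k \<longleftrightarrow> (i div 2) mod int k = (j div 2 + 1) mod int k" for i j
  proof -
    have "int ((r j + 1) mod k) = (j div 2 + 1) mod int k"
      using r(2)[of j] by (simp add: zmod_int mod_simps add.commute)
    then show ?thesis using r(2)[of i] by linarith
  qed
  have "cycle_in (incident G) (2 * int k) c"
    unfolding cycle_in_def
  proof (intro conjI allI)
    fix i j
    show "(c i = c j) = (i mod (2 * int k) = j mod (2 * int k))"
      unfolding mod_double_eq_iff c_def using inj r_eq r(1) by auto
    have d: "(i + 1) div 2 = i div 2" if "even i" for i :: int using that by presburger
    have d': "(i + 1) div 2 = i div 2 + 1" if "odd i" for i :: int using that by presburger
    show "incident G (c i) (c j) =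
      (j mod (2 * int k) = (i + 1) mod (2 * int k) \<or> i mod (2 * int k) = (j + 1) mod (2 * int k))"
    proof -
      have I: "Inc G (p (r i)) (m (r j)) \<longleftrightarrow> r i = r j \<or> r i = (r j + 1) mod k" for i j
        using incG[OF r(1) r(1)] inc[OF r(1) r(1)] by blast
      have J: "Inc G (p (r i)) (m (r j)) \<longleftrightarrow>
          (j div 2) mod int k = (i div 2) mod int k \<or> (i div 2) mod int k = (j div 2 + 1) mod int k" for i j
        unfolding I rS r_eq by auto
      consider "even i" "even j" | "odd i" "odd j" | "even i" "odd j" | "odd i" "even j" by blast
      then show ?thesis
      proof cases
        case 3 then show ?thesis unfolding mod_double_eq_iff d[OF 3(1)] d'[OF 3(2)] by (simp add: c_def J)
      next
        case 4 then show ?thesis unfolding mod_double_eq_iff d[OF 4(2)] d'[OF 4(1)]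
          by (simp add: c_def J disj_commute)
      qed (simp_all add: mod_double_eq_iff c_def)
    qed
  qed
  moreover have "range c = elements H"
  proof -
    have "c i \<in> elements H" for i using p m r(1) unfolding c_def bij_betw_def by auto
    moreover have "x \<in> range c" if "x \<in> elements H" for x
    proof (cases x)
      case (Inl q)
      then have "q \<in> p ` {..<k}" using that p by (simp add: bij_betw_def)
      then obtain i where "i < k" "q = p i" by blast
      then have "x = c (2 * int i)" using Inl by (simp add: c_def r_def)
      then show ?thesis by blast
    next
      case (Inr q)
      then have "q \<in> m ` {..<k}" using that m by (simp add: bij_betw_def)
      then obtain i where "i < k" "q = m i" by blast
      then have "x = c (2 * int i + 1)" using Inr by (simp add: c_def r_def)
      then show ?thesis by blast
    qed
    ultimately show ?thesis by blast
  qed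
  ultimately show ?thesis by blast
qed

lemma cycle_isl:
  assumes c: "cycle_in (incident G) N c"
  shows "isl (c i) \<longleftrightarrow> (even i \<longleftrightarrow> isl (c 0))"
proof -
  have s: "isl (c (i + 1)) \<longleftrightarrow> \<not> isl (c i)" for i
    using cycle_in_adj[OF c, of i] by (auto simp: incident_def)
  show ?thesis
  proof (induction i rule: int_induct[where k = 0])
    case (step1 i) then show ?case using s[of i] by (cases "isl (c 0)") simp_all
  next
    case (step2 i) then show ?case using s[of "i - 1"] by (cases "isl (c 0)") simp_all
  qed simp
qed

lemma cycle_ordinary_polygon:
  assumes plg: "point_line_geometry G" and c: "cycle_in (incident G) (2 * int k) c" and k: "2 \<le> k"
  shows "\<exists>H. subgeometry H G \<and> ordinary_polygon k H \<and> elements H = range c"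
proof -
  \<comment> \<open>The cycle may start at a line; a shift by \<open>e\<close> puts a point at
    position 0.\<close>
  obtain e where e: "isl (c e)"
    using cycle_isl[OF c, of 1] by (cases "isl (c 0)") auto
  define d where "d i = c (i + e)" for i
  have d: "cycle_in (incident G) (2 * int k) d" unfolding d_def by (rule cycle_in_shift[OF c])
  have isl: "isl (d i) \<longleftrightarrow> even i" for i
    using cycle_isl[OF d, of i] e unfolding d_def by simp
  have rd: "range d = range c"
  proof -
    have "c i = d (i - e)" for i unfolding d_def by simp
    then have "range c \<subseteq> range d" by (metis image_subsetI rangeI)
    then show ?thesis unfolding d_def by auto
  qed
  define p where "p i = projl (d (2 * int i))" for i :: nat
  define m where "m i = projr (d (2 * int i + 1))" for i :: nat
  have p: "d (2 * int i) = Inl (p i)" for i using isl[of "2 * int i"] unfolding p_def by simp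
  have m: "d (2 * int i + 1) = Inr (m i)" for i using isl[of "2 * int i + 1"] unfolding m_def by simp
  define H where "H = \<lparr>Pts = p ` {..<k}, Lns = m ` {..<k},
    Inc = (\<lambda>q l. q \<in> p ` {..<k} \<and> l \<in> m ` {..<k} \<and> Inc G q l)\<rparr>"
  have incp: "Inc G (p i) (m j) \<longleftrightarrow> i = j \<or> i = (j + 1) mod k" if "i < k" "j < k" for i j
  proof -
    have "Inc G (p i) (m j) \<longleftrightarrow> incident G (d (2 * int i)) (d (2 * int j + 1))" by (simp add: p m)
    also have "\<dots> \<longleftrightarrow> int j mod int k = int i mod int k \<or> int i mod int k = (int j + 1) mod int k"
      using d unfolding cycle_in_def by (simp add: mod_double_eq_iff) (simp add: add.commute)
    also have "\<dots> \<longleftrightarrow> int j = int i \<or> int i = int ((j + 1) mod k)"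
      using that by (simp add: zmod_int add.commute)
    also have "\<dots> \<longleftrightarrow> i = j \<or> i = (j + 1) mod k" by (simp only: of_nat_eq_iff) auto
    finally show ?thesis .
  qed
  have dV: "d i \<in> elements G" for i
    using bipartite_graph.adj_in[OF bipartite_graph_incident[OF plg] cycle_in_adj[OF d]] .
  have "p i \<in> Pts G" "m i \<in> Lns G" for i
    using dV[of "2 * int i"] dV[of "2 * int i + 1"] by (simp_all add: p m)
  then have "subgeometry H G" unfolding subgeometry_def H_def by auto
  moreover have "ordinary_polygon k H"
  proof -
    have "p i = p j \<Longrightarrow> i = j" if "i < k" "j < k" for i j
    proof -
      assume "p i = p j"
      then have "d (2 * int i) = d (2 * int j)" by (simp add: p)
      then have "int i mod int k = int j mod int k" using d unfolding cycle_in_def by (simp add: mod_double_eq_iff)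
      then show "i = j" using that by simp
    qed
    then have "bij_betw p {..<k} (Pts H)" unfolding H_def bij_betw_def inj_on_def by auto
    moreover have "m i = m j \<Longrightarrow> i = j" if "i < k" "j < k" for i j
    proof -
      assume "m i = m j"
      then have "d (2 * int i + 1) = d (2 * int j + 1)" by (simp add: m)
      then have "int i mod int k = int j mod int k"
        using d unfolding cycle_in_def by (simp add: mod_double_eq_iff)
      then show "i = j" using that by simp
    qed
    then have "bij_betw m {..<k} (Lns H)" unfolding H_def bij_betw_def inj_on_def by auto
    ultimately show ?thesis unfolding ordinary_polygon_def
      by (intro exI[of _ p] exI[of _ m]) (auto simp: H_def incp)
  qed
  moreover have "elements H = range d"
  proof -
    have "x \<in> range d" if "x \<in> elements H" for x
      using that unfolding elements_def H_def by (auto simp flip: p m)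
    moreover have "d i \<in> elements H" for i
    proof -
      define j where "j = nat ((i div 2) mod int k)"
      have j: "j < k" "int j = (i div 2) mod int k" using k unfolding j_def by (auto simp: nat_less_iff)
      show ?thesis
      proof (cases "even i")
        case True
        then have "d i = d (2 * int j)" using d j unfolding cycle_in_def by (simp add: mod_double_eq_iff)
        then have "d i = Inl (p j)" by (simp only: p)
        then show ?thesis using j(1) by (simp add: H_def)
      next
        case False
        then have "d i = d (2 * int j + 1)"
          using d j unfolding cycle_in_def by (simp add: mod_double_eq_iff)
        then have "d i = Inr (m j)" by (simp only: m)
        then show ?thesis using j(1) by (simp add: H_def)
      qed
    qed
    ultimately show ?thesis by blast
  qed
  ultimately show ?thesis using rd by auto
qed

text \<open>One of the two arcs between the given vertices has at most \<open>n\<close> edges; the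
  backward arc is the forward one with \<open>i\<close> and \<open>j\<close> exchanged.\<close>

lemma (in bipartite_graph) cycle_diam:
  assumes c: "cycle_in adj (2 * int n) c" and n: "2 \<le> n"
  shows "\<exists>w. nb w \<and> hd w = c i \<and> last w = c j \<and> length w \<le> Suc n"
proof -
  have up: "\<exists>w. nb w \<and> hd w = c i \<and> last w = c j \<and> length w \<le> Suc n"
    if "(j - i) mod (2 * int n) \<le> int n" for i j
  proof -
    define k where "k = nat ((j - i) mod (2 * int n))"
    let ?w = "map (\<lambda>t. c (i + int t)) [0..<Suc k]"
    have k: "int k = (j - i) mod (2 * int n)" unfolding k_def using n by simp
    have "2 * int n dvd (j - i) - (j - i) mod (2 * int n)" by (rule dvd_minus_mod)
    then have "2 * int n dvd j - (i + int k)" using k by (simp add: algebra_simps)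
    then have "c (i + int k) = c j" using cycle_in_eq[OF c] by metis
    then have "last ?w = c j" by simp
    moreover have "hd ?w = c i" by (simp add: hd_map del: upt_Suc)
    moreover have "nb ?w" using cycle_nb_walk[OF c] n by simp
    moreover have "length ?w \<le> Suc n" using k that by simp
    ultimately show ?thesis by blast
  qed
  show ?thesis
  proof (cases "(j - i) mod (2 * int n) \<le> int n")
    case False
    then have "(i - j) mod (2 * int n) \<le> int n"
      using zmod_zminus1_eq_if[of "j - i" "2 * int n"] by (auto split: if_splits)
    from up[OF this] obtain w where w: "nb w" "hd w = c j" "last w = c i" "length w \<le> Suc n" by blast
    moreover have "w \<noteq> []" using w by auto
    ultimately show ?thesis using nb_rev[OF w(1)]
      by (intro exI[of _ "rev w"]) (simp add: hd_rev last_rev)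
  qed (rule up)
qed

text \<open>A short closed walk yields an induced cycle, which is an ordinary subpolygon, so the ban
  on small polygons is the girth condition. Common ordinary \<open>n\<close>-gons give diameter and
  degrees, and \<open>cycle_through\<close> recovers them.\<close>

theorem weak_polygon_iff:
  "weak_polygon n G \<longleftrightarrow>
     point_line_geometry G \<and> ngon_graph (elements G) (incident G) isl n" (is "_ \<longleftrightarrow> ?R")
proof
  assume w: "weak_polygon n G"
  then have n: "3 \<le> n" and plg: "point_line_geometry G"
    and no: "\<And>k H. 2 \<le> k \<Longrightarrow> k < n \<Longrightarrow> subgeometry H G \<Longrightarrow> \<not> ordinary_polygon k H"
    unfolding weak_polygon_def by blast+
  have cyc: "\<exists>c. cycle_in (incident G) (2 * int n) c \<and> x \<in> range c \<and> y \<in> range c"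
    if "x \<in> elements G" "y \<in> elements G" for x y
  proof -
    obtain H where "subgeometry H G" "ordinary_polygon n H" "x \<in> elements H" "y \<in> elements H"
      using w \<open>x \<in> elements G\<close> \<open>y \<in> elements G\<close> unfolding weak_polygon_def by blast
    then show ?thesis using ordinary_polygon_cycle[of H G n] n by auto
  qed
  interpret bipartite_graph "elements G" "incident G" isl by (rule bipartite_graph_incident[OF plg])
  have "ngon_graph (elements G) (incident G) isl n"
  proof
    show "3 \<le> n" by (rule n)
    fix w assume "nb w" "2 \<le> length w" "hd w = last w"
    then obtain k c where k: "2 \<le> k" "2 * k \<le> length w - 1" "cycle_in (incident G) (2 * int k) c"
      using closed_walk_cycle by blast
    then show "2 * n \<le> length w - 1"
      using cycle_ordinary_polygon[OF plg k(3,1)] no[OF k(1)] by (cases "k < n") auto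
  next
    fix x y assume "x \<in> elements G" "y \<in> elements G"
    then show "\<exists>w. nb w \<and> hd w = x \<and> last w = y \<and> length w \<le> Suc n"
      using cyc[of x y] cycle_diam[of n] n by fastforce
  next
    fix x y assume "x \<in> elements G"
    then obtain c i where c: "cycle_in (incident G) (2 * int n) c" "x = c i" using cyc by blast
    have "c (i + 1) \<noteq> c (i - 1)"
      using n zdvd_not_zless[of 2 "2 * int n"] by (auto simp: cycle_in_eq[OF c(1)])
    moreover have "incident G x (c (i + 1))" "incident G x (c (i - 1))"
      using cycle_in_adj[OF c(1), of i] cycle_in_adj[OF c(1), of "i - 1"] adj_sym c(2) by auto
    ultimately show "\<exists>z. incident G x z \<and> z \<noteq> y" by metis
  qed
  then show ?R using plg by blast
next
  assume R: ?R
  then have plg: "point_line_geometry G" by blast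
  interpret ngon_graph "elements G" "incident G" isl n using R by blast
  show "weak_polygon n G"
    unfolding weak_polygon_def
  proof (intro conjI ballI allI impI notI)
    fix x y assume "x \<in> elements G" "y \<in> elements G"
    then obtain c where "cycle_in (incident G) (2 * int n) c" "x \<in> range c" "y \<in> range c"
      by (rule cycle_through)
    then show "\<exists>H. subgeometry H G \<and> ordinary_polygon n H \<and> x \<in> elements H \<and> y \<in> elements H"
      using cycle_ordinary_polygon[OF plg, of n c] n_ge_3 by auto
  next
    fix k assume k: "2 \<le> k \<and> k < n" and "\<exists>H. subgeometry H G \<and> ordinary_polygon k H"
    then obtain c where c: "cycle_in (incident G) (2 * int k) c"
      using ordinary_polygon_cycle by blast
    let ?w = "map (\<lambda>t. c (0 + int t)) [0..<Suc (2 * k)]"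
    have "nb ?w" by (rule cycle_nb_walk[OF c]) (use k in simp)
    moreover have "c 0 = c (2 * int k)" using cycle_in_eq[OF c] by simp
    then have "hd ?w = last ?w" by (simp add: hd_map del: upt_Suc) simp
    moreover have "2 \<le> length ?w" using k by simp
    ultimately have "2 * n \<le> length ?w - 1" using girth by blast
    then show False using k by simp
  qed (use plg n_ge_3 in auto)
qed

section \<open>Finite polygons over a cycle\<close>

text \<open>With \<open>u = v - 2\<close>, the term standing apart in \<open>E\<close> is the last
  summand of the identity: \<open>\<alpha> (u + n - 1) * \<beta> (u + n)\<close> equals
  \<open>\<beta> (v - 3) * \<alpha> (v - 2)\<close> by the antipodal symmetry
  \<open>ab\<close>.\<close>

lemma consecutive_zeros:
  fixes \<alpha> \<beta> :: "int \<Rightarrow> int" and n :: nat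
  assumes n: "3 \<le> n"
    and ab: "\<And>i. \<alpha> (i + int n) = \<beta> i" "\<And>i. \<beta> (i + int n) = \<alpha> i"
    and nonneg: "\<And>i. 0 \<le> \<alpha> i" "\<And>i. 0 \<le> \<beta> i" and pos: "\<And>i. 1 \<le> \<alpha> i + \<beta> i"
    and E: "\<And>v. \<alpha> (v - 2) * \<alpha> (v - 1) =
      \<beta> (v - 3) * \<alpha> (v - 2) + (\<Sum>i<n - 2. \<alpha> (v - 1 + int i) * \<beta> (v + int i))"
  shows "\<exists>u. \<forall>i. u \<le> i \<and> i < u + int n - 1 \<longrightarrow> \<alpha> i = 0"
proof -
  define T where "T v = (\<Sum>i<n - 2. \<alpha> (v - 1 + int i) * \<beta> (v + int i))" for v
  have E': "\<alpha> (v - 2) * \<alpha> (v - 1) = \<beta> (v - 3) * \<alpha> (v - 2) + T v" for v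
    using E unfolding T_def .
  have n3: "int (n - 3) = int n - 3" using n by simp
  have nS: "n - 2 = Suc (n - 3)" using n by simp
  have Tdiff: "T (v + 1) - T v = \<beta> (v - 3) * \<alpha> (v - 2) - \<alpha> (v - 1) * \<beta> v" for v
  proof -
    have "T v = \<alpha> (v - 1) * \<beta> v + (\<Sum>i<n - 3. \<alpha> (v + int i) * \<beta> (v + 1 + int i))"
      unfolding T_def nS sum.lessThan_Suc_shift by (simp add: algebra_simps)
    moreover have "T (v + 1) = (\<Sum>i<n - 3. \<alpha> (v + int i) * \<beta> (v + 1 + int i)) + \<beta> (v - 3) * \<alpha> (v - 2)"
      using ab(1)[of "v - 3"] ab(2)[of "v - 2"]
      unfolding T_def nS sum.lessThan_Suc by (simp add: n3 algebra_simps)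
    ultimately show ?thesis by simp
  qed
  \<comment> \<open>Two consecutive instances of \<open>E'\<close> differ by a multiple of
    \<open>\<alpha> (v - 1)\<close>, because \<open>T\<close> telescopes. A shift by
    \<open>n\<close> exchanges \<alpha> and \<beta>, so \<open>\<beta> (v - 1)\<close> may replace
    that factor, and one of the two is nonzero.\<close>
  have Q: "\<alpha> v + \<beta> v = \<alpha> (v - 2) + \<beta> (v - 2)" for v
  proof -
    have "\<alpha> (v - 1) * (\<alpha> v + \<beta> v - (\<alpha> (v - 2) + \<beta> (v - 2))) = 0" for v
      using E'[of v] E'[of "v + 1"] Tdiff[of v] by (simp add: algebra_simps)
    from this[of v] this[of "v + int n"] have
      "\<alpha> (v - 1) * (\<alpha> v + \<beta> v - (\<alpha> (v - 2) + \<beta> (v - 2))) = 0"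
      "\<beta> (v - 1) * (\<alpha> v + \<beta> v - (\<alpha> (v - 2) + \<beta> (v - 2))) = 0"
      using ab(1)[of v] ab(2)[of v] ab(1)[of "v - 1"] ab(1)[of "v - 2"] ab(2)[of "v - 2"]
      by (simp_all add: algebra_simps)
    then show ?thesis using pos[of "v - 1"] by auto
  qed
  have "\<exists>u. \<alpha> u = 0"
  proof (rule ccontr)
    assume "\<nexists>u. \<alpha> u = 0"
    then have ap: "0 < \<alpha> i" for i using nonneg(1)[of i] by (metis less_le)
    then have bp: "0 < \<beta> i" for i using ab(1)[of i] by metis
    have "\<beta> (v - 3) < \<alpha> (v - 1)" for v
    proof -
      have "0 < T v" unfolding T_def using ap bp n by (intro sum_pos) (auto simp: lessThan_empty_iff)
      then have "\<alpha> (v - 2) * \<beta> (v - 3) < \<alpha> (v - 2) * \<alpha> (v - 1)" using E'[of v] by (simp add: mult.commute)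
      then show ?thesis using ap[of "v - 2"] by simp
    qed
    \<comment> \<open>The two instances read \<open>\<beta> (-3) < \<alpha> (-1)\<close> and,
      antipodally, \<open>\<alpha> (-3) < \<beta> (-1)\<close>; their sum contradicts
      \<open>Q\<close>.\<close>
    from this[of 0] this[of "int n"] show False
      using Q[of "-1"] ab(1)[of "-1"] ab(2)[of "-3"] by (simp add: algebra_simps)
  qed
  then obtain u where u: "\<alpha> u = 0" by blast
  \<comment> \<open>The zero at \<open>u\<close> makes the nonnegative sum \<open>T (u + 2)\<close>
    vanish, hence each summand. The products at both ends of the range contain
    \<open>\<alpha> u\<close> itself, the last one as \<open>\<beta> (u + int n)\<close>.\<close>
  have g: "\<alpha> j * \<beta> (j + 1) = 0" if "u \<le> j" "j < u + int n" for j
  proof (cases "j = u \<or> j = u + int n - 1")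
    case True then show ?thesis using u ab(2)[of u] by auto
  next
    case False
    have "T (u + 2) = 0" using E'[of "u + 2"] u by simp
    then have "\<alpha> (u + 1 + int i) * \<beta> (u + 2 + int i) = 0" if "i < n - 2" for i
    proof -
      have "\<forall>i\<in>{..<n - 2}. \<alpha> (u + 2 - 1 + int i) * \<beta> (u + 2 + int i) = 0"
        using \<open>T (u + 2) = 0\<close> nonneg unfolding T_def by (subst (asm) sum_nonneg_eq_0_iff) auto
      then have "\<alpha> (u + 2 - 1 + int i) * \<beta> (u + 2 + int i) = 0" using that by blast
      then show ?thesis by (simp add: add_ac)
    qed
    moreover have "nat (j - u - 1) < n - 2" "int (nat (j - u - 1)) = j - u - 1" using False that by auto
    ultimately have "\<alpha> (u + 1 + (j - u - 1)) * \<beta> (u + 2 + (j - u - 1)) = 0" by metis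
    then show ?thesis by (simp add: add.commute)
  qed
  let ?P = "\<lambda>t. 0 < \<alpha> (u + int t)"
  have Pn: "?P n" using pos[of u] u ab(1)[of u] by simp
  define t where "t = Least ?P"
  have t: "?P t" "t \<le> n" using LeastI[of ?P, OF Pn] Least_le[of ?P, OF Pn] unfolding t_def by auto
  have tz: "\<alpha> (u + int i) = 0" if "i < t" for i
    using not_less_Least[of i ?P] that nonneg(1)[of "u + int i"] unfolding t_def by fastforce
  \<comment> \<open>Once positive, \<alpha> stays positive up to \<open>u + n\<close>: by
    \<open>g\<close> the next \<beta> vanishes, and \<open>pos\<close> then makes the next \<alpha>
    positive.\<close>
  have up: "0 < \<alpha> (u + int i) \<and> (t < i \<longrightarrow> \<beta> (u + int i) = 0)" if "t \<le> i" "i \<le> n" for i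
    using that
  proof (induction i rule: dec_induct)
    case (step i)
    then have "\<beta> (u + int i + 1) = 0" using g[of "u + int i"] by auto
    then show ?case using pos[of "u + int i + 1"] by (simp add: algebra_simps)
  qed (use t in auto)
  \<comment> \<open>The zeros of \<beta> at \<open>u + t + 1, ..., u + n\<close> are zeros of
    \<alpha> \<open>n\<close> positions earlier. They adjoin the zeros at
    \<open>u, ..., u + t - 1\<close>, which makes \<open>n - 1\<close> in a row.\<close>
  have "\<alpha> i = 0" if i: "u + int t - int n + 1 \<le> i" "i < u + int t - int n + 1 + int n - 1" for i
  proof (cases "u \<le> i")
    case True then show ?thesis using tz[of "nat (i - u)"] i by simp
  next
    case False
    then show ?thesis using up[of "nat (i + int n - u)"] i ab(2)[of i] by (simp add: algebra_simps)
  qed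
  then show ?thesis by blast
qed

section \<open>Maps onto a cycle of length \<open>2 * n\<close>, given as labels modulo
  \<open>2 * n\<close>\<close>

locale labelled_ngon = ngon_graph +
  fixes h :: "'a \<Rightarrow> int"
  assumes h_adj: "adj x y \<Longrightarrow> 2 * int n dvd h y - h x - 1 \<or> 2 * int n dvd h y - h x + 1"
    and h_surj: "\<exists>x\<in>V. 2 * int n dvd h x - i"
begin

definition layer :: "int \<Rightarrow> 'a set" where "layer i = {x \<in> V. 2 * int n dvd h x - i}"

lemma layer_in: "x \<in> layer i \<Longrightarrow> x \<in> V" by (simp add: layer_def)
lemma layer_nonempty: "\<exists>x. x \<in> layer i" using h_surj by (auto simp: layer_def)

lemma layer_diff: "x \<in> layer i \<Longrightarrow> x \<in> layer j \<longleftrightarrow> 2 * int n dvd i - j"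
proof -
  assume x: "x \<in> layer i"
  then have d: "2 * int n dvd h x - i" by (simp add: layer_def)
  have "h x - j = (h x - i) + (i - j)" by simp
  then have "2 * int n dvd h x - j \<longleftrightarrow> 2 * int n dvd i - j" using d by (metis dvd_add_right_iff)
  then show ?thesis using x by (simp add: layer_def)
qed

lemma layer_cong: "2 * int n dvd i - j \<Longrightarrow> layer i = layer j"
  using layer_diff dvd_diff_commute by blast

lemma layer_disjoint:
  assumes "x \<in> layer i" "x \<in> layer j" "\<bar>i - j\<bar> < 2 * int n" shows "i = j"
  using layer_diff[OF assms(1)] assms(2,3) zdvd_imp_le[of "2 * int n" "\<bar>i - j\<bar>"] by fastforce

lemma layer_adj: "adj x y \<Longrightarrow> x \<in> layer i \<Longrightarrow> y \<in> layer (i + 1) \<or> y \<in> layer (i - 1)"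
proof -
  assume a: "adj x y" and x: "x \<in> layer i"
  have d: "2 * int n dvd h x - i" using x by (simp add: layer_def)
  have "h y - (i + 1) = (h y - h x - 1) + (h x - i)" "h y - (i - 1) = (h y - h x + 1) + (h x - i)" by simp_all
  then show ?thesis using h_adj[OF a] adj_in2[OF a] d unfolding layer_def by (metis (mono_tags, lifting) dvd_add mem_Collect_eq)
qed

definition nbr :: "'a \<Rightarrow> int \<Rightarrow> 'a set" where "nbr x j = {y \<in> layer j. adj x y}"

definition ext :: "'a list set \<Rightarrow> int \<Rightarrow> 'a list set" where
  "ext W j = {z # w |z w. w \<in> W \<and> nb (z # w) \<and> z \<in> layer j}"

text \<open>Non-backtracking walks from \<open>x\<close>, head last: those whose labels go straight up from \<open>v\<close>,
  and those with exactly one downward step, which is the last step in \<open>dip\<close> but not in \<open>bent\<close>.\<close>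

primrec straight :: "'a \<Rightarrow> int \<Rightarrow> nat \<Rightarrow> 'a list set" where
  "straight x v 0 = {[x]}"
| "straight x v (Suc k) = ext (straight x v k) (v + int k + 1)"

definition dip :: "'a \<Rightarrow> int \<Rightarrow> nat \<Rightarrow> 'a list set" where
  "dip x v k = ext (straight x v k) (v + int k - 1)"

primrec bent :: "'a \<Rightarrow> int \<Rightarrow> nat \<Rightarrow> 'a list set" where
  "bent x v 0 = ext (dip x v 0) v"
| "bent x v (Suc k) = ext (dip x v (Suc k)) (v + int k + 1) \<union> ext (bent x v k) (v + int k + 1)"

lemma straight_walk:
  assumes x: "x \<in> layer v" and w: "w \<in> straight x v k"
  shows "nb w \<and> last w = x \<and> length w = Suc k \<and> hd w \<in> layer (v + int k) \<and>
     (0 < k \<longrightarrow> hd (tl w) \<in> layer (v + int k - 1) \<and> last (butlast w) \<in> layer (v + 1))"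
  using w
proof (induction k arbitrary: w)
  case 0 then show ?case using x layer_in by simp
next
  case (Suc k)
  then obtain z u where u: "w = z # u" "u \<in> straight x v k" "nb (z # u)" "z \<in> layer (v + int k + 1)"
    by (auto simp: ext_def)
  have IH: "nb u" "last u = x" "length u = Suc k" "hd u \<in> layer (v + int k)"
    "0 < k \<longrightarrow> last (butlast u) \<in> layer (v + 1)" using Suc.IH[OF u(2)] by blast+
  have "u \<noteq> []" using IH by auto
  moreover have "last (butlast w) \<in> layer (v + 1)"
  proof (cases "k = 0")
    case True then show ?thesis using u IH by (cases u) auto
  next
    case False
    then have "butlast u \<noteq> []" using IH(3) by (cases u; cases "tl u") auto
    then show ?thesis using u IH False \<open>u \<noteq> []\<close> by simp
  qed
  ultimately show ?case using IH u by (simp add: add_ac)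
qed

lemma dip_walk:
  assumes x: "x \<in> layer v" and w: "w \<in> dip x v k"
  shows "nb w \<and> last w = x \<and> length w = Suc (Suc k) \<and> hd w \<in> layer (v + int k - 1) \<and>
     hd (tl w) \<in> layer (v + int k)"
proof -
  obtain z u where u: "w = z # u" "u \<in> straight x v k" "nb (z # u)" "z \<in> layer (v + int k - 1)"
    using w by (auto simp: ext_def dip_def)
  then show ?thesis using straight_walk[OF x u(2)] by auto
qed

lemma bent_walk:
  assumes x: "x \<in> layer v" and w: "w \<in> bent x v k"
  shows "nb w \<and> last w = x \<and> length w = Suc (Suc (Suc k)) \<and> hd w \<in> layer (v + int k) \<and>
     hd (tl w) \<in> layer (v + int k - 1)"
  using w
proof (induction k arbitrary: w)
  case 0
  then obtain z u where u: "w = z # u" "u \<in> dip x v 0" "nb (z # u)" "z \<in> layer v"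
    by (auto simp: ext_def)
  then show ?case using dip_walk[OF x u(2)] by auto
next
  case (Suc k)
  then obtain z u where u: "w = z # u" "u \<in> dip x v (Suc k) \<or> u \<in> bent x v k" "nb (z # u)"
    "z \<in> layer (v + int k + 1)"
    by (auto simp: ext_def)
  then show ?case using dip_walk[OF x, of u "Suc k"] Suc.IH[of u] by (auto simp: add_ac)
qed

text \<open>Here \<open>j\<close> is the number of downward steps; each lowers the final label by 2
  against a straight ascent. The label reached by a short walk therefore reveals its class.\<close>

lemma walk_classification:
  assumes x: "x \<in> layer v" and w: "nb w" "last w = x"
  shows "\<exists>j < length w. hd w \<in> layer (v + int (length w) - 1 - 2 * int j) \<and>
     (j = 0 \<longrightarrow> w \<in> straight x v (length w - 1)) \<and>
     (j = 1 \<longrightarrow> w \<in> dip x v (length w - 2) \<or> 3 \<le> length w \<and> w \<in> bent x v (length w - 3))"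
  using w
proof (induction w)
  case (Cons z w)
  show ?case
  proof (cases "w = []")
    case True then show ?thesis using Cons.prems x by simp
  next
    case False
    have nbw: "nb w" "last w = x" "adj (hd w) z" using Cons.prems False adj_sym by (auto simp: nb_walk_Cons)
    obtain l where l: "length w = Suc l" using False by (cases w) auto
    obtain j where j: "j \<le> l" "hd w \<in> layer (v + int l - 2 * int j)"
      "j = 0 \<Longrightarrow> w \<in> straight x v l"
      "j = 1 \<Longrightarrow> w \<in> dip x v (l - 1) \<or> 2 \<le> l \<and> w \<in> bent x v (l - 2)"
      using Cons.IH[OF nbw(1,2)] l by (auto simp: less_Suc_eq_le)
    have ext_I: "z # w \<in> ext W i" if "w \<in> W" "z \<in> layer i" for W i
      using that Cons.prems by (auto simp: ext_def)
    from layer_adj[OF nbw(3) j(2)] show ?thesis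
    proof
      assume z: "z \<in> layer (v + int l - 2 * int j + 1)"
      have "z # w \<in> straight x v (Suc l)" if "j = 0" using ext_I[OF j(3)[OF that]] z that by simp
      moreover have "z # w \<in> bent x v (l - 1)" if j1: "j = 1"
      proof -
        have zl: "z \<in> layer (v + int (l - 1))" using z j1 j(1) by (simp add: of_nat_diff add_ac)
        show ?thesis
        proof (cases "l = 1")
          case True then show ?thesis using j(4)[OF j1] zl ext_I by auto
        next
          case False
          then obtain m where m: "l = Suc (Suc m)" using j1 j(1) by (metis Suc_le_D One_nat_def le_antisym not_less_eq_eq)
          have "z \<in> layer (v + int m + 1)" using zl m by (simp add: add_ac)
          then show ?thesis using j(4)[OF j1] m ext_I by auto
        qed
      qed
      moreover have "z \<in> layer (v + int (length (z # w)) - 1 - 2 * int j)"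
        using z l by (simp add: algebra_simps)
      moreover have "length (z # w) - 1 = Suc l" "length (z # w) - 3 = l - 1" "j < length (z # w)"
        "j = 1 \<Longrightarrow> 3 \<le> length (z # w)" using l j(1) by auto
      ultimately show ?thesis by (metis list.sel(1))
    next
      assume z: "z \<in> layer (v + int l - 2 * int j - 1)"
      have "z # w \<in> dip x v l" if "j = 0" using ext_I[OF j(3)[OF that]] z that by (simp add: dip_def)
      moreover have "z \<in> layer (v + int (length (z # w)) - 1 - 2 * int (Suc j))"
        using z l by (simp add: algebra_simps)
      moreover have "length (z # w) - 2 = l" "Suc j < length (z # w)" using l j(1) by auto
      ultimately show ?thesis by (metis list.sel(1) One_nat_def nat.inject nat.distinct(1))
    qed
  qed
qed simp

text \<open>At most \<open>n\<close> edges lead to labels from \<open>v - n\<close> to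
  \<open>v + n\<close>, where nothing but \<open>v + n - 1\<close> is congruent to it modulo
  \<open>2 * n\<close>. A single downward step already puts this label out of reach.\<close>

lemma layer_straight:
  assumes x: "x \<in> layer v" and w: "nb w" "last w = x" "hd w \<in> layer (v + int n - 1)" "length w \<le> Suc n"
  shows "w \<in> straight x v (n - 1)" "length w = n"
proof -
  obtain j where j: "j < length w" "hd w \<in> layer (v + int (length w) - 1 - 2 * int j)"
    "j = 0 \<longrightarrow> w \<in> straight x v (length w - 1)"
    using walk_classification[OF x w(1,2)] by blast
  have "v + int (length w) - 1 - 2 * int j = v + int n - 1"
    by (rule layer_disjoint[OF j(2) w(3)]) (use j(1) w(4) n_ge_3 in linarith)
  then have e: "int (length w) = int n + 2 * int j" by simp
  then have "j = 0" using w(4) by linarith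
  moreover have "length w = n" using e \<open>j = 0\<close> by simp
  ultimately have "j = 0" "length w = n" by blast+
  then show "w \<in> straight x v (n - 1)" "length w = n" using j(3) by auto
qed

text \<open>Surjectivity is the diameter, injectivity the girth. The fibre becomes a set of walks
  that can be counted step by step.\<close>

lemma straight_bij:
  assumes x: "x \<in> layer v"
  shows "bij_betw hd (straight x v (n - 1)) (layer (v + int n - 1))"
proof -
  have len: "Suc (n - 1) = n" "v + int (n - 1) = v + int n - 1" using n_ge_3 by simp_all
  have "inj_on hd (straight x v (n - 1))"
  proof (rule inj_onI)
    fix u w assume "u \<in> straight x v (n - 1)" "w \<in> straight x v (n - 1)" "hd u = hd w"
    then show "u = w" using straight_walk[OF x, of u "n - 1"] straight_walk[OF x, of w "n - 1"] len
      by (intro nb_walk_unique) auto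
  qed
  moreover have "y \<in> hd ` straight x v (n - 1)" if y: "y \<in> layer (v + int n - 1)" for y
  proof -
    obtain w where w: "nb w" "hd w = y" "last w = x" "length w \<le> Suc n"
      using diam[OF layer_in[OF y] layer_in[OF x]] by blast
    then show ?thesis using layer_straight(1)[OF x w(1)] y by blast
  qed
  moreover have "hd w \<in> layer (v + int n - 1)" if "w \<in> straight x v (n - 1)" for w
    using straight_walk[OF x that] len(2) by metis
  ultimately show ?thesis unfolding bij_betw_def by blast
qed

text \<open>A walk with fewer than \<open>n\<close> edges cannot change the label by
  \<open>n\<close> modulo \<open>2 * n\<close>.\<close>

lemma opposite_labels:
  assumes x: "x \<in> layer v" and y: "y \<in> layer (v + int n)"
  shows "dist y x = n"
proof -
  obtain w where w: "nb w" "hd w = y" "last w = x" "length w = Suc (dist y x)"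
    using dist_walk[OF layer_in[OF y] layer_in[OF x]] by blast
  have le: "dist y x \<le> n" using dist_walk(2) layer_in x y by blast
  obtain j where j: "j < length w" "hd w \<in> layer (v + int (length w) - 1 - 2 * int j)"
    using walk_classification[OF x w(1,3)] by blast
  have yj: "y \<in> layer (v + int (dist y x) - 2 * int j)" using j(2) w by simp
  show ?thesis
  proof (rule ccontr)
    assume "dist y x \<noteq> n"
    then have "v + int (dist y x) - 2 * int j = v + int n"
      using j(1) w(4) le by (intro layer_disjoint[OF yj y]) linarith
    then show False using le \<open>dist y x \<noteq> n\<close> by linarith
  qed
qed

lemma finite_layer: "finite V \<Longrightarrow> finite (layer i)" by (simp add: layer_def)
lemma finite_nbr: "finite V \<Longrightarrow> finite (nbr x i)" by (simp add: nbr_def finite_layer)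

text \<open>Projection from \<open>y\<close> to \<open>x\<close> is injective, and it takes lower
  neighbours of \<open>y\<close> to upper neighbours of \<open>x\<close> because the geodesics
  involved are straight.\<close>

lemma nbr_opposite_le:
  assumes fin: "finite V" and x: "x \<in> layer v" and y: "y \<in> layer (v + int n)"
  shows "card (nbr y (v + int n - 1)) \<le> card (nbr x (v + 1))"
proof -
  have "\<exists>w. hd w = x \<and> last w = z \<and> length w = n \<and> nb (w @ [y]) \<and> hd (tl w) \<in> nbr x (v + 1)"
    if z: "z \<in> nbr y (v + int n - 1)" for z
  proof -
    obtain w where w: "nb w" "hd w = x" "last w = z" "length w = n" "adj x (hd (tl w))" "nb (w @ [y])"
      using opposite_step[OF opposite_labels[OF x y] layer_in[OF x], of z] z unfolding nbr_def by auto
    have "last (rev w) = x" "hd (rev w) \<in> layer (v + int n - 1)" "length (rev w) \<le> Suc n"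
      using w z n_ge_3 unfolding nbr_def by (simp_all add: last_rev hd_rev)
    then have "rev w \<in> straight x v (n - 1)" by (rule layer_straight(1)[OF x nb_rev[OF w(1)]])
    then have "last (butlast (rev w)) \<in> layer (v + 1)"
      using straight_walk[OF x, of "rev w" "n - 1"] n_ge_3 by simp
    moreover obtain p q t where "w = p # q # t" using w(4) n_ge_3 by (cases w; cases "tl w") auto
    then have "last (butlast (rev w)) = hd (tl w)" by (simp add: butlast_append)
    ultimately have "hd (tl w) \<in> nbr x (v + 1)" using w(5) unfolding nbr_def by simp
    then show ?thesis using w by blast
  qed
  then obtain W where W: "\<And>z. z \<in> nbr y (v + int n - 1) \<Longrightarrow> hd (W z) = x \<and> last (W z) = z \<and>
    length (W z) = n \<and> nb (W z @ [y]) \<and> hd (tl (W z)) \<in> nbr x (v + 1)" by metis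
  have "inj_on (\<lambda>z. hd (tl (W z))) (nbr y (v + int n - 1))"
  proof (rule inj_onI)
    fix p q assume pq: "p \<in> nbr y (v + int n - 1)" "q \<in> nbr y (v + int n - 1)"
      "hd (tl (W p)) = hd (tl (W q))"
    have "W p = W q"
      by (rule opposite_step_inj[of _ y]) (use W[OF pq(1)] W[OF pq(2)] pq(3) in simp_all)
    then show "p = q" using W[OF pq(1)] W[OF pq(2)] by metis
  qed
  moreover have "(\<lambda>z. hd (tl (W z))) ` nbr y (v + int n - 1) \<subseteq> nbr x (v + 1)"
    using W by (intro image_subsetI) blast
  ultimately show ?thesis using finite_nbr[OF fin] by (rule card_inj_on_le)
qed

text \<open>Negated labels exchange up and down, which turns \<open>nbr_opposite_le\<close> into the
  reverse inequality.\<close>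

lemma labelled_ngon_reflected: "labelled_ngon V adj col n (\<lambda>x. - h x)"
proof
  have d: "2 * int n dvd - a \<longleftrightarrow> 2 * int n dvd a" for a by simp
  fix x y assume "adj x y"
  then show "2 * int n dvd - h y - - h x - 1 \<or> 2 * int n dvd - h y - - h x + 1"
    using h_adj[of x y] d[of "h y - h x - 1"] d[of "h y - h x + 1"] by (auto simp: algebra_simps)
next
  have d: "2 * int n dvd - a \<longleftrightarrow> 2 * int n dvd a" for a by simp
  fix i
  obtain x where "x \<in> V" "2 * int n dvd h x - (- i)" using h_surj by blast
  moreover have "- h x - i = - (h x - - i)" by simp
  ultimately show "\<exists>x\<in>V. 2 * int n dvd - h x - i" using d by metis
qed

lemma layer_reflected: "labelled_ngon.layer V n (\<lambda>x. - h x) i = layer (- i)"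
proof -
  have "2 * int n dvd - h x - i \<longleftrightarrow> 2 * int n dvd h x - - i" for x
  proof -
    have "- h x - i = - (h x - - i)" by simp
    then show ?thesis by (metis dvd_minus_iff)
  qed
  then show ?thesis unfolding labelled_ngon.layer_def[OF labelled_ngon_reflected] layer_def by simp
qed

lemma nbr_opposite:
  assumes fin: "finite V" and x: "x \<in> layer v" and y: "y \<in> layer (v + int n)"
  shows "card (nbr x (v + 1)) = card (nbr y (v + int n - 1))"
proof (rule antisym)
  interpret R: labelled_ngon V adj col n "\<lambda>x. - h x" by (rule labelled_ngon_reflected)
  have N: "R.nbr q i = nbr q (- i)" for q i unfolding R.nbr_def nbr_def layer_reflected ..
  have "card (R.nbr x (- v - int n + int n - 1)) \<le> card (R.nbr y (- v - int n + 1))"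
    by (rule R.nbr_opposite_le[OF fin]) (use x y in \<open>simp_all add: layer_reflected add.commute\<close>)
  then show "card (nbr x (v + 1)) \<le> card (nbr y (v + int n - 1))" by (simp add: N algebra_simps)
qed (rule nbr_opposite_le[OF assms])


section \<open>The degrees of a finite labelled graph\<close>

definition up_deg :: "int \<Rightarrow> nat" where "up_deg i = card (nbr (SOME x. x \<in> layer i) (i + 1))"
definition down_deg :: "int \<Rightarrow> nat" where "down_deg i = card (nbr (SOME x. x \<in> layer i) (i - 1))"

lemma some_layer: "(SOME x. x \<in> layer i) \<in> layer i"
  using layer_nonempty by (rule someI_ex)

lemma layer_period: "layer (i + int n + int n) = layer i"
  by (rule layer_cong) simp

text \<open>All elements of a fibre are compared with one element over the opposite position, so the
  choice made in \<open>up_deg\<close> does not matter.\<close>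

lemma card_nbr_up:
  assumes "finite V" "x \<in> layer i" shows "card (nbr x (i + 1)) = up_deg i"
  unfolding up_deg_def
  using nbr_opposite[OF assms(1) _ some_layer[of "i + int n"]] assms(2) some_layer[of i] by metis

lemma card_nbr_down:
  assumes "finite V" "x \<in> layer i" shows "card (nbr x (i - 1)) = down_deg i"
proof -
  have "i + 0 = i - int n + int n" by simp
  then have e: "y \<in> layer i \<Longrightarrow> y \<in> layer (i - int n + int n)" for y by simp
  show ?thesis
    unfolding down_deg_def
    using nbr_opposite[OF assms(1) some_layer[of "i - int n"] e[OF assms(2)]]
      nbr_opposite[OF assms(1) some_layer[of "i - int n"] e[OF some_layer[of i]]] by simp
qed

lemma degree_opposite:
  assumes "finite V" shows "up_deg i = down_deg (i + int n)" "up_deg (i + int n) = down_deg i"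
proof -
  have ab: "up_deg i = down_deg (i + int n)" for i
    using nbr_opposite[OF assms some_layer some_layer, of i] unfolding up_deg_def down_deg_def by simp
  show "up_deg i = down_deg (i + int n)" by (rule ab)
  have "nbr x (i + int n + int n - 1) = nbr x (i - 1)" for x
    unfolding nbr_def using layer_cong[of "i + int n + int n - 1" "i - 1"] by simp
  then have "down_deg (i + int n + int n) = down_deg i" unfolding down_deg_def layer_period by simp
  then show "up_deg (i + int n) = down_deg i" using ab by simp
qed

section \<open>Counting walks by their downward steps\<close>

lemma card_ext:
  assumes "finite W" "finite V" "\<And>w. w \<in> W \<Longrightarrow> card {z \<in> layer j. nb (z # w)} = d"
  shows "finite (ext W j)" "card (ext W j) = card W * d"
proof -
  let ?S = "SIGMA w:W. {z \<in> layer j. nb (z # w)}"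
  have e: "ext W j = (\<lambda>(w, z). z # w) ` ?S" unfolding ext_def by auto
  have "inj_on (\<lambda>(w, z). z # w) ?S" by (auto simp: inj_on_def)
  then have "card (ext W j) = card ?S" unfolding e by (rule card_image)
  also have "\<dots> = card W * d" using assms finite_layer by (subst card_SigmaI) auto
  finally show "card (ext W j) = card W * d" .
  show "finite (ext W j)" unfolding e using assms finite_layer by (intro finite_imageI finite_SigmaI) auto
qed

lemma extensions_turn:
  assumes w: "nb w" "tl w \<noteq> [] \<Longrightarrow> hd (tl w) \<notin> layer j"
  shows "{z \<in> layer j. nb (z # w)} = nbr (hd w) j"
proof -
  have "w \<noteq> []" using w by auto
  then show ?thesis using w adj_sym layer_in unfolding nbr_def by (auto simp: nb_walk_Cons)
qed

text \<open>At a turn between up and down the previous vertex is itself a candidate, and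
  non-backtracking removes exactly this one.\<close>

lemma card_extensions_back:
  assumes fin: "finite V" and w: "nb w" "tl w \<noteq> []" "hd (tl w) \<in> layer j"
  shows "card {z \<in> layer j. nb (z # w)} = card (nbr (hd w) j) - 1"
proof -
  obtain p q t where p: "w = p # q # t" using w(2) by (cases w; cases "tl w") auto
  have "{z \<in> layer j. nb (z # w)} = nbr (hd w) j - {hd (tl w)}"
    using w adj_sym layer_in p unfolding nbr_def by (auto simp: nb_walk_Cons)
  moreover have "hd (tl w) \<in> nbr (hd w) j" using w p unfolding nbr_def by (auto simp: nb_walk_Cons)
  ultimately show ?thesis using finite_nbr[OF fin] by (simp add: card_Diff_singleton)
qed

lemma not_layer: "x \<in> layer i \<Longrightarrow> i = j + 2 \<or> j = i + 2 \<Longrightarrow> x \<notin> layer j"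
  using layer_disjoint[of x i j] n_ge_3 by auto

context
  fixes x v
  assumes fin: "finite V" and x: "x \<in> layer v"
begin

lemma straight_count:
  "finite (straight x v k) \<and> card (straight x v k) = (\<Prod>i<k. up_deg (v + int i))"
proof (induction k)
  case (Suc k)
  have "card {z \<in> layer (v + int k + 1). nb (z # w)} = up_deg (v + int k)" if w: "w \<in> straight x v k" for w
  proof -
    have W: "nb w" "hd w \<in> layer (v + int k)" "0 < k \<longrightarrow> hd (tl w) \<in> layer (v + int k - 1)" "length w = Suc k"
      using straight_walk[OF x w] by auto
    have "hd (tl w) \<notin> layer (v + int k + 1)" if "tl w \<noteq> []"
    proof -
      have "0 < k" using that W(4) by (cases w) auto
      then show ?thesis using W(3) not_layer[of "hd (tl w)" "v + int k - 1" "v + int k + 1"] by simp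
    qed
    then show ?thesis using extensions_turn[OF W(1)] card_nbr_up[OF fin W(2)] by simp
  qed
  from card_ext[OF _ fin this] show ?case using Suc.IH by (simp add: mult.commute)
qed simp

text \<open>For \<open>k = 0\<close> the downward step is the first one and has no predecessor to
  avoid, so nothing is subtracted.\<close>

lemma dip_count:
  "finite (dip x v k) \<and>
   card (dip x v k) = (if k = 0 then down_deg v else card (straight x v k) * (down_deg (v + int k) - 1))"
proof -
  have "card {z \<in> layer (v + int k - 1). nb (z # w)} = (if k = 0 then down_deg v else down_deg (v + int k) - 1)"
    if w: "w \<in> straight x v k" for w
  proof -
    have W: "nb w" "hd w \<in> layer (v + int k)" "0 < k \<longrightarrow> hd (tl w) \<in> layer (v + int k - 1)" "length w = Suc k"
      using straight_walk[OF x w] by auto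
    show ?thesis
    proof (cases "k = 0")
      case True
      then have "tl w = []" using W(4) by (cases w) auto
      then show ?thesis using True extensions_turn[OF W(1)] card_nbr_down[OF fin W(2)] by simp
    next
      case False
      then have "tl w \<noteq> []" using W(4) by (cases w) auto
      then show ?thesis
        using False W(3) card_extensions_back[OF fin W(1)] card_nbr_down[OF fin W(2)] by simp
    qed
  qed
  from card_ext[OF _ fin this] show ?thesis using straight_count[of k] unfolding dip_def by simp
qed

lemma ext_dip_count:
  "finite (ext (dip x v k) (v + int k)) \<and>
   card (ext (dip x v k) (v + int k)) = card (dip x v k) * (up_deg (v + int k - 1) - 1)"
proof -
  have "card {z \<in> layer (v + int k). nb (z # w)} = up_deg (v + int k - 1) - 1" if w: "w \<in> dip x v k" for w
  proof -
    have W: "nb w" "hd w \<in> layer (v + int k - 1)" "hd (tl w) \<in> layer (v + int k)" "length w = Suc (Suc k)"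
      using dip_walk[OF x w] by auto
    have "tl w \<noteq> []" using W(4) by (cases w) auto
    then show ?thesis using card_extensions_back[OF fin W(1) _ W(3)] card_nbr_up[OF fin W(2)] by simp
  qed
  from card_ext[OF _ fin this] show ?thesis using dip_count[of k] by simp
qed

text \<open>A downward step from \<open>v + i + 1\<close> to \<open>v + i\<close> is a detour
  inserted into a straight walk: the straight factors remain, and each of its two turns contributes
  a degree minus 1. The first term is the detour below \<open>v\<close>, which begins without a
  turn.\<close>

lemma bent_count:
  "finite (bent x v k) \<and>
   card (bent x v k) = card (straight x v k) *
     (down_deg v * (up_deg (v - 1) - 1) + (\<Sum>i<k. (up_deg (v + int i) - 1) * (down_deg (v + int i + 1) - 1)))"
proof (induction k)
  case 0
  then show ?case using ext_dip_count[of 0] dip_count[of 0] by simp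
next
  case (Suc k)
  let ?D = "ext (dip x v (Suc k)) (v + int k + 1)" and ?B = "ext (bent x v k) (v + int k + 1)"
  have D: "finite ?D" "card ?D = card (dip x v (Suc k)) * (up_deg (v + int k) - 1)"
    using ext_dip_count[of "Suc k"] by (simp_all add: add_ac)
  have "card {z \<in> layer (v + int k + 1). nb (z # w)} = up_deg (v + int k)" if w: "w \<in> bent x v k" for w
  proof -
    have W: "nb w" "hd w \<in> layer (v + int k)" "hd (tl w) \<in> layer (v + int k - 1)"
      using bent_walk[OF x w] by auto
    then show ?thesis
      using extensions_turn[OF W(1)] card_nbr_up[OF fin W(2)] not_layer[OF W(3), of "v + int k + 1"] by simp
  qed
  from card_ext[OF _ fin this] have B: "finite ?B" "card ?B = card (bent x v k) * up_deg (v + int k)"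
    using Suc.IH by simp_all
  have "?D \<inter> ?B = {}"
  proof -
    have False if "w \<in> dip x v (Suc k)" "w \<in> bent x v k" for w
      using dip_walk[OF x that(1)] bent_walk[OF x that(2)]
        not_layer[of "hd (tl w)" "v + int k + 1" "v + int k - 1"] by (auto simp: add_ac)
    then show ?thesis unfolding ext_def by auto
  qed
  then have "card (bent x v (Suc k)) = card ?D + card ?B"
    using D B by (simp add: card_Un_disjoint)
  moreover have "card (straight x v (Suc k)) = card (straight x v k) * up_deg (v + int k)"
    using straight_count[of "Suc k"] straight_count[of k] by simp
  ultimately show ?case using D B dip_count[of "Suc k"] Suc.IH by (simp add: algebra_simps)
qed

lemma layer_count: "card (layer (v + int n - 1)) = (\<Prod>i<n - 1. up_deg (v + int i))"
  using bij_betw_same_card[OF straight_bij[OF x]] straight_count[of "n - 1"] by simp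

text \<open>Within \<open>n\<close> edges this fibre is reached by \<open>n - 3\<close> edges
  without a downward step or by \<open>n - 1\<close> edges with one, placed last
  (\<open>dip\<close>) or earlier (\<open>bent\<close>). All these walks are short enough for
  \<open>hd\<close> to be injective.\<close>

lemma layer_count_by_walks:
  "card (layer (v + int n - 3)) =
     card (straight x v (n - 3)) + card (dip x v (n - 2)) + card (bent x v (n - 3))"
proof -
  let ?S = "straight x v (n - 3)" and ?D = "dip x v (n - 2)" and ?B = "bent x v (n - 3)"
  have i: "int (n - 3) = int n - 3" "int (n - 2) = int n - 2" using n_ge_3 by simp_all
  have S: "nb w" "last w = x" "hd w \<in> layer (v + int n - 3)" "length w = n - 2" if "w \<in> ?S" for w
    using straight_walk[OF x that] i n_ge_3 by (auto simp: add_diff_eq)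
  have D: "nb w" "last w = x" "hd w \<in> layer (v + int n - 3)" "length w = n" "hd (tl w) \<in> layer (v + int n - 2)"
    if "w \<in> ?D" for w
  proof -
    have e: "v + int (n - 2) - 1 = v + int n - 3" "v + int (n - 2) = v + int n - 2" using i by simp_all
    show "nb w" "last w = x" "hd w \<in> layer (v + int n - 3)" "length w = n" "hd (tl w) \<in> layer (v + int n - 2)"
      using dip_walk[OF x that] n_ge_3 unfolding e by auto
  qed
  have B: "nb w" "last w = x" "hd w \<in> layer (v + int n - 3)" "length w = n" "hd (tl w) \<in> layer (v + int n - 4)"
    if "w \<in> ?B" for w
  proof -
    have e: "v + int (n - 3) - 1 = v + int n - 4" "v + int (n - 3) = v + int n - 3" using i by simp_all
    show "nb w" "last w = x" "hd w \<in> layer (v + int n - 3)" "length w = n" "hd (tl w) \<in> layer (v + int n - 4)"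
      using bent_walk[OF x that] n_ge_3 unfolding e by auto
  qed
  let ?U = "?S \<union> ?D \<union> ?B"
  have U: "nb w" "last w = x" "hd w \<in> layer (v + int n - 3)" "length w \<le> n" if "w \<in> ?U" for w
    using S[of w] D[of w] B[of w] that by auto
  have "inj_on hd ?U"
  proof (rule inj_onI)
    fix u w assume "u \<in> ?U" "w \<in> ?U" "hd u = hd w"
    then show "u = w" using U[of u] U[of w] by (intro nb_walk_unique) auto
  qed
  moreover have "hd ` ?U = layer (v + int n - 3)"
  proof
    show "hd ` ?U \<subseteq> layer (v + int n - 3)" using U by auto
    show "layer (v + int n - 3) \<subseteq> hd ` ?U"
    proof
      fix y assume y: "y \<in> layer (v + int n - 3)"
      obtain w where w: "nb w" "hd w = y" "last w = x" "length w \<le> Suc n"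
        using diam[OF layer_in[OF y] layer_in[OF x]] by blast
      obtain j where j: "j < length w" "hd w \<in> layer (v + int (length w) - 1 - 2 * int j)"
        "j = 0 \<longrightarrow> w \<in> straight x v (length w - 1)"
        "j = 1 \<longrightarrow> w \<in> dip x v (length w - 2) \<or> 3 \<le> length w \<and> w \<in> bent x v (length w - 3)"
        using walk_classification[OF x w(1,3)] by blast
      have "v + int (length w) - 1 - 2 * int j = v + int n - 3"
        by (rule layer_disjoint[OF j(2)]) (use y w j(1) n_ge_3 in \<open>auto simp: abs_if\<close>)
      then have e: "int (length w) = int n - 2 + 2 * int j" by simp
      then have "j = 0 \<or> j = 1" using w(4) by linarith
      then have "w \<in> ?U"
      proof
        assume "j = 0"
        then have "length w - 1 = n - 3" using e by linarith
        then show ?thesis using j(3) \<open>j = 0\<close> by auto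
      next
        assume "j = 1"
        then have "length w = n" using e by linarith
        then show ?thesis using j(4) \<open>j = 1\<close> by auto
      qed
      then show "y \<in> hd ` ?U" using w(2) by blast
    qed
  qed
  ultimately have "card (layer (v + int n - 3)) = card ?U" by (metis card_image)
  moreover have "?S \<inter> ?D = {}" "(?S \<union> ?D) \<inter> ?B = {}"
  proof -
    have "n - 2 \<noteq> n" using n_ge_3 by simp
    then show "?S \<inter> ?D = {}" using S(4) D(4) by fastforce
    have "w \<notin> ?B" if "w \<in> ?D" for w
      using D(5)[OF that] B(5)[of w] not_layer[of "hd (tl w)" "v + int n - 2" "v + int n - 4"] by auto
    moreover have "w \<notin> ?B" if "w \<in> ?S" for w using S(4)[OF that] B(4)[of w] \<open>n - 2 \<noteq> n\<close> by auto
    ultimately show "(?S \<union> ?D) \<inter> ?B = {}" by blast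
  qed
  ultimately show ?thesis
    using straight_count[of "n - 3"] dip_count[of "n - 2"] bent_count[of "n - 3"]
    by (simp add: card_Un_disjoint)
qed

end

text \<open>Fibres are nonempty, and \<open>up_deg i\<close> is a factor of the size of one of
  them.\<close>

lemma up_deg_pos:
  assumes fin: "finite V" shows "0 < up_deg i"
proof -
  obtain x where x: "x \<in> layer i" using layer_nonempty by blast
  have "card (layer (i + int n - 1)) \<noteq> 0" using layer_nonempty finite_layer[OF fin] by auto
  then have "(\<Prod>j<n - 1. up_deg (i + int j)) \<noteq> 0" using layer_count[OF fin x] by simp
  then have "\<forall>j\<in>{..<n - 1}. up_deg (i + int j) \<noteq> 0" by simp
  moreover have "0 \<in> {..<n - 1}" using n_ge_3 by simp
  ultimately have "up_deg (i + int 0) \<noteq> 0" by blast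
  then show ?thesis by simp
qed

lemma degree:
  assumes fin: "finite V" and thick: thick_graph shows "3 \<le> up_deg i + down_deg i"
proof -
  obtain x where x: "x \<in> layer i" using layer_nonempty by blast
  have fn: "finite (nbr x (i + 1))" "finite (nbr x (i - 1))" using finite_nbr[OF fin] by auto
  let ?N = "nbr x (i + 1) \<union> nbr x (i - 1)"
  have N: "y \<in> ?N" if "adj x y" for y using layer_adj[OF that x] that unfolding nbr_def by blast
  obtain p q r where pqr: "adj x p" "adj x q" "q \<noteq> p" "adj x r" "r \<noteq> p" "r \<noteq> q"
    using thick layer_in[OF x] unfolding thick_graph_def by metis
  then have "card {p, q, r} = 3" by auto
  moreover have "{p, q, r} \<subseteq> ?N" using N pqr by blast
  ultimately have "3 \<le> card ?N" using fn by (metis card_mono finite_UnI)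
  also have "\<dots> \<le> up_deg i + down_deg i"
    using card_Un_le[of "nbr x (i + 1)" "nbr x (i - 1)"] card_nbr_up[OF fin x] card_nbr_down[OF fin x] by simp
  finally show ?thesis .
qed

theorem singleton_fibre_finite:
  assumes fin: "finite V" and thick: thick_graph
  shows "\<exists>i. card (layer i) = 1"
proof -
  define \<alpha> where "\<alpha> i = int (up_deg i) - 1" for i
  define \<beta> where "\<beta> i = int (down_deg i) - 1" for i
  have bp: "0 < down_deg i" for i using up_deg_pos[OF fin, of "i + int n"] degree_opposite[OF fin] by metis
  have n1: "n - 1 = Suc (Suc (n - 3))" "n - 2 = Suc (n - 3)" using n_ge_3 by simp_all
  have "\<exists>u. \<forall>i. u \<le> i \<and> i < u + int n - 1 \<longrightarrow> \<alpha> i = 0"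
  proof (rule consecutive_zeros[OF n_ge_3, of \<alpha> \<beta>])
    show "\<alpha> (i + int n) = \<beta> i" "\<beta> (i + int n) = \<alpha> i" for i
      using degree_opposite[OF fin, of i] unfolding \<alpha>_def \<beta>_def by simp_all
    show "0 \<le> \<alpha> i" "0 \<le> \<beta> i" for i
      using up_deg_pos[OF fin, of i] bp[of i] unfolding \<alpha>_def \<beta>_def by simp_all
    show "1 \<le> \<alpha> i + \<beta> i" for i using degree[OF fin thick, of i] unfolding \<alpha>_def \<beta>_def by simp
    fix v
    obtain x where x: "x \<in> layer v" using layer_nonempty by blast
    \<comment> \<open>The fibre over \<open>v + n - 3\<close> lies \<open>n - 1\<close> positions
      above \<open>v - 2\<close> and \<open>n - 3\<close> above \<open>v\<close>, so both counts
      apply to it. The product \<open>P\<close> divides every term and is cancelled.\<close>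
    obtain y where y: "y \<in> layer (v - 2)" using layer_nonempty by blast
    define P where "P = int (\<Prod>i<n - 3. up_deg (v + int i))"
    have P: "0 < P" unfolding P_def using up_deg_pos[OF fin] by (simp add: prod_pos)
    have "int (card (layer (v + int n - 3))) = int (up_deg (v - 2)) * int (up_deg (v - 1)) * P"
      using layer_count[OF fin y] unfolding n1(1) prod.lessThan_Suc_shift P_def
      by (simp add: algebra_simps)
    moreover have s: "card (straight x v (n - 3)) = (\<Prod>i<n - 3. up_deg (v + int i))"
      "card (straight x v (n - 2)) = (\<Prod>i<n - 3. up_deg (v + int i)) * up_deg (v + int (n - 3))"
      using straight_count[OF fin x, of "n - 3"] straight_count[OF fin x, of "n - 2"]
      unfolding n1(2) by simp_all
    have "int (card (straight x v (n - 3))) = P" unfolding P_def s ..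
    moreover have "int (card (dip x v (n - 2))) = P * int (up_deg (v + int n - 3)) * \<beta> (v + int n - 2)"
      using dip_count[OF fin x, of "n - 2"] s(2) n_ge_3 bp[of "v + int n - 2"]
      unfolding P_def \<beta>_def by (simp add: of_nat_diff Suc_le_eq add_diff_eq)
    moreover have "int (card (bent x v (n - 3))) =
        P * (int (down_deg v) * \<alpha> (v - 1) + (\<Sum>i<n - 3. \<alpha> (v + int i) * \<beta> (v + int i + 1)))"
      using bent_count[OF fin x, of "n - 3"] s(1) up_deg_pos[OF fin] bp
      unfolding P_def \<alpha>_def \<beta>_def by (simp add: of_nat_diff Suc_le_eq)
    ultimately have "int (up_deg (v - 2)) * int (up_deg (v - 1)) * P =
      P + P * int (up_deg (v + int n - 3)) * \<beta> (v + int n - 2) +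
      P * (int (down_deg v) * \<alpha> (v - 1) + (\<Sum>i<n - 3. \<alpha> (v + int i) * \<beta> (v + int i + 1)))"
      using layer_count_by_walks[OF fin x] by simp
    then have "P * (int (up_deg (v - 2)) * int (up_deg (v - 1))) = P * (1 + int (up_deg (v + int n - 3)) * \<beta> (v + int n - 2) +
      (int (down_deg v) * \<alpha> (v - 1) + (\<Sum>i<n - 3. \<alpha> (v + int i) * \<beta> (v + int i + 1))))"
      by (simp add: algebra_simps)
    then have "int (up_deg (v - 2)) * int (up_deg (v - 1)) = 1 + int (up_deg (v + int n - 3)) * \<beta> (v + int n - 2) +
      (int (down_deg v) * \<alpha> (v - 1) + (\<Sum>i<n - 3. \<alpha> (v + int i) * \<beta> (v + int i + 1)))"
      using P by simp
    moreover have "up_deg (v + int n - 3) = down_deg (v - 3)" "\<beta> (v + int n - 2) = \<alpha> (v - 2)"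
      using degree_opposite(2)[OF fin, of "v - 3"] degree_opposite(1)[OF fin, of "v - 2"]
      unfolding \<alpha>_def \<beta>_def by (simp_all add: algebra_simps)
    ultimately have "(\<alpha> (v - 2) + 1) * (\<alpha> (v - 1) + 1) = 1 + (\<beta> (v - 3) + 1) * \<alpha> (v - 2) +
      ((\<beta> v + 1) * \<alpha> (v - 1) + (\<Sum>i<n - 3. \<alpha> (v + int i) * \<beta> (v + int i + 1)))"
      unfolding \<alpha>_def \<beta>_def by simp
    moreover have "(\<Sum>i<n - 2. \<alpha> (v - 1 + int i) * \<beta> (v + int i)) =
        \<alpha> (v - 1) * \<beta> v + (\<Sum>i<n - 3. \<alpha> (v + int i) * \<beta> (v + int i + 1))"
      unfolding n1(2) sum.lessThan_Suc_shift by (simp add: algebra_simps)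
    ultimately show "\<alpha> (v - 2) * \<alpha> (v - 1) =
        \<beta> (v - 3) * \<alpha> (v - 2) + (\<Sum>i<n - 2. \<alpha> (v - 1 + int i) * \<beta> (v + int i))"
      by (simp add: algebra_simps)
  qed
  then obtain u where u: "\<And>i. u \<le> i \<Longrightarrow> i < u + int n - 1 \<Longrightarrow> \<alpha> i = 0" by blast
  obtain x where x: "x \<in> layer u" using layer_nonempty by blast
  have "up_deg (u + int i) = 1" if "i < n - 1" for i using u[of "u + int i"] that unfolding \<alpha>_def by simp
  then have "card (layer (u + int n - 1)) = 1" using layer_count[OF fin x] by simp
  then show ?thesis by blast
qed

end

section \<open>Locally finitely generated polygons\<close>

lemma ecard_ge_3:
  assumes "3 \<le> ecard A" shows "\<exists>u\<in>A. u \<noteq> p \<and> u \<noteq> q"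
proof (rule ccontr)
  assume "\<not> ?thesis"
  then have A: "A \<subseteq> {p, q}" by blast
  then have "finite A" using finite_subset by blast
  moreover have "card A \<le> 2" using card_mono[OF _ A] card_insert_le_m1[of 2 "{q}" p] by (simp add: card_insert_if split: if_splits)
  ultimately show False using assms by (simp add: ecard_def numeral_eq_enat)
qed

lemma thick_polygon_graph:
  assumes "thick_polygon n G"
  shows "ngon_graph.thick_graph (elements G) (incident G)"
proof -
  have w: "weak_polygon n G" and th: "thick G" using assms by (auto simp: thick_polygon_def)
  interpret ngon_graph "elements G" "incident G" isl n using w weak_polygon_iff by blast
  show thick_graph
    unfolding thick_graph_def
  proof (intro ballI allI)
    fix x a b assume x: "x \<in> elements G"
    show "\<exists>u. incident G x u \<and> u \<noteq> a \<and> u \<noteq> b"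
    proof (cases x)
      case (Inl p)
      then have "3 \<le> ecard (lines_through G p)" using th x by (simp add: thick_def)
      from ecard_ge_3[OF this, of "projr a" "projr b"] obtain l
        where "l \<in> lines_through G p" "l \<noteq> projr a" "l \<noteq> projr b" by blast
      then show ?thesis using Inl by (intro exI[of _ "Inr l"]) (auto simp: lines_through_def)
    next
      case (Inr l)
      then have "3 \<le> ecard (points_on G l)" using th x by (simp add: thick_def)
      from ecard_ge_3[OF this, of "projl a" "projl b"] obtain p
        where "p \<in> points_on G l" "p \<noteq> projl a" "p \<noteq> projl b" by blast
      then show ?thesis using Inr by (intro exI[of _ "Inl p"]) (auto simp: points_on_def)
    qed
  qed
qed

lemma subgeometry_incident:
  assumes "subgeometry H G"
  shows "incident H = (\<lambda>x y. incident G x y \<and> x \<in> elements H \<and> y \<in> elements H)"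
    and "elements H \<subseteq> elements G"
proof -
  have "incident H x y \<longleftrightarrow> incident G x y \<and> x \<in> elements H \<and> y \<in> elements H" for x y
    using assms unfolding subgeometry_def by (cases x; cases y) auto
  then show "incident H = (\<lambda>x y. incident G x y \<and> x \<in> elements H \<and> y \<in> elements H)" by blast
  show "elements H \<subseteq> elements G" using assms unfolding subgeometry_def elements_def by auto
qed

text \<open>A geodesic taken inside \<open>H\<close> has at most \<open>n\<close> edges and
  \<open>w\<close> at most \<open>n - 1\<close>, so uniqueness in \<open>G\<close> identifies
  them.\<close>

lemma sub_polygon_walk_closed:
  assumes G: "weak_polygon n G" and H: "sub_polygon n H G"
    and w: "nb_walk (elements G) (incident G) w" "length w \<le> n"
    and ends: "hd w \<in> elements H" "last w \<in> elements H"
  shows "set w \<subseteq> elements H"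
proof -
  interpret G: ngon_graph "elements G" "incident G" isl n using G weak_polygon_iff by blast
  interpret H: ngon_graph "elements H" "incident H" isl n
    using H weak_polygon_iff unfolding sub_polygon_def by blast
  have s: "subgeometry H G" using H by (simp add: sub_polygon_def)
  obtain u where u: "H.nb u" "hd u = hd w" "last u = last w" "length u \<le> Suc n"
    using H.diam ends by blast
  have "G.nb u" 
    by (rule nb_walk_mono[OF u(1)]) (simp_all add: subgeometry_incident[OF s])
  then have "u = w" using u w by (intro G.nb_walk_unique) auto
  then show ?thesis using nb_walk_in[OF u(1)] by simp
qed

text \<open>Generation starts from points only. A line is forced by two of its points, being the
  middle of the path that joins them.\<close>

lemma finite_generating_points:
  assumes G: "weak_polygon n G" and X: "finite X" "X \<subseteq> elements G"
  shows "\<exists>S. finite S \<and> S \<subseteq> Pts G \<and> (\<forall>H. sub_polygon n H G \<and> S \<subseteq> Pts H \<longrightarrow> X \<subseteq> elements H)"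
proof -
  interpret G: ngon_graph "elements G" "incident G" isl n using G weak_polygon_iff by blast
  have "\<exists>S. finite S \<and> S \<subseteq> Pts G \<and> (\<forall>H. sub_polygon n H G \<and> S \<subseteq> Pts H \<longrightarrow> x \<in> elements H)"
    if x: "x \<in> X" for x
  proof (cases x)
    case (Inl p)
    then show ?thesis using x X(2) by (intro exI[of _ "{p}"]) auto
  next
    case (Inr l)
    have xV: "x \<in> elements G" using x X(2) by blast
    obtain y where y: "incident G x y" using G.another_neighbour[OF xV] by blast
    obtain z where z: "incident G x z" "z \<noteq> y" using G.another_neighbour[OF xV] by blast
    obtain p q where pq: "y = Inl p" "z = Inl q" using y z Inr by (auto simp: incident_def)
    have yz: "y \<in> elements G" "z \<in> elements G" using G.adj_in2 y z by blast+
    have nb: "G.nb [y, x, z]" using y z xV yz G.adj_sym by (simp add: nb_walk_Cons)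
    have "x \<in> elements H" if "sub_polygon n H G" "{p, q} \<subseteq> Pts H" for H
      using sub_polygon_walk_closed[OF G that(1) nb] that(2) pq G.n_ge_3 by simp
    then show ?thesis using pq yz by (intro exI[of _ "{p, q}"]) auto
  qed
  then obtain S where S: "\<And>x. x \<in> X \<Longrightarrow> finite (S x) \<and> S x \<subseteq> Pts G \<and>
      (\<forall>H. sub_polygon n H G \<and> S x \<subseteq> Pts H \<longrightarrow> x \<in> elements H)" by metis
  show ?thesis
  proof (intro exI[of _ "\<Union>x\<in>X. S x"] conjI allI impI)
    show "finite (\<Union>x\<in>X. S x)" using X(1) S by (intro finite_UN_I) blast+
    show "(\<Union>x\<in>X. S x) \<subseteq> Pts G" using S by blast
    fix H assume H: "sub_polygon n H G \<and> (\<Union>x\<in>X. S x) \<subseteq> Pts H"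
    show "X \<subseteq> elements H"
    proof
      fix x assume "x \<in> X"
      then show "x \<in> elements H" using S[of x] H by blast
    qed
  qed
qed

lemma generated_simps:
  "Pts (generated n G S) = \<Inter> {Pts H | H. sub_polygon n H G \<and> S \<subseteq> Pts H}"
  "Lns (generated n G S) = \<Inter> {Lns H | H. sub_polygon n H G \<and> S \<subseteq> Pts H}"
  "Inc (generated n G S) p l \<longleftrightarrow>
     p \<in> Pts (generated n G S) \<and> l \<in> Lns (generated n G S) \<and> Inc G p l"
  by (simp_all add: generated_def Let_def)

lemma generated_elements:
  "x \<in> elements (generated n G S) \<longleftrightarrow> (\<forall>H. sub_polygon n H G \<and> S \<subseteq> Pts H \<longrightarrow> x \<in> elements H)"
  by (cases x) (auto simp: generated_simps)

text \<open>An intersection of sub \<open>n\<close>-gons inherits closure under short geodesics; the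
  cycle supplies what \<open>closed_subgraph\<close> needs besides.\<close>

lemma generated_sub_polygon:
  assumes G: "weak_polygon n G" and S: "S \<subseteq> Pts G"
    and c: "cycle_in (incident G) (2 * int n) c" "range c \<subseteq> elements (generated n G S)"
  shows "sub_polygon n (generated n G S) G"
proof -
  let ?K = "generated n G S"
  interpret G: ngon_graph "elements G" "incident G" isl n using G weak_polygon_iff by blast
  have self: "sub_polygon n G G"
    using G unfolding sub_polygon_def subgeometry_def weak_polygon_def point_line_geometry_def by auto
  have sub: "subgeometry ?K G"
    using self S unfolding subgeometry_def by (auto simp: generated_simps)
  note K = subgeometry_incident[OF sub]
  have "ngon_graph (elements ?K) (\<lambda>x y. incident G x y \<and> x \<in> elements ?K \<and> y \<in> elements ?K) isl n"
  proof (rule G.closed_subgraph[OF K(2) c])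
    fix w assume w: "G.nb w" "hd w \<in> elements ?K" "last w \<in> elements ?K" "length w \<le> n"
    show "set w \<subseteq> elements ?K"
    proof
      fix x assume "x \<in> set w"
      then show "x \<in> elements ?K"
        using sub_polygon_walk_closed[OF G _ w(1,4)] w(2,3) unfolding generated_elements by blast
    qed
  qed
  then have "ngon_graph (elements ?K) (incident ?K) isl n" using K(1) by simp
  moreover have "point_line_geometry ?K"
  proof -
    have "isl (c 0) \<longleftrightarrow> \<not> isl (c 1)" using cycle_isl[OF c(1), of 1] by auto
    moreover have "c 0 \<in> elements ?K" "c 1 \<in> elements ?K" using c(2) by auto
    ultimately have "Pts ?K \<noteq> {}" "Lns ?K \<noteq> {}" by (cases "c 0"; cases "c 1"; auto)+
    then show ?thesis using sub unfolding point_line_geometry_def subgeometry_def by blast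
  qed
  ultimately show ?thesis using sub weak_polygon_iff unfolding sub_polygon_def by blast
qed

theorem singleton_fibre:
  assumes G: "thick_polygon n G" and lfg: "locally_finitely_generated n G"
    and h_adj: "\<And>x y. incident G x y \<Longrightarrow> 2 * int n dvd h y - h x - 1 \<or> 2 * int n dvd h y - h x + 1"
    and h_surj: "\<And>i. \<exists>x\<in>elements G. 2 * int n dvd h x - i"
  shows "\<exists>i x. {x \<in> elements G. 2 * int n dvd h x - i} = {x}"
proof (rule ccontr)
  assume no: "\<not> ?thesis"
  define layer where "layer i = {x \<in> elements G. 2 * int n dvd h x - i}" for i
  have W: "weak_polygon n G" using G by (simp add: thick_polygon_def)
  interpret G: ngon_graph "elements G" "incident G" isl n using W weak_polygon_iff by blast
  have th: G.thick_graph by (rule thick_polygon_graph[OF G])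
  have "\<exists>x y. x \<in> layer i \<and> y \<in> layer i \<and> x \<noteq> y" for i
  proof -
    obtain x where "x \<in> layer i" using h_surj unfolding layer_def by blast
    moreover have "layer i \<noteq> {x}" using no unfolding layer_def by blast
    ultimately show ?thesis by blast
  qed
  then obtain X Y where XY: "\<And>i. X i \<in> layer i \<and> Y i \<in> layer i \<and> X i \<noteq> Y i" by metis
  have "X 0 \<in> elements G" using XY unfolding layer_def by blast
  then obtain c where c: "cycle_in (incident G) (2 * int n) c" "range c \<subseteq> elements G"
    using G.cycle_through by metis
  have "\<exists>p q r. incident G x p \<and> incident G x q \<and> incident G x r \<and> p \<noteq> q \<and> p \<noteq> r \<and> q \<noteq> r"
    if "x \<in> elements G" for x
    using th that unfolding G.thick_graph_def by metis
  moreover have "c i \<in> elements G" for i using c(2) by auto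
  ultimately have "\<exists>p q r. incident G (c i) p \<and> incident G (c i) q \<and> incident G (c i) r \<and> p \<noteq> q \<and> p \<noteq> r \<and> q \<noteq> r" for i
    by blast
  then obtain p q r where pqr: "\<And>i. incident G (c i) (p i) \<and> incident G (c i) (q i) \<and>
      incident G (c i) (r i) \<and> p i \<noteq> q i \<and> p i \<noteq> r i \<and> q i \<noteq> r i" by metis
  let ?I = "{0..<2 * int n}"
  \<comment> \<open>One period of indices keeps \<open>A\<close> finite: two elements of each fibre,
    an ordinary \<open>n\<close>-gon, and three neighbours of each of its elements.\<close>
  define A where "A = X ` ?I \<union> Y ` ?I \<union> c ` ?I \<union> p ` ?I \<union> q ` ?I \<union> r ` ?I"
  have mI: "i mod (2 * int n) \<in> ?I" for i using G.n_ge_3 by simp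
  have cm: "c (i mod (2 * int n)) = c i" for i using c(1) unfolding cycle_in_def by simp
  have "finite A" unfolding A_def by simp
  moreover have "A \<subseteq> elements G"
    using XY c(2) pqr G.adj_in2 unfolding A_def layer_def by blast
  ultimately obtain S where S: "finite S" "S \<subseteq> Pts G"
      "\<And>H. sub_polygon n H G \<Longrightarrow> S \<subseteq> Pts H \<Longrightarrow> A \<subseteq> elements H"
    using finite_generating_points[OF W] by metis
  let ?K = "generated n G S"
  have AK: "A \<subseteq> elements ?K"
  proof
    fix x assume "x \<in> A"
    then show "x \<in> elements ?K" using S(3) unfolding generated_elements by blast
  qed
  have "c i \<in> elements ?K" for i
  proof -
    have "c (i mod (2 * int n)) \<in> A" using mI unfolding A_def by blast
    then show ?thesis using AK cm by auto
  qed
  then have cK: "range c \<subseteq> elements ?K" by blast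
  have sub: "sub_polygon n ?K G" by (rule generated_sub_polygon[OF W S(2) c(1) cK])
  have finK: "finite (elements ?K)"
  proof -
    have "finite (Pts ?K) \<and> finite (Lns ?K)"
      using lfg S(1,2) sub unfolding locally_finitely_generated_def by blast
    then show ?thesis unfolding elements_def by (intro finite_Plus) simp_all
  qed
  have s: "subgeometry ?K G" using sub by (simp add: sub_polygon_def)
  note K = subgeometry_incident[OF s]
  interpret K: ngon_graph "elements ?K" "incident ?K" isl n
    using sub weak_polygon_iff unfolding sub_polygon_def by blast
  have XYm: "X (i mod (2 * int n)) \<in> layer i" "Y (i mod (2 * int n)) \<in> layer i" for i
  proof -
    have "layer (i mod (2 * int n)) = layer i"
    proof -
      have "2 * int n dvd h x - i mod (2 * int n) \<longleftrightarrow> 2 * int n dvd h x - i" for x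
      proof -
        have "h x - i mod (2 * int n) = (i - i mod (2 * int n)) + (h x - i)" by simp
        then show ?thesis by (simp only: dvd_add_right_iff[OF dvd_minus_mod])
      qed
      then show ?thesis unfolding layer_def by (simp only:)
    qed
    then show "X (i mod (2 * int n)) \<in> layer i" "Y (i mod (2 * int n)) \<in> layer i"
      using XY[of "i mod (2 * int n)"] by (simp_all only:)
  qed
  have XYK: "X (i mod (2 * int n)) \<in> elements ?K" "Y (i mod (2 * int n)) \<in> elements ?K" for i
    using AK mI[of i] unfolding A_def by blast+
  interpret L: labelled_ngon "elements ?K" "incident ?K" isl n h
  proof
    fix x y assume "incident ?K x y"
    then have "incident G x y" unfolding K(1) by blast
    then show "2 * int n dvd h y - h x - 1 \<or> 2 * int n dvd h y - h x + 1" by (rule h_adj)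
  next
    fix i show "\<exists>x\<in>elements ?K. 2 * int n dvd h x - i"
      using XYm(1)[of i] XYK(1)[of i] unfolding layer_def by blast
  qed
  have cK': "cycle_in (incident ?K) (2 * int n) c"
  proof -
    have "c i \<in> elements ?K" for i using cK by blast
    then have "incident ?K (c i) (c j) \<longleftrightarrow> incident G (c i) (c j)" for i j unfolding K(1) by blast
    then show ?thesis using c(1) unfolding cycle_in_def by presburger
  qed
  have "K.thick_graph"
  proof (rule K.thick_graphI[OF cK'])
    fix i
    let ?j = "i mod (2 * int n)"
    have "p ?j \<in> A" "q ?j \<in> A" "r ?j \<in> A" using imageI[OF mI[of i]] unfolding A_def by blast+
    then have "p ?j \<in> elements ?K" "q ?j \<in> elements ?K" "r ?j \<in> elements ?K"
      using AK by blast+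
    moreover have "c i \<in> elements ?K" using cK by blast
    ultimately have "incident ?K (c i) (p ?j)" "incident ?K (c i) (q ?j)" "incident ?K (c i) (r ?j)"
      using pqr[of ?j] unfolding cm[of i] K(1) by blast+
    then show "\<exists>u1 u2 u3. incident ?K (c i) u1 \<and> incident ?K (c i) u2 \<and> incident ?K (c i) u3 \<and>
        u1 \<noteq> u2 \<and> u1 \<noteq> u3 \<and> u2 \<noteq> u3"
      using pqr[of ?j] by (intro exI[of _ "p ?j"] exI[of _ "q ?j"] exI[of _ "r ?j"]) simp
  qed
  then obtain i where "card (L.layer i) = 1" using L.singleton_fibre_finite[OF finK] by blast
  then obtain x where x: "L.layer i = {x}" by (rule card_1_singletonE)
  have "X (i mod (2 * int n)) \<in> L.layer i" "Y (i mod (2 * int n)) \<in> L.layer i"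
    using XYm[of i] XYK[of i] unfolding layer_def L.layer_def by simp_all
  then have "X (i mod (2 * int n)) = Y (i mod (2 * int n))" unfolding x by simp
  then show False using XY[of "i mod (2 * int n)"] by blast
qed

section \<open>Folding and lifting\<close>

lemma walk_append:
  "walk V adj u \<Longrightarrow> walk V adj v \<Longrightarrow> adj (last u) (hd v) \<Longrightarrow> walk V adj (u @ v)"
proof (induction u)
  case (Cons x u)
  then show ?case by (cases "u = []") (auto simp: walk_Cons)
qed simp

context ngon_graph begin

text \<open>Cutting out a backtracking step would bring the ends closer than their distance.\<close>

lemma geodesic_nb:
  assumes "walk V adj w" "length w \<le> Suc n" "dist (hd w) (last w) = length w - 1"
  shows "nb w"
  using assms
proof (induction w)
  case (Cons x w)
  show ?case
  proof (cases "w = []")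
    case True then show ?thesis using Cons.prems by (simp add: walk_Cons)
  next
    case False
    let ?z = "last w"
    have a: "adj x (hd w)" "walk V adj w" "x \<in> V" using Cons.prems(1) False by (auto simp: walk_Cons)
    have zV: "?z \<in> V" using a(2) False unfolding walk_def by auto
    have d: "dist x ?z = length w" using Cons.prems(3) False by simp
    have le: "dist (hd w) ?z \<le> length w - 1" by (rule dist_le_walk[OF a(2)]) simp
    then have e: "dist (hd w) ?z = length w - 1" using dist_adj[OF a(1) zV] d by linarith
    have nbw: "nb w" using Cons.IH[OF a(2)] Cons.prems(2) e by simp
    have "x \<noteq> hd (tl w)" if t: "tl w \<noteq> []"
    proof
      assume x: "x = hd (tl w)"
      have "walk V adj (tl w)" using a(2) t by (cases w) (auto simp: walk_Cons)
      then have "dist (hd (tl w)) (last (tl w)) \<le> length w - 2" by (rule dist_le_walk) simp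
      then show False using d x t False by (cases w) (auto simp: last_tl)
    qed
    then show ?thesis using a nbw False by (auto simp: nb_walk_Cons)
  qed
qed simp

text \<open>A signed distance to \<open>p\<close>: walks entering \<open>p\<close> through
  \<open>l\<close> form the positive side, all others the negative one. At distance \<open>n\<close>
  geodesics are not unique, but the sign is then irrelevant because \<open>n\<close> and
  \<open>- n\<close> agree modulo \<open>2 * n\<close>.\<close>

definition fold_label :: "'a \<Rightarrow> 'a \<Rightarrow> 'a \<Rightarrow> int" where
  "fold_label p l z =
     (if \<exists>w. nb w \<and> hd w = z \<and> last w = p \<and> length w = Suc (dist z p) \<and> last (butlast w) = l
      then int (dist z p) else - int (dist z p))"

lemma fold_label_eq:
  assumes w: "nb w" "hd w = z" "last w = p" "length w = Suc d" and d: "d < n"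
  shows "fold_label p l z = (if last (butlast w) = l then int d else - int d)"
proof -
  have e: "dist z p = d" using dist_eqI[OF w] d by simp
  have "u = w" if "nb u" "hd u = z" "last u = p" "length u = Suc d" for u
    using nb_walk_unique[of u w] that w d by simp
  then have "(\<exists>u. nb u \<and> hd u = z \<and> last u = p \<and> length u = Suc d \<and> last (butlast u) = l) \<longleftrightarrow>
      last (butlast w) = l" using w by blast
  then show ?thesis unfolding fold_label_def e by simp
qed

lemma fold_label_same:
  assumes w: "nb w" "last w = p" "length w = Suc d" and u: "nb u" "last u = p" "length u = Suc d"
    and d: "d \<le> n" and s: "last (butlast w) = last (butlast u)"
  shows "2 * int n dvd fold_label p l (hd w) - fold_label p l (hd u)"
proof (cases "d < n")
  case True
  then show ?thesis using fold_label_eq[OF w(1) _ w(2,3)] fold_label_eq[OF u(1) _ u(2,3)] s by simp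
next
  case False
  then have "dist (hd w) p = n" "dist (hd u) p = n"
    using dist_eqI[OF w(1) _ w(2,3)] dist_eqI[OF u(1) _ u(2,3)] d by auto
  then show ?thesis unfolding fold_label_def by auto
qed

text \<open>A geodesic from \<open>z\<close> prolongs to one from \<open>z'\<close> that enters
  \<open>p\<close> through the same neighbour, so the signs agree. Exempt are \<open>z = p\<close>,
  where both signs give a step of 1, and distance \<open>n\<close>, where the sign is
  irrelevant.\<close>

lemma fold_label_step:
  assumes p: "p \<in> V" and a: "adj z z'" and d: "dist z' p = Suc (dist z p)"
  shows "2 * int n dvd fold_label p l z' - fold_label p l z - 1 \<or>
         2 * int n dvd fold_label p l z' - fold_label p l z + 1"
proof -
  have V: "z \<in> V" "z' \<in> V" using a adj_in adj_in2 by auto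
  have dn: "dist z p < n" using dist_walk(2)[OF V(2) p] d by simp
  obtain w where w: "nb w" "hd w = z" "last w = p" "length w = Suc (dist z p)"
    using dist_walk[OF V(1) p] by blast
  have wne: "w \<noteq> []" using w by auto
  have fz: "fold_label p l z = (if last (butlast w) = l then int (dist z p) else - int (dist z p))"
    by (rule fold_label_eq[OF w dn])
  show ?thesis
  proof (cases "dist z p = 0")
    case True
    then have "fold_label p l z = 0" using fz by simp
    moreover have "fold_label p l z' = 1 \<or> fold_label p l z' = -1"
      unfolding fold_label_def using d True by auto
    ultimately show ?thesis by auto
  next
    case False
    then have twne: "tl w \<noteq> []" using w by (cases w) auto
    have "z' \<noteq> hd (tl w)"
    proof
      assume e: "z' = hd (tl w)"
      have "nb (tl w)" using w(1) twne by (cases w) (auto simp: nb_walk_Cons)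
      then have "dist z' p = dist z p - 1"
        using dist_eqI[of "tl w" z' p "dist z p - 1"] e w twne dn False by (auto simp: last_tl)
      then show False using d by simp
    qed
    then have nb': "nb (z' # w)" using w wne V a adj_sym by (auto simp: nb_walk_Cons)
    have len: "length (z' # w) = Suc (dist z' p)" using w(4) d by simp
    have lb: "last (butlast (z' # w)) = last (butlast w)" using wne twne by (cases w) auto
    have last: "last (z' # w) = p" using w wne by simp
    show ?thesis
    proof (cases "last (butlast w) = l")
      case True
      then have "fold_label p l z' = int (dist z' p)"
        unfolding fold_label_def using nb' len lb last by (metis list.sel(1))
      then show ?thesis using True fz d by simp
    next
      case f: False
      show ?thesis
      proof (cases "dist z' p < n")
        case True
        then have "fold_label p l z' = - int (dist z' p)"
          using fold_label_eq[OF nb' _ last len] lb f by simp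
        then show ?thesis using f fz d by simp
      next
        case False
        then have "dist z' p = n" using dist_walk(2)[OF V(2) p] by simp
        moreover have "int (dist z p) = int n - 1" using d calculation by simp
        ultimately show ?thesis using f fz unfolding fold_label_def by auto
      qed
    qed
  qed
qed

lemma fold_label_adj:
  assumes p: "p \<in> V" and a: "adj z z'"
  shows "2 * int n dvd fold_label p l z' - fold_label p l z - 1 \<or>
         2 * int n dvd fold_label p l z' - fold_label p l z + 1"
  using dist_adj[OF a p]
proof
  assume "dist z p = Suc (dist z' p)"
  from fold_label_step[OF p adj_sym[OF a] this, of l]
  have "2 * int n dvd - (fold_label p l z - fold_label p l z' - 1) \<or>
        2 * int n dvd - (fold_label p l z - fold_label p l z' + 1)"
    by (simp only: dvd_minus_iff)
  then show ?thesis by (simp add: algebra_simps) blast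
qed (rule fold_label_step[OF p a])

text \<open>Residues up to \<open>n\<close> are reached through \<open>l\<close>, a larger residue
  \<open>r\<close> as \<open>- (2 * n - r)\<close> through a second neighbour of
  \<open>p\<close>.\<close>

lemma fold_label_surj:
  assumes p: "p \<in> V" and l: "adj p l"
  shows "\<exists>z\<in>V. 2 * int n dvd fold_label p l z - i"
proof -
  obtain l' where l': "adj p l'" "l' \<noteq> l" using another_neighbour[OF p] by blast
  have ex: "\<exists>w. nb w \<and> hd w \<in> V \<and> last w = p \<and> length w = Suc k \<and> last (butlast w) = q"
    if q: "adj p q" and k: "1 \<le> k" for q k
  proof -
    have "nb [q, p]" using q p adj_sym adj_in2 by (auto simp: nb_walk_Cons)
    then obtain u where u: "nb (u @ [q, p])" "length (u @ [q, p]) = Suc k"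
      using extend_walk[of "[q, p]" "Suc k"] k by auto
    moreover have "hd (u @ [q, p]) \<in> V"
      using nb_walk_in[OF u(1)] hd_in_set[of "u @ [q, p]"] by blast
    ultimately show ?thesis by (intro exI[of _ "u @ [q, p]"]) (simp add: butlast_append)
  qed
  define r where "r = i mod (2 * int n)"
  have r: "0 \<le> r" "r < 2 * int n" "2 * int n dvd i - r"
    using n_ge_3 unfolding r_def by (simp_all add: dvd_minus_mod)
  have sh: "2 * int n dvd t - i" if "2 * int n dvd t - r" for t
    using dvd_diff[OF that r(3)] by simp
  consider "r = 0" | "1 \<le> r" "r \<le> int n" | "int n < r" using r by linarith
  then show ?thesis
  proof cases
    case 1
    have "dist p p = 0" using dist_eqI[of "[p]" p p 0] p by simp
    then have "fold_label p l p = 0" unfolding fold_label_def by simp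
    moreover have "2 * int n dvd 0 - i" by (rule sh) (use 1 in simp)
    ultimately show ?thesis using p by (intro bexI[of _ p]) simp_all
  next
    case 2
    then have "1 \<le> nat r" by linarith
    obtain w where w: "nb w" "hd w \<in> V" "last w = p" "length w = Suc (nat r)" "last (butlast w) = l"
      using ex[OF l _, of "nat r"] \<open>1 \<le> nat r\<close> by blast
    have "dist (hd w) p = nat r" using dist_eqI[OF w(1) _ w(3,4)] 2 by simp
    then have "fold_label p l (hd w) = r" unfolding fold_label_def using w 2 by auto
    then show ?thesis using w(2) sh[of r] by auto
  next
    case 3
    define k where "k = nat (2 * int n - r)"
    have k: "1 \<le> k" "k < n" "int k = 2 * int n - r" using 3 r unfolding k_def by auto
    obtain w where w: "nb w" "hd w \<in> V" "last w = p" "length w = Suc k" "last (butlast w) = l'"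
      using ex[OF l'(1) k(1)] by blast
    have "fold_label p l (hd w) = - int k" using fold_label_eq[OF w(1) _ w(3,4) k(2)] w(5) l'(2) by simp
    then have "2 * int n dvd fold_label p l (hd w) - r" using k(3) by simp
    then show ?thesis using w(2) sh by blast
  qed
qed

text \<open>Leave the geodesic from \<open>z\<close> at its first inner vertex of the kind opposite
  to \<open>p\<close>: the next vertex for even distance, the one after it for odd. The new branch
  has the same length and enters \<open>p\<close> in the same way.\<close>

lemma fold_label_not_inj:
  assumes p: "p \<in> V" and ev: "even n" and z: "z \<in> V" "2 \<le> dist z p"
    and thick: "\<And>x a b. x \<in> V \<Longrightarrow> col x \<noteq> col p \<Longrightarrow> \<exists>u. adj x u \<and> u \<noteq> a \<and> u \<noteq> b"
  shows "\<exists>z'\<in>V. z' \<noteq> z \<and> 2 * int n dvd fold_label p l z' - fold_label p l z"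
proof -
  obtain w where w: "nb w" "hd w = z" "last w = p" "length w = Suc (dist z p)"
    using dist_walk[OF z(1) p] by blast
  have le: "dist z p \<le> n" by (rule dist_walk(2)[OF z(1) p])
  obtain y x t where t: "w = z # y # x # t"
    using w(2,4) z(2) by (cases w; cases "tl w"; cases "tl (tl w)") auto
  have nb1: "nb (y # x # t)" "nb (x # t)" "adj z y" "adj y x" using w(1) t by (auto simp: nb_walk_Cons)
  have V: "y \<in> V" "x \<in> V" using nb1 adj_in adj_in2 by blast+
  show ?thesis
  proof (cases "even (dist z p)")
    case True
    then have "col y \<noteq> col p" using dist_col[OF z(1) p] adj_col[OF nb1(3)] by auto
    from thick[OF V(1) this, of z x] obtain z' where z': "adj y z'" "z' \<noteq> z" "z' \<noteq> x" by blast
    have nb': "nb (z' # y # x # t)" using nb1 z' adj_sym adj_in2 by (auto simp: nb_walk_Cons)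
    have "2 * int n dvd fold_label p l (hd (z' # y # x # t)) - fold_label p l (hd w)"
      by (rule fold_label_same[OF nb' _ _ w(1,3,4) le]) (use w t in auto)
    then show ?thesis using z' adj_in2 w(2) by (intro bexI[of _ z']) auto
  next
    case False
    \<comment> \<open>Evenness of \<open>n\<close> excludes an odd distance \<open>n\<close>.
      Uniqueness of the geodesic then shows that the new branch does not end in
      \<open>z\<close>.\<close>
    then have lt: "dist z p < n" using le ev by (metis le_neq_implies_less)
    have "col x \<noteq> col p" using False dist_col[OF z(1) p] adj_col[OF nb1(3)] adj_col[OF nb1(4)] by auto
    from thick[OF V(2) this, of y "hd t"] obtain y' where y': "adj x y'" "y' \<noteq> y" "y' \<noteq> hd t" by blast
    have y'V: "y' \<in> V" using y' adj_in2 by blast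
    obtain z' where z': "adj y' z'" "z' \<noteq> x" using another_neighbour[OF y'V] by blast
    have nb': "nb (z' # y' # x # t)" using nb1 z' y' adj_sym adj_in2 by (auto simp: nb_walk_Cons)
    have "2 * int n dvd fold_label p l (hd (z' # y' # x # t)) - fold_label p l (hd w)"
    proof (rule fold_label_same[OF nb' _ _ w(1,3,4) le])
      have "t \<noteq> []"
      proof
        assume "t = []"
        then have "dist z p = 2" using w(4) t by simp
        then show False using False by simp
      qed
      then show "last (butlast (z' # y' # x # t)) = last (butlast w)" using t by auto
    qed (use w t in auto)
    moreover have "z' \<noteq> z"
    proof
      assume "z' = z"
      then have "z' # y' # x # t = w" by (intro nb_walk_unique[OF nb' w(1)]) (use w t lt in auto)
      then show False using t y'(2) by simp
    qed
    ultimately show ?thesis using z' adj_in2 w(2) by (intro bexI[of _ z']) auto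
  qed
qed

end

section \<open>Morphisms: local surjectivity and unique lifting\<close>

locale ngon_morphism = G: ngon_graph V adj col n + D: ngon_graph V' adj' col' n
  for V :: "'a set" and adj col and V' :: "'b set" and adj' col' n +
  fixes \<phi> :: "'a \<Rightarrow> 'b"
  assumes \<phi>_adj: "adj x y \<Longrightarrow> adj' (\<phi> x) (\<phi> y)" and \<phi>_onto: "\<phi> ` V = V'"
begin

lemma preimage_ex: "v \<in> V' \<Longrightarrow> \<exists>x\<in>V. \<phi> x = v"
  unfolding \<phi>_onto[symmetric] by (erule imageE) blast

lemma walk_map: "walk V adj w \<Longrightarrow> walk V' adj' (map \<phi> w)"
  unfolding walk_def using \<phi>_onto \<phi>_adj by auto

lemma nb_walk_map: "walk V adj w \<Longrightarrow> D.nb (map \<phi> w) \<Longrightarrow> G.nb w"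
  unfolding nb_walk_def by (auto simp: Suc_lessD)

text \<open>Prolong the edge from \<open>\<phi> x\<close> to \<open>u\<close> to a geodesic
  \<open>q\<close> with \<open>n - 1\<close> edges, and join \<open>x\<close> to a preimage of its
  end by a geodesic. The image of the latter has \<open>n - 1\<close> or \<open>n\<close> edges and
  the parity of \<open>q\<close>, so it is \<open>q\<close>, and its second vertex is
  \<open>u\<close>.\<close>

lemma locally_onto:
  assumes x: "x \<in> V" and u: "adj' (\<phi> x) u"
  shows "\<exists>y. adj x y \<and> \<phi> y = u"
proof -
  have V': "\<phi> x \<in> V'" "u \<in> V'" using u D.adj_in D.adj_in2 by auto
  have "D.nb [u, \<phi> x]" using u V' D.adj_sym by (simp add: nb_walk_Cons)
  then obtain r where r: "D.nb (r @ [u, \<phi> x])" "length (r @ [u, \<phi> x]) = n"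
    using D.extend_walk[of "[u, \<phi> x]" n] D.n_ge_3 by auto
  define q where "q = \<phi> x # u # rev r"
  have q: "D.nb q" "length q = n" "hd q = \<phi> x" "q \<noteq> []"
    using D.nb_rev[OF r(1)] r(2) unfolding q_def by simp_all
  have "last q \<in> \<phi> ` V" unfolding \<phi>_onto using nb_walk_in[OF q(1)] last_in_set[OF q(4)] by blast
  then obtain y where y: "last q = \<phi> y" "y \<in> V" by (rule imageE)
  obtain w where w: "G.nb w" "hd w = x" "last w = y" "length w \<le> Suc n" using G.diam[OF x y(2)] by blast
  have wne: "w \<noteq> []" using w by auto
  have W: "walk V' adj' (map \<phi> w)" by (rule walk_map[OF nb_walk_imp_walk[OF w(1)]])
  have ends: "hd (map \<phi> w) = hd q" "last (map \<phi> w) = last q"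
    using w y(1) wne q(3) by (simp_all add: hd_map last_map)
  have dq: "D.dist (hd q) (last q) = n - 1"
    by (rule D.dist_eqI[OF q(1)]) (use q(2) D.n_ge_3 in auto)
  have "odd (length w) \<longleftrightarrow> odd n"
    using D.walk_col[OF W] D.walk_col[OF nb_walk_imp_walk[OF q(1)]] ends q(2) by simp
  moreover have "n - 1 \<le> length w - 1"
    using D.dist_le_walk[OF W, of "length w - 1"] dq ends by simp
  ultimately have len: "length w = n" using w(4) D.n_ge_3 by (cases "length w = Suc n") auto
  have "D.nb (map \<phi> w)" by (rule D.geodesic_nb[OF W]) (use len dq ends in auto)
  then have "map \<phi> w = q" by (rule D.nb_walk_unique[OF _ q(1)]) (use ends len q(2) in auto)
  moreover obtain y' w' where "w = x # y' # w'"
    using w(2) len D.n_ge_3 by (cases w; cases "tl w") auto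
  ultimately have "\<phi> y' = u" "adj x y'" using w(1) unfolding q_def by (simp_all add: nb_walk_Cons)
  then show ?thesis by blast
qed

lemma lift_walk:
  assumes "walk V' adj' v" "x \<in> V" "\<phi> x = hd v"
  shows "\<exists>w. walk V adj w \<and> map \<phi> w = v \<and> hd w = x"
  using assms
proof (induction v arbitrary: x)
  case (Cons a v)
  show ?case
  proof (cases "v = []")
    case True then show ?thesis using Cons.prems by (intro exI[of _ "[x]"]) simp
  next
    case False
    then obtain y where y: "adj x y" "\<phi> y = hd v"
      using locally_onto[OF Cons.prems(2)] Cons.prems by (auto simp: walk_Cons)
    then obtain w where w: "walk V adj w" "map \<phi> w = v" "hd w = y"
      using Cons.IH[of y] Cons.prems(1) False G.adj_in2 by (auto simp: walk_Cons)
    then show ?thesis using y Cons.prems by (intro exI[of _ "x # w"]) (auto simp: walk_Cons)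
  qed
qed simp

text \<open>Lifts of \<open>v\<close> do not backtrack, and all of them end at \<open>x0\<close>.
  Lifts through \<open>y1\<close> and through \<open>y2\<close> can share their part up to
  \<open>x\<close>; having equal ends, they coincide.\<close>

lemma unique_lift_towards_singleton:
  assumes v: "D.nb v" "length v = n" and single: "{x \<in> V. \<phi> x = last v} = {x0}"
    and k: "Suc k < n" and x: "x \<in> V" "\<phi> x = v ! k"
    and y: "adj x y1" "adj x y2" "\<phi> y1 = v ! Suc k" "\<phi> y2 = v ! Suc k"
  shows "y1 = y2"
proof -
  have vs: "v = take (Suc k) v @ drop (Suc k) v" by simp
  have ne: "take (Suc k) v \<noteq> []" "drop (Suc k) v \<noteq> []" using v(2) k by auto
  have nb1: "D.nb (take (Suc k) v)" using nb_walk_append1[of _ _ "take (Suc k) v" "drop (Suc k) v"] v(1) ne by simp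
  have nb2: "D.nb (drop (Suc k) v)" using nb_walk_append2[of _ _ "take (Suc k) v" "drop (Suc k) v"] v(1) ne by simp
  have ends: "last (take (Suc k) v) = v ! k" "hd (drop (Suc k) v) = v ! Suc k"
    using v(2) k by (simp_all add: take_Suc_conv_app_nth hd_drop_conv_nth)
  have "hd (rev (take (Suc k) v)) = v ! k" using ends(1) ne(1) by (simp add: hd_rev)
  then obtain w0 where w0: "walk V adj w0" "map \<phi> w0 = rev (take (Suc k) v)" "hd w0 = x"
    using lift_walk[OF nb_walk_imp_walk[OF D.nb_rev[OF nb1]] x(1)] x(2) by auto
  have w0r: "walk V adj (rev w0)" "map \<phi> (rev w0) = take (Suc k) v" "last (rev w0) = x"
    using G.walk_rev[OF w0(1)] w0 by (auto simp: rev_map[symmetric] last_rev)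
  have key: "\<exists>w. G.nb (rev w0 @ w) \<and> hd w = y \<and> w \<noteq> [] \<and> last w = x0 \<and> length (rev w0 @ w) = n"
    if yy: "adj x y" "\<phi> y = v ! Suc k" for y
  proof -
    have "y \<in> V" using yy G.adj_in2 by blast
    then obtain w where w: "walk V adj w" "map \<phi> w = drop (Suc k) v" "hd w = y"
      using lift_walk[OF nb_walk_imp_walk[OF nb2]] yy(2) ends(2) by metis
    have m: "map \<phi> (rev w0 @ w) = v" using w0r(2) w(2) by (simp only: map_append append_take_drop_id)
    have "walk V adj (rev w0 @ w)"
      by (rule walk_append[OF w0r(1) w(1)]) (use w0r(3) w(3) yy(1) in simp)
    then have "G.nb (rev w0 @ w)" by (rule nb_walk_map) (use m v(1) in simp)
    moreover have wne: "w \<noteq> []" using w(1) by auto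
    moreover have "last w = x0"
    proof -
      have "last w \<in> V" using w(1) wne unfolding walk_def by auto
      moreover have "\<phi> (last w) = last v"
        using m wne by (metis append_is_Nil_conv last_appendR last_map)
      ultimately show ?thesis using single by blast
    qed
    moreover have "length (rev w0 @ w) = n" using m v(2) by (metis length_map)
    ultimately show ?thesis using w(3) by blast
  qed
  obtain u1 where u1: "G.nb (rev w0 @ u1)" "hd u1 = y1" "u1 \<noteq> []" "last u1 = x0" "length (rev w0 @ u1) = n"
    using key[OF y(1,3)] by blast
  obtain u2 where u2: "G.nb (rev w0 @ u2)" "hd u2 = y2" "u2 \<noteq> []" "last u2 = x0" "length (rev w0 @ u2) = n"
    using key[OF y(2,4)] by blast
  have "rev w0 \<noteq> []" using w0r(1) by auto
  then have "rev w0 @ u1 = rev w0 @ u2"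
    by (intro G.nb_walk_unique[OF u1(1) u2(1)]) (use u1 u2 in auto)
  then show ?thesis using u1 u2 by simp
qed

lemma unique_lift_on_cycle:
  assumes c: "cycle_in adj' (2 * int n) c" and single: "{x \<in> V. \<phi> x = c e} = {x0}"
    and m: "e < m" "m < e + int n" and x: "x \<in> V" "\<phi> x = c m"
    and y: "adj x y1" "adj x y2" "\<phi> y1 = c (m - 1)" "\<phi> y2 = c (m - 1)"
  shows "y1 = y2"
proof -
  \<comment> \<open>The \<open>n\<close> vertices from \<open>c (e + n - 1)\<close> down to
    \<open>c e\<close>, passing \<open>c m\<close> and then \<open>c (m - 1)\<close>.\<close>
  let ?f = "\<lambda>t. c (e + int n - 1 - int t)"
  have n: "Suc (n - 1) = n" using D.n_ge_3 by simp
  have "cycle_in adj' (2 * int n) (\<lambda>i. c (e + int n - 1 - i))" by (rule cycle_in_reflect[OF c])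
  from D.cycle_nb_walk[OF this, of 0 "n - 1"] have nb: "D.nb (map ?f [0..<n])"
    using D.n_ge_3 unfolding n by simp
  define k where "k = nat (e + int n - 1 - m)"
  have k: "Suc k < n" "e + int n - 1 - int k = m" using m unfolding k_def by auto
  have "e + int n - 1 - int (n - 1) = e" using D.n_ge_3 by simp
  moreover have "last (map ?f [0..<Suc (n - 1)]) = ?f (n - 1)" by simp
  ultimately have lst: "last (map ?f [0..<n]) = c e" unfolding n by simp
  have nth: "map ?f [0..<n] ! k = c m" "map ?f [0..<n] ! Suc k = c (m - 1)"
  proof -
    show "map ?f [0..<n] ! k = c m" using k by simp
    have "e + int n - 1 - int (Suc k) = m - 1" using k(2) by simp
    then show "map ?f [0..<n] ! Suc k = c (m - 1)" using k(1) by simp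
  qed
  show ?thesis
    by (rule unique_lift_towards_singleton[OF nb _ _ k(1) x(1), where ?x0.0 = x0])
      (use single lst nth x y in simp_all)
qed

text \<open>Position 2 lies strictly between the singletons, at distance below \<open>n\<close> from
  both; this uses \<open>4 \<le> n\<close>. An element over \<open>c 2\<close> has at most one
  neighbour over \<open>c 1\<close> and one over \<open>c 3\<close>, against thickness.\<close>

lemma two_far_singletons:
  assumes thick: G.thick_graph and c: "cycle_in adj' (2 * int n) c" and n4: "4 \<le> n"
    and two: "\<And>z. adj' (c 2) z \<Longrightarrow> z = c 1 \<or> z = c 3"
    and i: "-1 \<le> i" "i \<le> 1" "{x \<in> V. \<phi> x = c i} = {x0}"
    and j: "int n - 1 \<le> j" "j \<le> int n + 1" "{x \<in> V. \<phi> x = c j} = {x1}"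
  shows False
proof -
  have "c 2 \<in> V'" using cycle_in_adj[OF c] D.adj_in by blast
  then obtain x where x: "x \<in> V" "\<phi> x = c 2" using preimage_ex by blast
  obtain p where p: "adj x p" using G.another_neighbour[OF x(1)] by blast
  obtain q where q: "adj x q" "q \<noteq> p" using G.another_neighbour[OF x(1)] by blast
  obtain r where r: "adj x r" "r \<noteq> p" "r \<noteq> q" using thick x(1) unfolding G.thick_graph_def by metis
  have over: "\<phi> y = c 1 \<or> \<phi> y = c 3" if "adj x y" for y
    by (rule two) (use \<phi>_adj[OF that] x(2) in simp)
  have one: "y = y'" if "adj x y" "adj x y'" "\<phi> y = c 1" "\<phi> y' = c 1" for y y'
    by (rule unique_lift_on_cycle[OF c i(3) _ _ x]) (use that i n4 in simp_all)
  \<comment> \<open>Reflection turns the ascent from 2 to \<open>j\<close> into a descent, so that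
    \<open>unique_lift_on_cycle\<close> applies again.\<close>
  have "cycle_in adj' (2 * int n) (\<lambda>i. c (0 - i))" by (rule cycle_in_reflect[OF c])
  note three_aux = unique_lift_on_cycle[OF this, of "- j" x1 "-2" x]
  have three: "y = y'" if "adj x y" "adj x y'" "\<phi> y = c 3" "\<phi> y' = c 3" for y y'
    by (rule three_aux) (use that j n4 x in simp_all)
  have "\<not> (\<phi> p = c 1 \<and> \<phi> q = c 1)" "\<not> (\<phi> p = c 3 \<and> \<phi> q = c 3)"
    using one[OF p q(1)] three[OF p q(1)] q(2) by blast+
  moreover have "\<not> (\<phi> p = c 1 \<and> \<phi> r = c 1)" "\<not> (\<phi> p = c 3 \<and> \<phi> r = c 3)"
    using one[OF p r(1)] three[OF p r(1)] r(2) by blast+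
  moreover have "\<not> (\<phi> q = c 1 \<and> \<phi> r = c 1)" "\<not> (\<phi> q = c 3 \<and> \<phi> r = c 3)"
    using one[OF q(1) r(1)] three[OF q(1) r(1)] r(3) by blast+
  ultimately show False using over[OF p] over[OF q(1)] over[OF r(1)] by blast
qed

end

section \<open>Recognizing the types\<close>

text \<open>The two lifting assumptions are local surjectivity, stated separately for points and
  lines.\<close>

locale polygon_cover =
  fixes G :: "('p, 'l) geometry" and D :: "('q, 'm) geometry" and f :: "'p \<Rightarrow> 'q" and g :: "'l \<Rightarrow> 'm"
  assumes Inc_G: "Inc G p l \<Longrightarrow> p \<in> Pts G \<and> l \<in> Lns G"
    and Inc_D: "Inc D q m \<Longrightarrow> q \<in> Pts D \<and> m \<in> Lns D"
    and Inc_f_g: "Inc G p l \<Longrightarrow> Inc D (f p) (g l)"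
    and lift_line: "p \<in> Pts G \<Longrightarrow> Inc D (f p) m \<Longrightarrow> \<exists>l. Inc G p l \<and> g l = m"
    and lift_point: "l \<in> Lns G \<Longrightarrow> Inc D q (g l) \<Longrightarrow> \<exists>p. Inc G p l \<and> f p = q"
begin

text \<open>A stretch of an ordinary polygon around \<open>v\<close>. It records the absence of
  further incidences with \<open>v\<close>, \<open>m\<close> and \<open>m'\<close>, as the
  description of a neighbouring fibre requires.\<close>

definition path_at :: "'q \<Rightarrow> 'm \<Rightarrow> 'q \<Rightarrow> 'm \<Rightarrow> 'q \<Rightarrow> bool" where
  "path_at u m v m' w \<longleftrightarrow> m \<noteq> m' \<and> (\<forall>k. Inc D v k \<longleftrightarrow> k = m \<or> k = m') \<and>
     (\<forall>q. Inc D q m \<longleftrightarrow> q = u \<or> q = v) \<and> (\<forall>q. Inc D q m' \<longleftrightarrow> q = v \<or> q = w)"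

lemma path_at_sym: "path_at u m v m' w \<Longrightarrow> path_at w m' v m u"
  unfolding path_at_def by blast

lemma path_at_join:
  assumes "path_at u m v m' w" "u \<noteq> v" "v \<noteq> w" "u \<noteq> w"
  shows "join D u v = m" "join D v u = m" "join D v w = m'" "join D w v = m'"
    "collinear_in D u v" "collinear_in D v u" "collinear_in D v w" "collinear_in D w v"
proof -
  have I: "Inc D v k \<longleftrightarrow> k = m \<or> k = m'" "Inc D q m \<longleftrightarrow> q = u \<or> q = v" "Inc D q m' \<longleftrightarrow> q = v \<or> q = w"
    and "m \<noteq> m'" for k q using assms unfolding path_at_def by blast+
  have on: "Inc D u m" "Inc D v m" "Inc D v m'" "Inc D w m'" by (simp_all add: I)
  have in_D: "u \<in> Pts D" "v \<in> Pts D" "w \<in> Pts D" "m \<in> Lns D" "m' \<in> Lns D"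
    using Inc_D[OF on(1)] Inc_D[OF on(3)] Inc_D[OF on(4)] by blast+
  have u: "l \<in> Lns D \<and> Inc D u l \<and> Inc D v l \<longleftrightarrow> l = m" for l
    using I(1)[of l] I(3)[of u] assms(2,4) on in_D by blast
  have w: "l \<in> Lns D \<and> Inc D v l \<and> Inc D w l \<longleftrightarrow> l = m'" for l
    using I(1)[of l] I(2)[of w] assms(3,4) on in_D by blast
  show "join D u v = m" "join D v u = m" unfolding join_def using u by (simp_all add: conj_commute)
  show "join D v w = m'" "join D w v = m'" unfolding join_def using w by (simp_all add: conj_commute)
  show "collinear_in D u v" "collinear_in D v u" "collinear_in D v w" "collinear_in D w v"
    unfolding collinear_in_def using in_D on by blast+
qed

lemma line_fibre:
  assumes "path_at u m v m' w"
  shows "fibre g (Lns G) m' = {l \<in> Lns G. g l \<noteq> m \<and> (\<exists>p\<in>fibre f (Pts G) v. Inc G p l)}"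
proof -
  have I: "Inc D v k \<longleftrightarrow> k = m \<or> k = m'" and "m \<noteq> m'" for k using assms unfolding path_at_def by blast+
  have "g l = m' \<longleftrightarrow> g l \<noteq> m \<and> (\<exists>p\<in>fibre f (Pts G) v. Inc G p l)" if l: "l \<in> Lns G" for l
  proof
    assume e: "g l = m'"
    then obtain p where "Inc G p l" "f p = v" using lift_point[OF l, of v] I by blast
    then show "g l \<noteq> m \<and> (\<exists>p\<in>fibre f (Pts G) v. Inc G p l)"
      using e \<open>m \<noteq> m'\<close> Inc_G unfolding fibre_def by blast
  next
    assume "g l \<noteq> m \<and> (\<exists>p\<in>fibre f (Pts G) v. Inc G p l)"
    then show "g l = m'" using Inc_f_g I unfolding fibre_def by blast
  qed
  then show ?thesis unfolding fibre_def by blast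
qed

text \<open>Lifting a line through \<open>p\<close> and then a point on it reaches the fibre of
  \<open>v\<close>. The case \<open>f p = v\<close> appears because \<open>collinear_in\<close> does
  not ask for distinct points.\<close>

lemma collinear_with_fibre:
  assumes "path_at u m v m' w" and p: "p \<in> Pts G"
  shows "(\<exists>q\<in>fibre f (Pts G) v. collinear_in G p q) \<longleftrightarrow> f p = u \<or> f p = v \<or> f p = w"
proof -
  have I: "Inc D v k \<longleftrightarrow> k = m \<or> k = m'" "Inc D q m \<longleftrightarrow> q = u \<or> q = v" "Inc D q m' \<longleftrightarrow> q = v \<or> q = w"
    for k q using assms unfolding path_at_def by blast+
  show ?thesis
  proof
    assume "\<exists>q\<in>fibre f (Pts G) v. collinear_in G p q"
    then obtain q l where "f q = v" "Inc G p l" "Inc G q l"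
      unfolding fibre_def collinear_in_def by blast
    then show "f p = u \<or> f p = v \<or> f p = w" using Inc_f_g I by metis
  next
    assume "f p = u \<or> f p = v \<or> f p = w"
    then obtain k where k: "Inc D (f p) k" "Inc D v k" using I by blast
    obtain l where l: "Inc G p l" "g l = k" using lift_line[OF p k(1)] by blast
    then obtain q where "Inc G q l" "f q = v" using lift_point[of l v] Inc_G k(2) by blast
    then show "\<exists>q\<in>fibre f (Pts G) v. collinear_in G p q"
      using l(1) Inc_G unfolding fibre_def collinear_in_def by blast
  qed
qed

text \<open>Each point over \<open>u\<close> or \<open>v\<close> lies on some line over
  \<open>m\<close>, and \<open>L\<close> is the only candidate; hence \<open>L\<close> carries both
  fibres entirely.\<close>

lemma single_line_fibre:
  assumes "fibre g (Lns G) m = {L}" and m: "\<And>q. Inc D q m \<longleftrightarrow> q = u \<or> q = v"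
  shows "L \<in> Lns G" "g L = m" "\<And>l. l \<in> Lns G \<Longrightarrow> g l = m \<longleftrightarrow> l = L"
    "\<And>p. p \<in> Pts G \<Longrightarrow> Inc G p L \<longleftrightarrow> f p = u \<or> f p = v"
    "fibre f (Pts G) u \<union> fibre f (Pts G) v = points_on G L"
    "fibre f (Pts G) u \<noteq> {}" "fibre f (Pts G) v \<noteq> {}"
proof -
  show L: "L \<in> Lns G" "g L = m" using assms(1) unfolding fibre_def by blast+
  show eq: "g l = m \<longleftrightarrow> l = L" if "l \<in> Lns G" for l using assms(1) that L unfolding fibre_def by blast
  show on: "Inc G p L \<longleftrightarrow> f p = u \<or> f p = v" if p: "p \<in> Pts G" for p
  proof
    assume "Inc G p L" then show "f p = u \<or> f p = v" using Inc_f_g[of p L] L(2) m by simp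
  next
    assume "f p = u \<or> f p = v"
    then obtain l where "Inc G p l" "g l = m" using lift_line[OF p, of m] m by blast
    then show "Inc G p L" using eq[of l] Inc_G by blast
  qed
  show "fibre f (Pts G) u \<union> fibre f (Pts G) v = points_on G L"
    using on unfolding fibre_def points_on_def by blast
  have "Inc D u (g L)" "Inc D v (g L)" using L(2) m by simp_all
  then show "fibre f (Pts G) u \<noteq> {}" "fibre f (Pts G) v \<noteq> {}"
    using lift_point[OF L(1)] Inc_G unfolding fibre_def by blast+
qed

lemma type_a_quadrangleI:
  assumes P: "Pts D = {a, b, c, d}" "distinct [a, b, c, d]"
    and paths: "path_at d da a ab b" "path_at a ab b bc c" "path_at b bc c cd d" "path_at c cd d da a"
    and L: "fibre g (Lns G) ab = {L}"
  shows "type_a_quadrangle G D f g a b c d"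
proof -
  have ne: "a \<noteq> b" "b \<noteq> c" "c \<noteq> d" "d \<noteq> a" "a \<noteq> c" "b \<noteq> d" "d \<noteq> b" using P(2) by auto
  note J = path_at_join(1-4)[OF paths(1) ne(4,1,7)] path_at_join(1-4)[OF paths(3) ne(2,3,6)]
  note C = path_at_join(5-8)[OF paths(1) ne(4,1,7)] path_at_join(5-8)[OF paths(3) ne(2,3,6)]
  have ab: "Inc D q ab \<longleftrightarrow> q = a \<or> q = b" for q using paths(1) unfolding path_at_def by blast
  note single = single_line_fibre[OF L ab]
  let ?F = "fibre f (Pts G)"
  have mem: "x \<in> ?F y \<longleftrightarrow> x \<in> Pts G \<and> f x = y" for x y unfolding fibre_def by simp
  \<comment> \<open>Assumption \<open>uv\<close> fixes \<open>u\<close> and \<open>v\<close> only as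
    an unordered pair, so one argument serves both ends of the line \<open>ab\<close>.\<close>
  have beyond: "?F w = {p \<in> Pts G. \<not> Inc G p L \<and> (\<exists>q\<in>?F v. collinear_in G p q)}"
    if path: "path_at u m v m' w" and uv: "\<And>x. x = u \<or> x = v \<longleftrightarrow> x = a \<or> x = b"
      and w: "w \<noteq> a" "w \<noteq> b" for u m v m' w
  proof -
    have "f p = w \<longleftrightarrow> \<not> Inc G p L \<and> (\<exists>q\<in>?F v. collinear_in G p q)" if p: "p \<in> Pts G" for p
      unfolding collinear_with_fibre[OF path p] single(4)[OF p] using uv[of "f p"] w by auto
    then show ?thesis unfolding set_eq_iff mem mem_Collect_eq by (simp cong: conj_cong)
  qed
  show ?thesis
    unfolding type_a_quadrangle_def Let_def J
  proof (intro conjI bexI[OF _ single(1)] P C)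
    show "?F a \<inter> ?F b = {}" using ne(1) by (auto simp: mem)
    show "?F c = {p \<in> Pts G. \<not> Inc G p L \<and> (\<exists>q\<in>?F b. collinear_in G p q)}"
      by (rule beyond[OF paths(2)]) (use ne in auto)
    show "?F d = {p \<in> Pts G. \<not> Inc G p L \<and> (\<exists>q\<in>?F a. collinear_in G p q)}"
      by (rule beyond[OF path_at_sym[OF paths(1)]]) (use ne in auto)
    show "fibre g (Lns G) bc = {l \<in> Lns G. l \<noteq> L \<and> (\<exists>p\<in>?F b. Inc G p l)}"
      unfolding line_fibre[OF paths(2)] using single(3) by blast
    show "fibre g (Lns G) da = {l \<in> Lns G. l \<noteq> L \<and> (\<exists>p\<in>?F a. Inc G p l)}"
      unfolding line_fibre[OF path_at_sym[OF paths(1)]] using single(3) by blast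
    \<comment> \<open>This makes \<open>cd\<close> the only line incident with both \<open>c\<close>
      and \<open>d\<close>.\<close>
    have "bc \<noteq> da"
    proof
      assume "bc = da"
      moreover have "Inc D c bc" "\<not> Inc D c da" using paths(1,2) ne unfolding path_at_def by blast+
      ultimately show False by simp
    qed
    moreover have cd: "Inc D c k \<longleftrightarrow> k = bc \<or> k = cd" "Inc D d k \<longleftrightarrow> k = cd \<or> k = da" for k
      using paths(3,4) unfolding path_at_def by blast+
    ultimately have g_cd: "g l = cd \<longleftrightarrow> Inc D c (g l) \<and> Inc D d (g l)" for l by auto
    have hits: "Inc D x (g l) \<longleftrightarrow> (\<exists>p\<in>?F x. Inc G p l)" if "Inc D x cd" "l \<in> Lns G" for x l
      using lift_point[OF that(2), of x] Inc_f_g[of _ l] Inc_G[of _ l] mem[of _ x] by auto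
    have "Inc D c cd" "Inc D d cd" using cd by blast+
    then have "g l = cd \<longleftrightarrow> (\<exists>p\<in>?F c. Inc G p l) \<and> (\<exists>p\<in>?F d. Inc G p l)" if "l \<in> Lns G" for l
      using g_cd[of l] hits[of c l] hits[of d l] that by blast
    then show "fibre g (Lns G) cd = {l \<in> Lns G. (\<exists>p\<in>?F c. Inc G p l) \<and> (\<exists>p\<in>?F d. Inc G p l)}"
      unfolding fibre_def by blast
  qed (fact single L)+
qed

lemma type_a_hexagonI:
  assumes P: "Pts D = {a, b, c, d, e, h}" "distinct [a, b, c, d, e, h]"
    and paths: "path_at h ha a ab b" "path_at a ab b bc c" "path_at b bc c cd d"
      "path_at c cd d de e" "path_at d de e eh h" "path_at e eh h ha a"
    and L: "fibre g (Lns G) bc = {L}"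
  shows "type_a_hexagon G D f g a b c d e h"
proof -
  have ne: "a \<noteq> b" "b \<noteq> c" "c \<noteq> d" "d \<noteq> e" "e \<noteq> h" "h \<noteq> a" "h \<noteq> b" "b \<noteq> d" "d \<noteq> h" using P(2) by auto
  note J = path_at_join(1-4)[OF paths(1) ne(6,1,7)] path_at_join(1-4)[OF paths(3) ne(2,3,8)]
    path_at_join(1-4)[OF paths(5) ne(4,5,9)]
  note C = path_at_join(5-8)[OF paths(1) ne(6,1,7)] path_at_join(5-8)[OF paths(3) ne(2,3,8)]
    path_at_join(5-8)[OF paths(5) ne(4,5,9)]
  have bc: "Inc D q bc \<longleftrightarrow> q = c \<or> q = b" for q using paths(3) unfolding path_at_def by blast
  note single = single_line_fibre[OF L bc]
  let ?F = "fibre f (Pts G)"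
  have mem: "x \<in> ?F y \<longleftrightarrow> x \<in> Pts G \<and> f x = y" for x y unfolding fibre_def by simp
  have beyond: "?F w = {p \<in> Pts G. \<not> Inc G p L \<and> (\<exists>q\<in>?F v. collinear_in G p q)}"
    if path: "path_at u m v m' w" and uv: "\<And>x. x = u \<or> x = v \<longleftrightarrow> x = b \<or> x = c"
      and w: "w \<noteq> b" "w \<noteq> c" for u m v m' w
  proof -
    have "f p = w \<longleftrightarrow> \<not> Inc G p L \<and> (\<exists>q\<in>?F v. collinear_in G p q)" if p: "p \<in> Pts G" for p
      unfolding collinear_with_fibre[OF path p] single(4)[OF p] using uv[of "f p"] w by auto
    then show ?thesis unfolding set_eq_iff mem mem_Collect_eq by (simp cong: conj_cong)
  qed
  have beyond2: "?F w = {p \<in> Pts G. p \<notin> ?F s \<union> ?F t \<and> (\<exists>q\<in>?F v. collinear_in G p q)}"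
    if path: "path_at u m v m' w" and uv: "\<And>x. x = u \<or> x = v \<longleftrightarrow> x = s \<or> x = t"
      and w: "w \<noteq> s" "w \<noteq> t" for u m v m' w s t
  proof -
    have "f p = w \<longleftrightarrow> p \<notin> ?F s \<union> ?F t \<and> (\<exists>q\<in>?F v. collinear_in G p q)" if p: "p \<in> Pts G" for p
      unfolding collinear_with_fibre[OF path p] using uv[of "f p"] w mem[of p] p by auto
    then show ?thesis unfolding set_eq_iff mem mem_Collect_eq by (simp cong: conj_cong)
  qed
  have fib: "fibre g (Lns G) m' = {l \<in> Lns G. l \<notin> fibre g (Lns G) m \<and> (\<exists>p\<in>?F v. Inc G p l)}"
    if "path_at u m v m' w" for u m v m' w
    unfolding line_fibre[OF that] by (auto simp: fibre_def)
  have fibL: "fibre g (Lns G) m' = {l \<in> Lns G. l \<noteq> L \<and> (\<exists>p\<in>?F v. Inc G p l)}"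
    if "path_at u bc v m' w" for u v m' w
    unfolding line_fibre[OF that] using single(3) by blast
  show ?thesis
    unfolding type_a_hexagon_def Let_def J
  proof (intro conjI bexI[OF _ single(1)] P C)
    show "?F c \<inter> ?F b = {}" using ne(2) by (auto simp: mem)
    show "?F d = {p \<in> Pts G. \<not> Inc G p L \<and> (\<exists>q\<in>?F c. collinear_in G p q)}"
      by (rule beyond[OF paths(3)]) (use P(2) in auto)
    show "?F a = {p \<in> Pts G. \<not> Inc G p L \<and> (\<exists>q\<in>?F b. collinear_in G p q)}"
      by (rule beyond[OF path_at_sym[OF paths(2)]]) (use P(2) in auto)
    show "?F e = {p \<in> Pts G. p \<notin> ?F c \<union> ?F d \<and> (\<exists>q\<in>?F d. collinear_in G p q)}"
      by (rule beyond2[OF paths(4)]) (use P(2) in auto)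
    show "?F h = {p \<in> Pts G. p \<notin> ?F a \<union> ?F b \<and> (\<exists>q\<in>?F a. collinear_in G p q)}"
      by (rule beyond2[OF path_at_sym[OF paths(1)]]) (use P(2) in auto)
  qed (fact L single fibL[OF paths(3)] fibL[OF path_at_sym[OF paths(2)]] fib[OF paths(4)]
       fib[OF path_at_sym[OF paths(1)]] fib[OF path_at_sym[OF paths(6)]] fib[OF paths(5)])+
qed

end

lemma cycle_neighbours:
  assumes c: "cycle_in (incident D) N c" and r: "range c = elements D" and D: "point_line_geometry D"
  shows "incident D (c i) y \<longleftrightarrow> y = c (i + 1) \<or> y = c (i - 1)"
proof
  assume a: "incident D (c i) y"
  then have "y \<in> range c"
    unfolding r using bipartite_graph.adj_in2[OF bipartite_graph_incident[OF D]] by blast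
  then obtain j where j: "y = c j" by blast
  then have "j mod N = (i + 1) mod N \<or> i mod N = (j + 1) mod N" using a c unfolding cycle_in_def by blast
  then have "N dvd j - (i + 1) \<or> N dvd j - (i - 1)"
  proof
    assume "i mod N = (j + 1) mod N"
    then have "N dvd - (i - (j + 1))" unfolding mod_eq_dvd_iff by (simp only: dvd_minus_iff)
    then show ?thesis by (simp add: algebra_simps)
  qed (simp add: mod_eq_dvd_iff)
  then show "y = c (i + 1) \<or> y = c (i - 1)" unfolding j cycle_in_eq[OF c] .
next
  assume "y = c (i + 1) \<or> y = c (i - 1)"
  then show "incident D (c i) y"
    using cycle_in_adj[OF c, of i] cycle_in_adj[OF c, of "i - 1"]
      bipartite_graph.adj_sym[OF bipartite_graph_incident[OF D]] by auto
qed

lemma type_a_of_cycle: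
  assumes n: "n \<in> {4, 6}" and G: "point_line_geometry G" and D: "point_line_geometry D"
    and adj: "\<And>x y. incident G x y \<Longrightarrow> incident D (map_sum f g x) (map_sum f g y)"
    and lift: "\<And>x u. x \<in> elements G \<Longrightarrow> incident D (map_sum f g x) u \<Longrightarrow> \<exists>y. incident G x y \<and> map_sum f g y = u"
    and c: "cycle_in (incident D) (2 * int n) c" "range c = elements D"
    and line: "\<not> isl (c 0)" and single: "{x \<in> elements G. map_sum f g x = c 0} = {x0}"
  shows "type_a n G D f g"
proof -
  interpret polygon_cover G D f g
  proof
    show "p \<in> Pts G \<and> l \<in> Lns G" if "Inc G p l" for p l using G that by (simp add: point_line_geometry_def)
    show "p \<in> Pts D \<and> l \<in> Lns D" if "Inc D p l" for p l using D that by (simp add: point_line_geometry_def)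
    show "Inc D (f p) (g l)" if "Inc G p l" for p l using adj[of "Inl p" "Inr l"] that by simp
    show "\<exists>l. Inc G p l \<and> g l = m" if pm: "p \<in> Pts G" "Inc D (f p) m" for p m
    proof -
      obtain y where y: "incident G (Inl p) y" "map_sum f g y = Inr m"
        using lift[of "Inl p" "Inr m"] pm by auto
      then show ?thesis by (cases y) auto
    qed
    show "\<exists>p. Inc G p l \<and> f p = q" if lq: "l \<in> Lns G" "Inc D q (g l)" for l q
    proof -
      obtain y where y: "incident G (Inr l) y" "map_sum f g y = Inl q"
        using lift[of "Inr l" "Inl q"] lq by auto
      then show ?thesis by (cases y) auto
    qed
  qed
  define pt where "pt i = projl (c i)" for i
  define ln where "ln i = projr (c i)" for i
  \<comment> \<open>The line with the singleton fibre is at position 0, so here points have the odd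
    positions.\<close>
  have isl: "isl (c i) \<longleftrightarrow> odd i" for i using cycle_isl[OF c(1), of i] line by simp
  have pt: "c i = Inl (pt i)" if "odd i" for i using isl[of i] that unfolding pt_def by simp
  have ln: "c i = Inr (ln i)" if "even i" for i using isl[of i] that unfolding ln_def by (cases "c i") auto
  have nb: "incident D (c i) y \<longleftrightarrow> y = c (i + 1) \<or> y = c (i - 1)" for i y
    by (rule cycle_neighbours[OF c D])
  have eq: "pt i = pt j \<longleftrightarrow> 2 * int n dvd i - j" if "odd i" "odd j" for i j
    using cycle_in_eq[OF c(1), of i j] pt that by simp
  have eql: "ln i = ln j \<longleftrightarrow> 2 * int n dvd i - j" if "even i" "even j" for i j
    using cycle_in_eq[OF c(1), of i j] ln that by simp
  have path: "path_at (pt (i - 2)) (ln (i - 1)) (pt i) (ln (i + 1)) (pt (i + 2))" if "odd i" for i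
    unfolding path_at_def
  proof (intro conjI allI)
    have o: "odd (i - 2)" "even (i - 1)" "even (i + 1)" "odd (i + 2)" using that by simp_all
    show "ln (i - 1) \<noteq> ln (i + 1)" using eql[OF o(2,3)] n by auto
    show "Inc D (pt i) k \<longleftrightarrow> k = ln (i - 1) \<or> k = ln (i + 1)" for k
      using nb[of i "Inr k"] pt[OF that] ln[OF o(2)] ln[OF o(3)] by auto
    show "Inc D q (ln (i - 1)) \<longleftrightarrow> q = pt (i - 2) \<or> q = pt i" for q
      using nb[of "i - 1" "Inl q"] pt[OF that] pt[OF o(1)] ln[OF o(2)] by auto
    show "Inc D q (ln (i + 1)) \<longleftrightarrow> q = pt i \<or> q = pt (i + 2)" for q
      using nb[of "i + 1" "Inl q"] pt[OF that] pt[OF o(4)] ln[OF o(3)] by (auto simp: add.assoc)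
  qed
  have Pts: "q \<in> Pts D \<longleftrightarrow> (\<exists>i\<in>{0..<2 * int n}. odd i \<and> q = pt i)" for q
  proof
    assume "q \<in> Pts D"
    then have "Inl q \<in> range c" using c(2) by simp
    then obtain j where j: "c j = Inl q" by (metis rangeE)
    define i where "i = j mod (2 * int n)"
    have "2 * int n dvd i - j" unfolding i_def mod_eq_dvd_iff[symmetric] by (rule mod_mod_trivial)
    then have ci: "c i = Inl q" using cycle_in_eq[OF c(1), of i j] j by simp
    moreover have "odd i" using isl[of i] ci by simp
    moreover have "i \<in> {0..<2 * int n}" using n unfolding i_def by auto
    ultimately show "\<exists>i\<in>{0..<2 * int n}. odd i \<and> q = pt i" using pt by (intro bexI[of _ i]) auto
  next
    assume "\<exists>i\<in>{0..<2 * int n}. odd i \<and> q = pt i"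
    then obtain i where "odd i" "q = pt i" by blast
    then have "Inl q = c i" using pt by simp
    then have "Inl q \<in> elements D" using c(2) by auto
    then show "q \<in> Pts D" by simp
  qed
  have "map_sum f g x0 = Inr (ln 0)" "x0 \<in> elements G" using single ln[of 0] by auto
  then obtain L where L: "x0 = Inr L" by (cases x0) auto
  have fib: "fibre g (Lns G) (ln 0) = {L}"
  proof -
    have "l \<in> fibre g (Lns G) (ln 0) \<longleftrightarrow> Inr l \<in> {x \<in> elements G. map_sum f g x = c 0}" for l
      using ln[of 0] unfolding fibre_def by simp
    then show ?thesis unfolding single L by auto
  qed
  consider "n = 4" | "n = 6" using n by blast
  then show ?thesis
  proof cases
    case 1
    have odds: "0 \<le> i \<and> i < 8 \<and> odd i \<longleftrightarrow> i = 7 \<or> i = 1 \<or> i = 3 \<or> i = 5" for i :: int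
      by presburger
    have "{0..<2 * int n} \<inter> {i. odd i} = {7, 1, 3, 5}"
      by (rule set_eqI) (use odds in \<open>simp add: 1 conj_assoc\<close>)
    moreover have "Pts D = pt ` ({0..<2 * int n} \<inter> {i. odd i})" using Pts by auto
    ultimately have P: "Pts D = {pt 7, pt 1, pt 3, pt 5}" by simp
    have dist: "distinct [pt 7, pt 1, pt 3, pt 5]" using 1 by (simp add: eq)
    have per: "pt 9 = pt 1" "pt (-1) = pt 7" "ln 8 = ln 0" using 1 by (simp_all add: eq eql)
    \<comment> \<open>Position 0 has to be the line \<open>ab\<close>, so \<open>a\<close> and
      \<open>b\<close> are at 7, which is -1 modulo 8, and at 1.\<close>
    have "type_a_quadrangle G D f g (pt 7) (pt 1) (pt 3) (pt 5)"
    proof (rule type_a_quadrangleI[OF P dist _ _ _ _ fib])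
      show "path_at (pt 5) (ln 6) (pt 7) (ln 0) (pt 1)" using path[of 7] by (simp add: per)
      show "path_at (pt 7) (ln 0) (pt 1) (ln 2) (pt 3)" using path[of 1] by (simp add: per)
      show "path_at (pt 1) (ln 2) (pt 3) (ln 4) (pt 5)" using path[of 3] by simp
      show "path_at (pt 3) (ln 4) (pt 5) (ln 6) (pt 7)" using path[of 5] by simp
    qed
    then show ?thesis unfolding type_a_def using 1 by blast
  next
    case 2
    have odds: "0 \<le> i \<and> i < 12 \<and> odd i \<longleftrightarrow>
        i = 9 \<or> i = 11 \<or> i = 1 \<or> i = 3 \<or> i = 5 \<or> i = 7" for i :: int
      by presburger
    have "{0..<2 * int n} \<inter> {i. odd i} = {9, 11, 1, 3, 5, 7}"
      by (rule set_eqI) (use odds in \<open>simp add: 2 conj_assoc\<close>)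
    moreover have "Pts D = pt ` ({0..<2 * int n} \<inter> {i. odd i})" using Pts by auto
    ultimately have P: "Pts D = {pt 9, pt 11, pt 1, pt 3, pt 5, pt 7}" by simp
    have dist: "distinct [pt 9, pt 11, pt 1, pt 3, pt 5, pt 7]" using 2 by (simp add: eq)
    have per: "pt 13 = pt 1" "pt (-1) = pt 11" "ln 12 = ln 0" using 2 by (simp_all add: eq eql)
    \<comment> \<open>Here position 0 has to be \<open>bc\<close>, so \<open>b\<close> and
      \<open>c\<close> are at 11, which is -1 modulo 12, and at 1.\<close>
    have "type_a_hexagon G D f g (pt 9) (pt 11) (pt 1) (pt 3) (pt 5) (pt 7)"
    proof (rule type_a_hexagonI[OF P dist _ _ _ _ _ _ fib])
      show "path_at (pt 7) (ln 8) (pt 9) (ln 10) (pt 11)" using path[of 9] by simp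
      show "path_at (pt 9) (ln 10) (pt 11) (ln 0) (pt 1)" using path[of 11] by (simp add: per)
      show "path_at (pt 11) (ln 0) (pt 1) (ln 2) (pt 3)" using path[of 1] by (simp add: per)
      show "path_at (pt 1) (ln 2) (pt 3) (ln 4) (pt 5)" using path[of 3] by simp
      show "path_at (pt 3) (ln 4) (pt 5) (ln 6) (pt 7)" using path[of 5] by simp
      show "path_at (pt 5) (ln 6) (pt 7) (ln 8) (pt 9)" using path[of 7] by simp
    qed
    then show ?thesis unfolding type_a_def using 2 by blast
  qed
qed

section \<open>Duality on incidence graphs\<close>

definition swap_sum :: "'a + 'b \<Rightarrow> 'b + 'a" where "swap_sum = case_sum Inr Inl"

lemma swap_sum_simps [simp]: "swap_sum (Inl p) = Inr p" "swap_sum (Inr l) = Inl l"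
  by (simp_all add: swap_sum_def)

lemma swap_sum_swap_sum [simp]: "swap_sum (swap_sum x) = x"
  by (cases x) simp_all

lemma swap_sum_eq_iff [simp]: "swap_sum x = swap_sum y \<longleftrightarrow> x = y"
  by (metis swap_sum_swap_sum)

lemma isl_swap_sum [simp]: "isl (swap_sum x) \<longleftrightarrow> \<not> isl x"
  by (cases x) simp_all

lemma map_sum_swap_sum [simp]: "map_sum g f (swap_sum x) = swap_sum (map_sum f g x)"
  by (cases x) simp_all

lemma incident_dual [simp]: "incident (dual G) (swap_sum x) (swap_sum y) \<longleftrightarrow> incident G x y"
  by (cases x; cases y) (simp_all add: dual_def)

lemma elements_dual [simp]: "swap_sum x \<in> elements (dual G) \<longleftrightarrow> x \<in> elements G"
  by (cases x) (simp_all add: dual_def)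

text \<open>Serves as an induction rule that carries statements about a dual geometry back to the
  original.\<close>

lemma all_swap_sum: "(\<And>x. P (swap_sum x)) \<Longrightarrow> P y"
  by (metis swap_sum_swap_sum)

lemma type_b_of_cycle:
  assumes n: "n \<in> {4, 6}" and G: "point_line_geometry G" and D: "point_line_geometry D"
    and adj: "\<And>x y. incident G x y \<Longrightarrow> incident D (map_sum f g x) (map_sum f g y)"
    and lift: "\<And>x u. x \<in> elements G \<Longrightarrow> incident D (map_sum f g x) u \<Longrightarrow> \<exists>y. incident G x y \<and> map_sum f g y = u"
    and c: "cycle_in (incident D) (2 * int n) c" "range c = elements D"
    and point: "isl (c 0)" and single: "{x \<in> elements G. map_sum f g x = c 0} = {x0}"
  shows "type_b n G D f g"
  unfolding type_b_def
proof (rule type_a_of_cycle[OF n, where c = "\<lambda>i. swap_sum (c i)" and ?x0.0 = "swap_sum x0"])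
  show "point_line_geometry (dual G)" "point_line_geometry (dual D)"
    using G D unfolding point_line_geometry_def dual_def by auto
  show "incident (dual D) (map_sum g f x) (map_sum g f y)" if "incident (dual G) x y" for x y
    using that adj by (induction x rule: all_swap_sum; induction y rule: all_swap_sum) simp
  show "\<exists>y. incident (dual G) x y \<and> map_sum g f y = u"
    if xu: "x \<in> elements (dual G)" "incident (dual D) (map_sum g f x) u" for x u
  proof -
    obtain x' u' where e: "x = swap_sum x'" "u = swap_sum u'" by (metis swap_sum_swap_sum)
    then obtain y where "incident G x' y" "map_sum f g y = u'" using lift[of x' u'] xu by auto
    then show ?thesis using e by (intro exI[of _ "swap_sum y"]) simp
  qed
  show "cycle_in (incident (dual D)) (2 * int n) (\<lambda>i. swap_sum (c i))"
    using c(1) unfolding cycle_in_def by simp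
  have "y \<in> range (\<lambda>i. swap_sum (c i)) \<longleftrightarrow> y \<in> elements (dual D)" for y
  proof (induction y rule: all_swap_sum)
    case (1 x)
    have "swap_sum x \<in> range (\<lambda>i. swap_sum (c i)) \<longleftrightarrow> x \<in> range c" by (auto simp: image_iff)
    then show ?case using c(2) by simp
  qed
  then show "range (\<lambda>i. swap_sum (c i)) = elements (dual D)" by blast
  show "\<not> isl (swap_sum (c 0))" using point by simp
  have "y \<in> {x \<in> elements (dual G). map_sum g f x = swap_sum (c 0)} \<longleftrightarrow> y \<in> {swap_sum x0}" for y
  proof (induction y rule: all_swap_sum)
    case (1 x)
    have "x \<in> {x \<in> elements G. map_sum f g x = c 0} \<longleftrightarrow> x = x0" unfolding single by simp
    then show ?case by simp
  qed
  then show "{x \<in> elements (dual G). map_sum g f x = swap_sum (c 0)} = {swap_sum x0}" by blast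
qed

section \<open>Epimorphisms onto thin polygons\<close>

lemma ecard_eq_2:
  assumes "ecard A = 1 + 1" shows "\<exists>p q. A = {p, q}"
proof -
  have "finite A" "card A = 2"
    using assms by (auto simp: ecard_def one_enat_def numeral_2_eq_2 split: if_splits)
  then show ?thesis by (auto simp: card_2_iff)
qed

lemma ecard_eq_1:
  assumes "ecard A = 0 + 1" shows "\<exists>p. A = {p}"
proof -
  have "card A = 1"
    using assms by (auto simp: ecard_def one_enat_def split: if_splits)
  then show ?thesis by (rule card_1_singletonE) blast
qed

lemma epimorphism_ngon_morphism:
  assumes "weak_polygon n G" "weak_polygon n D" "epimorphism G D f g"
  shows "ngon_morphism (elements G) (incident G) isl (elements D) (incident D) isl n (map_sum f g)"
proof -
  interpret G: ngon_graph "elements G" "incident G" isl n using assms(1) weak_polygon_iff by blast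
  interpret D: ngon_graph "elements D" "incident D" isl n using assms(2) weak_polygon_iff by blast
  have e: "f ` Pts G = Pts D" "g ` Lns G = Lns D"
    "\<And>p l. p \<in> Pts G \<Longrightarrow> l \<in> Lns G \<Longrightarrow> Inc G p l \<Longrightarrow> Inc D (f p) (g l)"
    using assms(3) unfolding epimorphism_def morphism_def by blast+
  show ?thesis
  proof
    fix x y assume a: "incident G x y"
    then have "x \<in> elements G" "y \<in> elements G" using G.adj_in G.adj_in2 by blast+
    then show "incident D (map_sum f g x) (map_sum f g y)"
      using a e(3) by (cases x; cases y) simp_all
  next
    show "map_sum f g ` elements G = elements D"
      unfolding elements_def Plus_def image_Un e(1,2)[symmetric] image_image by simp
  qed
qed

lemma (in ngon_graph) degree_two_neighbours:
  assumes c: "cycle_in adj (2 * int n) c" and two: "\<And>z. adj (c i) z \<Longrightarrow> z = u \<or> z = v"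
    and z: "adj (c i) z"
  shows "z = c (i + 1) \<or> z = c (i - 1)"
proof -
  have "adj (c i) (c (i + 1))" "adj (c i) (c (i - 1))"
    using cycle_in_adj[OF c, of i] cycle_in_adj[OF c, of "i - 1"] adj_sym by simp_all
  moreover have "c (i + 1) \<noteq> c (i - 1)"
    using n_ge_3 zdvd_not_zless[of 2 "2 * int n"] by (auto simp: cycle_in_eq[OF c])
  ultimately show ?thesis using two z by metis
qed

text \<open>The cycle uses up both neighbours of each of its vertices, so a walk ending on it never
  leaves it; the diameter provides a walk from every element.\<close>

lemma (in ngon_graph) cycle_exhausts:
  assumes c: "cycle_in adj (2 * int n) c"
    and two: "\<And>x. x \<in> V \<Longrightarrow> \<exists>u v. \<forall>z. adj x z \<longrightarrow> z = u \<or> z = v"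
  shows "range c = V"
proof
  have cV: "c i \<in> V" for i using cycle_in_adj[OF c] adj_in by blast
  then show "range c \<subseteq> V" by blast
  have "hd w \<in> range c" if "nb w" "last w = c 0" for w
    using that
  proof (induction w)
    case (Cons x w)
    show ?case
    proof (cases "w = []")
      case False
      then have "hd w \<in> range c" "adj (hd w) x"
        using Cons adj_sym by (auto simp: nb_walk_Cons)
      then obtain i where i: "adj (c i) x" by auto
      obtain u v where "\<forall>z. adj (c i) z \<longrightarrow> z = u \<or> z = v" using two[OF cV] by blast
      then have "x = c (i + 1) \<or> x = c (i - 1)" using degree_two_neighbours[OF c _ i] by blast
      then show ?thesis by auto
    qed (use Cons in simp)
  qed simp
  then show "V \<subseteq> range c" using diam[OF _ cV[of 0]] by blast
qed

theorem corollary6p4: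
  fixes \<Gamma> :: "('p, 'l) geometry" and \<Delta> :: "('q, 'm) geometry"
    and \<gamma>\<^sub>P :: "'p \<Rightarrow> 'q" and \<gamma>\<^sub>L :: "'l \<Rightarrow> 'm"
    and n :: nat and s :: enat
  assumes "n \<in> {4, 6}"
    and "thick_polygon n \<Gamma>"
    and "locally_finitely_generated n \<Gamma>"
    and "thin_polygon n \<Delta>"
    and "has_order \<Delta> s 1"
    and "epimorphism \<Gamma> \<Delta> \<gamma>\<^sub>P \<gamma>\<^sub>L"
  shows "s = 1 \<and> (type_a n \<Gamma> \<Delta> \<gamma>\<^sub>P \<gamma>\<^sub>L \<or> type_b n \<Gamma> \<Delta> \<gamma>\<^sub>P \<gamma>\<^sub>L)"
proof -
  have n: "4 \<le> n" "even n" using assms(1) by auto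
  have wG: "weak_polygon n \<Gamma>" and wD: "weak_polygon n \<Delta>"
    using assms(2,4) by (auto simp: thick_polygon_def thin_polygon_def)
  have pG: "point_line_geometry \<Gamma>" and pD: "point_line_geometry \<Delta>"
    using wG wD weak_polygon_iff by blast+
  define \<phi> where "\<phi> = map_sum \<gamma>\<^sub>P \<gamma>\<^sub>L"
  interpret ngon_morphism "elements \<Gamma>" "incident \<Gamma>" isl "elements \<Delta>" "incident \<Delta>" isl n \<phi>
    unfolding \<phi>_def by (rule epimorphism_ngon_morphism[OF wG wD assms(6)])
  have maps: "\<phi> x \<in> elements \<Delta>" if "x \<in> elements \<Gamma>" for x
    unfolding \<phi>_onto[symmetric] by (rule imageI[OF that])
  have thick: G.thick_graph by (rule thick_polygon_graph[OF assms(2)])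
  \<comment> \<open>A labelling of \<Delta> pulls back along \<phi>, so
    \<open>singleton_fibre\<close> applies to every fold of \<Delta>.\<close>
  have label: "\<exists>i x. {x \<in> elements \<Gamma>. 2 * int n dvd h (\<phi> x) - i} = {x}"
    if h: "\<And>x y. incident \<Delta> x y \<Longrightarrow> 2 * int n dvd h y - h x - 1 \<or> 2 * int n dvd h y - h x + 1"
      "\<And>i. \<exists>z\<in>elements \<Delta>. 2 * int n dvd h z - i" for h
  proof (rule singleton_fibre[OF assms(2,3)])
    show "2 * int n dvd h (\<phi> y) - h (\<phi> x) - 1 \<or> 2 * int n dvd h (\<phi> y) - h (\<phi> x) + 1"
      if "incident \<Gamma> x y" for x y using h(1)[OF \<phi>_adj[OF that]] .
    show "\<exists>x\<in>elements \<Gamma>. 2 * int n dvd h (\<phi> x) - i" for i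
      using h(2)[of i] preimage_ex by metis
  qed
  have point_degree: "\<exists>u v. \<forall>z. incident \<Delta> x z \<longrightarrow> z = u \<or> z = v" if x: "x \<in> elements \<Delta>" "isl x" for x
  proof -
    obtain p where p: "x = Inl p" "p \<in> Pts \<Delta>" using x by (cases x) auto
    have "ecard (lines_through \<Delta> p) = 1 + 1" using assms(5) p(2) unfolding has_order_def by blast
    then obtain l m where lm: "lines_through \<Delta> p = {l, m}" using ecard_eq_2 by blast
    have "z = Inr l \<or> z = Inr m" if z: "incident \<Delta> x z" for z
    proof -
      obtain k where k: "z = Inr k" "Inc \<Delta> p k" using z p(1) by (cases z) auto
      then have "k \<in> lines_through \<Delta> p"
        using pD unfolding lines_through_def point_line_geometry_def by blast
      then show ?thesis using k(1) lm by blast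
    qed
    then show ?thesis by blast
  qed
  obtain q where "q \<in> Pts \<Delta>" using pD unfolding point_line_geometry_def by blast
  then have "Inl q \<in> elements \<Delta>" by simp
  then obtain c' where c': "cycle_in (incident \<Delta>) (2 * int n) c'"
    using D.cycle_through[of "Inl q" "Inl q"] by metis
  obtain k where k: "isl (c' k)" using cycle_isl[OF c', of 1] by (cases "isl (c' 0)") auto
  \<comment> \<open>The shift puts points at even positions; as \<open>n\<close> is even,
    \<open>c 0\<close> and \<open>c n\<close> are opposite points.\<close>
  define c where "c i = c' (i + k)" for i
  have c: "cycle_in (incident \<Delta>) (2 * int n) c" unfolding c_def by (rule cycle_in_shift[OF c'])
  have isl: "isl (c i) \<longleftrightarrow> even i" for i using cycle_isl[OF c, of i] k unfolding c_def by simp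
  have cV: "c i \<in> elements \<Delta>" for i by (rule D.adj_in[OF cycle_in_adj[OF c]])
  have near_c: "z = c (i + 1) \<or> z = c (i - 1)" if i: "even i" and z: "incident \<Delta> (c i) z" for i z
  proof -
    obtain u v where "\<forall>z. incident \<Delta> (c i) z \<longrightarrow> z = u \<or> z = v"
      using point_degree[OF cV[of i]] isl[of i] i by blast
    then show ?thesis by (intro D.degree_two_neighbours[OF c _ z]) blast
  qed
  have s: "s = 1"
  proof (rule ccontr)
    assume s1: "s \<noteq> 1"
    have order: "ecard (points_on \<Delta> l) = s + 1" if "l \<in> Lns \<Delta>" for l
      using assms(5) that unfolding has_order_def by blast
    have "s \<noteq> 0"
    proof
      assume s0: "s = 0"
      obtain l where l: "c 1 = Inr l" using isl[of 1] by (cases "c 1") auto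
      have "l \<in> Lns \<Delta>" using cV[of 1] l by simp
      then obtain q where q: "points_on \<Delta> l = {q}" using order[of l] ecard_eq_1 unfolding s0 by blast
      obtain z where z: "incident \<Delta> (c 1) z" "z \<noteq> Inl q" using D.another_neighbour[OF cV] by blast
      then obtain p where p: "z = Inl p" "Inc \<Delta> p l" using l by (cases z) auto
      then have "p \<in> points_on \<Delta> l"
        using pD unfolding points_on_def point_line_geometry_def by blast
      then show False using q p z(2) by blast
    qed
    then have s3: "3 \<le> s + 1"
      using s1 by (cases s) (auto simp: numeral_eq_enat one_enat_def zero_enat_def)
    have thick_lines: "\<exists>u. incident \<Delta> x u \<and> u \<noteq> a \<and> u \<noteq> b" if x: "x \<in> elements \<Delta>" "\<not> isl x" for x a b
    proof -
      obtain l where l: "x = Inr l" "l \<in> Lns \<Delta>" using x by (cases x) auto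
      obtain p where "p \<in> points_on \<Delta> l" "p \<noteq> projl a" "p \<noteq> projl b"
        using ecard_ge_3[of "points_on \<Delta> l" "projl a" "projl b"] order[OF l(2)] s3 by auto
      then show ?thesis using l(1) unfolding points_on_def by (intro exI[of _ "Inl p"]) auto
    qed
    \<comment> \<open>The fold singles out one \<open>x\<close>. If \<open>\<phi> x\<close> were at
      distance 2 or more from \<open>p\<close>, another element with the same folded label would
      have a preimage, which would be a second element of that fibre.\<close>
    have near: "\<exists>z x. (z = p \<or> incident \<Delta> p z) \<and> {y \<in> elements \<Gamma>. \<phi> y = z} = {x}"
      if p: "p \<in> elements \<Delta>" "isl p" for p
    proof -
      obtain l where l: "incident \<Delta> p l" using D.another_neighbour[OF p(1)] by blast
      let ?h = "D.fold_label p l"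
      obtain i x where x: "{x \<in> elements \<Gamma>. 2 * int n dvd ?h (\<phi> x) - i} = {x}"
        using label[of ?h, OF D.fold_label_adj[OF p(1)] D.fold_label_surj[OF p(1) l]] by blast
      have xG: "x \<in> elements \<Gamma>" "2 * int n dvd ?h (\<phi> x) - i" using x by blast+
      have zD: "\<phi> x \<in> elements \<Delta>" by (rule maps[OF xG(1)])
      have same: "y = x" if "y \<in> elements \<Gamma>" "2 * int n dvd ?h (\<phi> y) - ?h (\<phi> x)" for y
      proof -
        have "2 * int n dvd ?h (\<phi> y) - i" using dvd_add[OF that(2) xG(2)] by simp
        then show ?thesis using that(1) x by blast
      qed
      have "\<not> 2 \<le> D.dist (\<phi> x) p"
      proof
        assume "2 \<le> D.dist (\<phi> x) p"
        then obtain z' where z': "z' \<in> elements \<Delta>" "z' \<noteq> \<phi> x" "2 * int n dvd ?h z' - ?h (\<phi> x)"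
          using D.fold_label_not_inj[OF p(1) n(2) zD] thick_lines p(2) by metis
        obtain y where "y \<in> elements \<Gamma>" "\<phi> y = z'" using preimage_ex[OF z'(1)] by blast
        then show False using same[of y] z'(2,3) by blast
      qed
      moreover obtain w where w: "D.nb w" "hd w = \<phi> x" "last w = p" "length w = Suc (D.dist (\<phi> x) p)"
        using D.dist_walk[OF zD p(1)] by blast
      ultimately have "\<phi> x = p \<or> incident \<Delta> (\<phi> x) p"
        by (cases w; cases "tl w"; cases "tl (tl w)") (auto simp: nb_walk_Cons)
      then have "\<phi> x = p \<or> incident \<Delta> p (\<phi> x)" using D.adj_sym by blast
      moreover have "{y \<in> elements \<Gamma>. \<phi> y = \<phi> x} = {x}" using same xG(1) by auto
      ultimately show ?thesis by blast
    qed
    have near': "\<exists>i x. j - 1 \<le> i \<and> i \<le> j + 1 \<and> {y \<in> elements \<Gamma>. \<phi> y = c i} = {x}" if j: "even j" for j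
    proof -
      obtain z x where z: "z = c j \<or> incident \<Delta> (c j) z" "{y \<in> elements \<Gamma>. \<phi> y = z} = {x}"
        using near[OF cV, of j] isl j by blast
      then consider "z = c j" | "z = c (j + 1)" | "z = c (j - 1)" using near_c[OF j] by blast
      then show ?thesis
      proof cases
        case 1 then show ?thesis using z(2) by (intro exI[of _ j] exI[of _ x]) simp
      next
        case 2 then show ?thesis using z(2) by (intro exI[of _ "j + 1"] exI[of _ x]) simp
      next
        case 3 then show ?thesis using z(2) by (intro exI[of _ "j - 1"] exI[of _ x]) simp
      qed
    qed
    obtain i x0 where i: "0 - 1 \<le> i" "i \<le> 0 + 1" "{y \<in> elements \<Gamma>. \<phi> y = c i} = {x0}"
      using near'[of 0] by auto
    obtain j x1 where j: "int n - 1 \<le> j" "j \<le> int n + 1" "{y \<in> elements \<Gamma>. \<phi> y = c j} = {x1}"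
      using near'[of "int n"] n(2) by auto
    have "z = c 1 \<or> z = c 3" if "incident \<Delta> (c 2) z" for z using near_c[OF _ that] by auto
    then show False using two_far_singletons[OF thick c n(1) _ _ _ i(3) j] i(1,2) by simp
  qed
  have line_degree: "\<exists>u v. \<forall>z. incident \<Delta> x z \<longrightarrow> z = u \<or> z = v" if x: "x \<in> elements \<Delta>" "\<not> isl x" for x
  proof -
    obtain l where l: "x = Inr l" "l \<in> Lns \<Delta>" using x by (cases x) auto
    have "ecard (points_on \<Delta> l) = 1 + 1" using assms(5) l(2) s unfolding has_order_def by blast
    then obtain p q where pq: "points_on \<Delta> l = {p, q}" using ecard_eq_2 by blast
    have "z = Inl p \<or> z = Inl q" if z: "incident \<Delta> x z" for z
    proof -
      obtain r where r: "z = Inl r" "Inc \<Delta> r l" using z l(1) by (cases z) auto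
      then have "r \<in> points_on \<Delta> l"
        using pD unfolding points_on_def point_line_geometry_def by blast
      then show ?thesis using r(1) pq by blast
    qed
    then show ?thesis by blast
  qed
  have range_c: "range c = elements \<Delta>"
    by (rule D.cycle_exhausts[OF c]) (use point_degree line_degree in blast)
  \<comment> \<open>Any index will do, since positions matter only modulo
    \<open>2 * n\<close>.\<close>
  define h where "h z = (SOME i. c i = z)" for z
  have ch: "c (h z) = z" if "z \<in> elements \<Delta>" for z
  proof -
    have "z \<in> range c" using that range_c by simp
    then have "\<exists>i. c i = z" by auto
    then show ?thesis unfolding h_def by (rule someI_ex)
  qed
  have "\<exists>i x. {x \<in> elements \<Gamma>. 2 * int n dvd h (\<phi> x) - i} = {x}"
  proof (rule label)
    fix x y assume a: "incident \<Delta> x y"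
    then have xy: "c (h x) = x" "c (h y) = y"
      using ch[OF D.adj_in[OF a]] ch[OF D.adj_in2[OF a]] by simp_all
    have "y = c (h x + 1) \<or> y = c (h x - 1)"
      using cycle_neighbours[OF c range_c pD, of "h x" y] a xy(1) by simp
    then have "c (h y) = c (h x + 1) \<or> c (h y) = c (h x - 1)" using xy(2) by simp
    then show "2 * int n dvd h y - h x - 1 \<or> 2 * int n dvd h y - h x + 1"
      unfolding cycle_in_eq[OF c] by (simp add: algebra_simps)
  next
    fix i
    have "c (h (c i)) = c i" by (rule ch[OF cV])
    then have "2 * int n dvd h (c i) - i" unfolding cycle_in_eq[OF c] .
    then show "\<exists>z\<in>elements \<Delta>. 2 * int n dvd h z - i" using cV by blast
  qed
  then obtain i x0 where x0: "{x \<in> elements \<Gamma>. 2 * int n dvd h (\<phi> x) - i} = {x0}" by blast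
  define d where "d j = c (j + i)" for j
  have d: "cycle_in (incident \<Delta>) (2 * int n) d" unfolding d_def by (rule cycle_in_shift[OF c])
  have range_d: "range d = elements \<Delta>"
  proof -
    have "c j = d (j - i)" for j unfolding d_def by simp
    then have "range c \<subseteq> range d" by (metis image_subsetI rangeI)
    moreover have "range d \<subseteq> range c" unfolding d_def by blast
    ultimately show ?thesis using range_c by blast
  qed
  have "\<phi> x = d 0 \<longleftrightarrow> 2 * int n dvd h (\<phi> x) - i" if "x \<in> elements \<Gamma>" for x
    using cycle_in_eq[OF c, of "h (\<phi> x)" i] ch[OF maps[OF that]] unfolding d_def by simp
  then have single: "{x \<in> elements \<Gamma>. \<phi> x = d 0} = {x0}" using x0 by blast
  note data = \<phi>_adj[unfolded \<phi>_def] locally_onto[unfolded \<phi>_def] d range_d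
  show ?thesis
  proof (cases "isl (d 0)")
    case True
    have "type_b n \<Gamma> \<Delta> \<gamma>\<^sub>P \<gamma>\<^sub>L"
      by (rule type_b_of_cycle[OF assms(1) pG pD data True single[unfolded \<phi>_def]])
    then show ?thesis using s by blast
  next
    case False
    have "type_a n \<Gamma> \<Delta> \<gamma>\<^sub>P \<gamma>\<^sub>L"
      by (rule type_a_of_cycle[OF assms(1) pG pD data False single[unfolded \<phi>_def]])
    then show ?thesis using s by blast
  qed
qed

end
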